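(* Let $k$ be a field of characteristic zero and let $(R,\Delta)$ be a commutative differential $k$-algebra. Suppose that $R$ is noetherian, $\dim_k R<|k|$ and $|\Delta|<|k|$. Then the following are equivalent: (i) $R$ satisfies the $\Delta$-Dixmier-Moeglin equivalence; (ii) every $\Delta$-rational ideal of $R$ is locally closed in $\Delta\text{-}{\rm spec}\,R$; (iii) every $\Delta$-primitive ideal of $R$ is locally closed in $\Delta\text{-}{\rm spec}\,R$; (iv) in the topological space $\Delta\text{-}{\rm spec}\,R$, every $\Delta$-prime ideal that is $|k|$-separable is $\aleph_0$-separable; (v) in the poset $(\Delta\text{-}{\rm spec}\,R,\subseteq)$, every $\Delta$-prime ideal that is $|k|$-separable is $\aleph_0$-separable.
   Context: A commutative differential $k$-algebra is a pair $(R,\Delta)$ with $R$ a commutative $k$-algebra and $\Delta\subseteq{\rm Der}_k R$ a subset of $k$-linear derivations. A $\Delta$-ideal is an ideal $I$ with $\delta(I)\subseteq I$ for all $\delta\in\Delta$. A $\Delta$-prime ideal is a proper $\Delta$-ideal that is prime among $\Delta$-ideals; for noetherian $R$ these are exactly the prime ideals that are $\Delta$-ideals. $\Delta\text{-}{\rm spec}\,R$ is the set of $\Delta$-prime ideals with the subspace topology from ${\rm spec}\,R$. The $\Delta$-core $(J:\Delta)$ of an ideal $J$ is the largest $\Delta$-ideal contained in $J$. A $\Delta$-primitive ideal is the $\Delta$-core of a maximal ideal. For a $\Delta$-prime ideal $P$, derivations in $\Delta$ induce derivations on $R/P$ and extend uniquely to ${\rm Frac}(R/P)$; $Z_\Delta({\rm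 Frac}\,R/P)$ is the subfield of elements killed by all $\delta\in\Delta$, and $P$ is $\Delta$-rational if this field is algebraic over $k$. $P$ is locally closed if $\{P\}$ is the intersection of an open and a closed subset of $\Delta\text{-}{\rm spec}\,R$. $R$ satisfies the $\Delta$-Dixmier-Moeglin equivalence if for every $P\in\Delta\text{-}{\rm spec}\,R$: $P$ is locally closed in $\Delta\text{-}{\rm spec}\,R$ $\iff$ $P$ is $\Delta$-primitive $\iff$ $P$ is $\Delta$-rational. Let $\kappa$ be a cardinal. A point $p$ of a topological space $X$ is $\kappa$-separable if there is a subset $\Lambda\subseteq\overline{\{p\}}\setminus\{p\}$ of cardinality strictly less than $\kappa$ with $\overline{\{p\}}\setminus\{p\}=\bigcup_{q\in\Lambda}\overline{\{q\}}$. An element $s$ of a poset $(S,\le)$ is $\kappa$-separable if the set of covers of $s$ (the minimal elements of $\{t\in S: s\lneqq t\}$) has cardinality strictly less than $\kappa$. *)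

theory Defs
  imports "HOL-Analysis.Abstract_Topology" "HOL-Algebra.Algebra"
begin

unbundle cardinal_syntax

definition char_zero :: "('k, 'm) ring_scheme \<Rightarrow> bool" where
  "char_zero K \<longleftrightarrow> (\<forall>n::nat. n > 0 \<longrightarrow> add_pow K n \<one>\<^bsub>K\<^esub> \<noteq> \<zero>\<^bsub>K\<^esub>)"

definition lin_indep :: "('k, 'm) ring_scheme \<Rightarrow> ('k, 'a, 'n) module_scheme \<Rightarrow> 'a set \<Rightarrow> bool" where
  "lin_indep K M B \<longleftrightarrow>
     (\<forall>A c. finite A \<and> A \<subseteq> B \<and> c \<in> A \<rightarrow> carrier K \<and> (\<Oplus>\<^bsub>M\<^esub>b\<in>A. c b \<odot>\<^bsub>M\<^esub> b) = \<zero>\<^bsub>M\<^esub>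
        \<longrightarrow> (\<forall>b\<in>A. c b = \<zero>\<^bsub>K\<^esub>))"

definition lin_span :: "('k, 'm) ring_scheme \<Rightarrow> ('k, 'a, 'n) module_scheme \<Rightarrow> 'a set \<Rightarrow> 'a set" where
  "lin_span K M B = {\<Oplus>\<^bsub>M\<^esub>b\<in>A. c b \<odot>\<^bsub>M\<^esub> b | A c. finite A \<and> A \<subseteq> B \<and> c \<in> A \<rightarrow> carrier K}"

definition lin_basis :: "('k, 'm) ring_scheme \<Rightarrow> ('k, 'a, 'n) module_scheme \<Rightarrow> 'a set \<Rightarrow> bool" where
  "lin_basis K M B \<longleftrightarrow> B \<subseteq> carrier M \<and> lin_indep K M B \<and> lin_span K M B = carrier M"

text \<open>
  Derivations are extensional functions on the carrier. Otherwise one derivation would be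
  represented by many HOL functions differing outside the carrier, and the cardinality of a
  set of derivations would be wrong.
\<close>

definition ring_der :: "('a, 'n) ring_scheme \<Rightarrow> ('a \<Rightarrow> 'a) set" where
  "ring_der R = {\<delta> \<in> carrier R \<rightarrow>\<^sub>E carrier R. \<forall>a\<in>carrier R. \<forall>b\<in>carrier R.
     \<delta> (a \<oplus>\<^bsub>R\<^esub> b) = \<delta> a \<oplus>\<^bsub>R\<^esub> \<delta> b \<and>
     \<delta> (a \<otimes>\<^bsub>R\<^esub> b) = \<delta> a \<otimes>\<^bsub>R\<^esub> b \<oplus>\<^bsub>R\<^esub> a \<otimes>\<^bsub>R\<^esub> \<delta> b}"

definition Der :: "('k, 'm) ring_scheme \<Rightarrow> ('k, 'a, 'n) module_scheme \<Rightarrow> ('a \<Rightarrow> 'a) set" where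
  "Der K R = {\<delta> \<in> ring_der R. \<forall>c\<in>carrier K. \<forall>a\<in>carrier R. \<delta> (c \<odot>\<^bsub>R\<^esub> a) = c \<odot>\<^bsub>R\<^esub> \<delta> a}"

locale comm_diff_algebra = algebra K R
    for K :: "('k, 'm) ring_scheme" (structure) and R :: "('k, 'a, 'n) module_scheme" (structure) +
  fixes \<Delta> :: "('a \<Rightarrow> 'a) set"
  assumes derivations: "\<Delta> \<subseteq> Der K R"

definition delta_ideal :: "('a, 'n) ring_scheme \<Rightarrow> ('a \<Rightarrow> 'a) set \<Rightarrow> 'a set \<Rightarrow> bool" where
  "delta_ideal R \<Delta> I \<longleftrightarrow> ideal I R \<and> (\<forall>\<delta>\<in>\<Delta>. \<delta> ` I \<subseteq> I)"

text \<open>Prime among \<open>\<Delta>\<close>-ideals; \<open>I \<cdot>\<^bsub>R\<^esub> J\<close> is the ideal product.\<close>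

definition delta_prime :: "('a, 'n) ring_scheme \<Rightarrow> ('a \<Rightarrow> 'a) set \<Rightarrow> 'a set \<Rightarrow> bool" where
  "delta_prime R \<Delta> P \<longleftrightarrow> delta_ideal R \<Delta> P \<and> P \<noteq> carrier R \<and>
     (\<forall>I J. delta_ideal R \<Delta> I \<and> delta_ideal R \<Delta> J \<and> I \<cdot>\<^bsub>R\<^esub> J \<subseteq> P \<longrightarrow> I \<subseteq> P \<or> J \<subseteq> P)"

definition delta_spec :: "('a, 'n) ring_scheme \<Rightarrow> ('a \<Rightarrow> 'a) set \<Rightarrow> 'a set set" where
  "delta_spec R \<Delta> = {P. delta_prime R \<Delta> P}"

definition delta_core :: "('a, 'n) ring_scheme \<Rightarrow> ('a \<Rightarrow> 'a) set \<Rightarrow> 'a set \<Rightarrow> 'a set" where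
  "delta_core R \<Delta> J = (GREATEST I. delta_ideal R \<Delta> I \<and> I \<subseteq> J)"

definition delta_primitive :: "('a, 'n) ring_scheme \<Rightarrow> ('a \<Rightarrow> 'a) set \<Rightarrow> 'a set \<Rightarrow> bool" where
  "delta_primitive R \<Delta> P \<longleftrightarrow> (\<exists>M. maximalideal M R \<and> P = delta_core R \<Delta> M)"

text \<open>The largest \<open>\<Delta>\<close>-ideal inside an ideal \<open>J\<close> exists: it consists of the
  elements all of whose iterated derivatives lie in \<open>J\<close>.\<close>

lemma (in comm_diff_algebra) delta_core_greatest:
  assumes J: "ideal J R"
  shows "delta_ideal R \<Delta> (delta_core R \<Delta> J)" "delta_core R \<Delta> J \<subseteq> J"
    "\<And>I. delta_ideal R \<Delta> I \<Longrightarrow> I \<subseteq> J \<Longrightarrow> I \<subseteq> delta_core R \<Delta> J"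
proof -
  interpret J: ideal J R by fact
  have cr: "cring R" by unfold_locales
  define D :: "('a \<Rightarrow> 'a) list \<Rightarrow> 'a \<Rightarrow> 'a"
    where "D ds = foldr (\<lambda>\<delta> f. \<delta> \<circ> f) ds id" for ds
  define C where "C = {x \<in> carrier R. \<forall>ds. set ds \<subseteq> \<Delta> \<longrightarrow> D ds x \<in> J}"
  have der: "\<delta> \<in> ring_der R" if "\<delta> \<in> \<Delta>" for \<delta>
    using derivations that by (auto simp: Der_def)
  have D_Cons: "D (\<delta> # ds) x = \<delta> (D ds x)" and D_Nil: "D [] x = x" for \<delta> ds x
    by (simp_all add: D_def)
  have D_app: "D (ds @ es) x = D ds (D es x)" for ds es x
    by (induction ds) (simp_all add: D_def)
  have clos: "D ds x \<in> carrier R" if "set ds \<subseteq> \<Delta>" "x \<in> carrier R" for ds x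
    using that by (induction ds) (use der in \<open>auto simp: D_Cons D_Nil ring_der_def\<close>)
  have D_add: "D ds (x \<oplus>\<^bsub>R\<^esub> y) = D ds x \<oplus>\<^bsub>R\<^esub> D ds y"
    if "set ds \<subseteq> \<Delta>" "x \<in> carrier R" "y \<in> carrier R" for ds x y
    using that by (induction ds) (use der clos in \<open>auto simp: D_Cons D_Nil ring_der_def\<close>)
  have C_add: "x \<oplus>\<^bsub>R\<^esub> y \<in> C" if "x \<in> C" "y \<in> C" for x y
    using that by (auto simp: C_def D_add)
  have C_der: "\<delta> x \<in> C" if "x \<in> C" "\<delta> \<in> \<Delta>" for x \<delta>
  proof -
    have "D ds (\<delta> x) \<in> J" if "set ds \<subseteq> \<Delta>" for ds
    proof -
      have "D (ds @ [\<delta>]) x \<in> J" using \<open>x \<in> C\<close> \<open>\<delta> \<in> \<Delta>\<close> that by (simp add: C_def)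
      thus ?thesis by (simp add: D_app D_Cons D_Nil)
    qed
    thus ?thesis using that clos[of "[\<delta>]" x] by (auto simp: C_def D_Cons D_Nil)
  qed
  have mult: "D ds (r \<otimes>\<^bsub>R\<^esub> x) \<in> J"
    if "set ds \<subseteq> \<Delta>" "r \<in> carrier R" "x \<in> C" for ds r x
    using that
  proof (induction ds arbitrary: r x rule: rev_induct)
    case Nil
    then show ?case using J.I_l_closed D_Nil[of x]
      by (auto simp: C_def D_Nil dest: spec[of _ "[]"])
  next
    case (snoc \<delta> ds)
    have d: "\<delta> \<in> \<Delta>" and ds: "set ds \<subseteq> \<Delta>" using snoc.prems by auto
    have x: "x \<in> carrier R" using snoc.prems by (simp add: C_def)
    have dr: "\<delta> r \<in> carrier R" using der[OF d] snoc.prems by (auto simp: ring_der_def)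
    have dx: "\<delta> x \<in> C" using C_der d snoc.prems by blast
    hence dxc: "\<delta> x \<in> carrier R" by (simp add: C_def)
    have "D (ds @ [\<delta>]) (r \<otimes>\<^bsub>R\<^esub> x) = D ds (\<delta> r \<otimes>\<^bsub>R\<^esub> x \<oplus>\<^bsub>R\<^esub> r \<otimes>\<^bsub>R\<^esub> \<delta> x)"
      using der[OF d] snoc.prems x by (simp add: D_app D_Cons D_Nil ring_der_def)
    also have "\<dots> = D ds (\<delta> r \<otimes>\<^bsub>R\<^esub> x) \<oplus>\<^bsub>R\<^esub> D ds (r \<otimes>\<^bsub>R\<^esub> \<delta> x)"
      using ds dr x snoc.prems dxc by (intro D_add) auto
    also have "\<dots> \<in> J"
      using snoc.IH[OF ds dr snoc.prems(3)] snoc.IH[OF ds snoc.prems(2) dx] by simp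
    finally show ?case .
  qed
  have C_mult: "r \<otimes>\<^bsub>R\<^esub> x \<in> C" if "r \<in> carrier R" "x \<in> C" for r x
    using that mult by (auto simp: C_def)
  have C_zero: "\<zero>\<^bsub>R\<^esub> \<in> C"
  proof -
    have "D ds \<zero>\<^bsub>R\<^esub> = \<zero>\<^bsub>R\<^esub>" if "set ds \<subseteq> \<Delta>" for ds
      using D_add[OF that, of "\<zero>\<^bsub>R\<^esub>" "\<zero>\<^bsub>R\<^esub>"] clos[OF that, of "\<zero>\<^bsub>R\<^esub>"]
      by (metis M.add.l_cancel_one M.l_zero M.zero_closed)
    thus ?thesis by (simp add: C_def)
  qed
  have C_carr: "C \<subseteq> carrier R" by (auto simp: C_def)
  have "ideal C R"
  proof (rule idealI)
    show "subgroup C (add_monoid R)"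
    proof (rule M.add.subgroupI)
      show "C \<subseteq> carrier R" "C \<noteq> {}" using C_carr C_zero by auto
      fix a assume a: "a \<in> C"
      have "\<ominus>\<^bsub>R\<^esub> a = (\<ominus>\<^bsub>R\<^esub> \<one>\<^bsub>R\<^esub>) \<otimes>\<^bsub>R\<^esub> a" 
        using a C_carr ring.l_minus[OF cring.axioms(1)[OF cr], of "\<one>\<^bsub>R\<^esub>" a] by (simp add: subset_iff)
      thus "\<ominus>\<^bsub>R\<^esub> a \<in> C" using C_mult[of "\<ominus>\<^bsub>R\<^esub> \<one>\<^bsub>R\<^esub>" a] a by simp
    qed (rule C_add)
  next
    fix a x assume ax: "a \<in> C" "x \<in> carrier R"
    show "x \<otimes>\<^bsub>R\<^esub> a \<in> C" using C_mult ax by blast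
    thus "a \<otimes>\<^bsub>R\<^esub> x \<in> C" using ax C_carr cring.cring_simprules(14)[OF cr] by (metis subsetD)
  qed (use cr cring.axioms(1) in blast)
  hence C_ideal: "delta_ideal R \<Delta> C" using C_der by (auto simp: delta_ideal_def)
  have C_sub: "C \<subseteq> J" unfolding C_def using D_Nil by (auto dest: spec[of _ "[]"])
  have C_max: "I \<subseteq> C" if I: "delta_ideal R \<Delta> I" "I \<subseteq> J" for I
  proof
    fix x assume x: "x \<in> I"
    have "D ds x \<in> I" if "set ds \<subseteq> \<Delta>" for ds
      using that by (induction ds) (use I x in \<open>auto simp: D_Cons D_Nil delta_ideal_def image_subset_iff\<close>)
    moreover have "x \<in> carrier R"
      using I x by (auto simp: delta_ideal_def dest: ideal.Icarr)
    ultimately show "x \<in> C" using I by (auto simp: C_def)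
  qed
  have "delta_core R \<Delta> J = C"
    unfolding delta_core_def by (rule Greatest_equality) (use C_ideal C_sub C_max in auto)
  thus "delta_ideal R \<Delta> (delta_core R \<Delta> J)" "delta_core R \<Delta> J \<subseteq> J"
    "\<And>I. delta_ideal R \<Delta> I \<Longrightarrow> I \<subseteq> J \<Longrightarrow> I \<subseteq> delta_core R \<Delta> J"
    using C_ideal C_sub C_max by simp_all
qed

definition fraction_rel :: "('a, 'n) ring_scheme \<Rightarrow> (('a \<times> 'a) \<times> ('a \<times> 'a)) set" where
  "fraction_rel D = {((a, b), (c, d)).
     a \<in> carrier D \<and> b \<in> carrier D - {\<zero>\<^bsub>D\<^esub>} \<and> c \<in> carrier D \<and> d \<in> carrier D - {\<zero>\<^bsub>D\<^esub>} \<and>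
     a \<otimes>\<^bsub>D\<^esub> d = c \<otimes>\<^bsub>D\<^esub> b}"

definition fraction :: "('a, 'n) ring_scheme \<Rightarrow> 'a \<Rightarrow> 'a \<Rightarrow> ('a \<times> 'a) set" where
  "fraction D a b = fraction_rel D `` {(a, b)}"

definition Frac :: "('a, 'n) ring_scheme \<Rightarrow> ('a \<times> 'a) set ring" where
  "Frac D = \<lparr>
     partial_object.carrier = (carrier D \<times> (carrier D - {\<zero>\<^bsub>D\<^esub>})) // fraction_rel D,
     monoid.mult = (\<lambda>U V. \<Union>(a, b)\<in>U. \<Union>(c, d)\<in>V. fraction D (a \<otimes>\<^bsub>D\<^esub> c) (b \<otimes>\<^bsub>D\<^esub> d)),
     monoid.one = fraction D \<one>\<^bsub>D\<^esub> \<one>\<^bsub>D\<^esub>,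
     ring.zero = fraction D \<zero>\<^bsub>D\<^esub> \<one>\<^bsub>D\<^esub>,
     ring.add = (\<lambda>U V. \<Union>(a, b)\<in>U. \<Union>(c, d)\<in>V.
       fraction D (a \<otimes>\<^bsub>D\<^esub> d \<oplus>\<^bsub>D\<^esub> c \<otimes>\<^bsub>D\<^esub> b) (b \<otimes>\<^bsub>D\<^esub> d))\<rparr>"

definition quot_der :: "('a, 'n) ring_scheme \<Rightarrow> 'a set \<Rightarrow> ('a \<Rightarrow> 'a) \<Rightarrow> 'a set \<Rightarrow> 'a set" where
  "quot_der R P \<delta> = (\<lambda>U\<in>carrier (R Quot P). \<Union>x\<in>U. P +>\<^bsub>R\<^esub> \<delta> x)"

definition frac_der :: "('a, 'n) ring_scheme \<Rightarrow> ('a \<Rightarrow> 'a) \<Rightarrow> ('a \<times> 'a) set \<Rightarrow> ('a \<times> 'a) set" where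
  "frac_der D \<delta> = (\<lambda>U\<in>carrier (Frac D).
     \<Union>(a, b)\<in>U. fraction D (\<delta> a \<otimes>\<^bsub>D\<^esub> b \<ominus>\<^bsub>D\<^esub> a \<otimes>\<^bsub>D\<^esub> \<delta> b) (b \<otimes>\<^bsub>D\<^esub> b))"

context "domain"
begin

lemma equiv_fraction_rel: "equiv (carrier R \<times> (carrier R - {\<zero>})) (fraction_rel R)"
proof (rule equivI)
  show "fraction_rel R \<subseteq> (carrier R \<times> (carrier R - {\<zero>})) \<times> (carrier R \<times> (carrier R - {\<zero>}))"
    by (auto simp: fraction_rel_def)
  show "refl_on (carrier R \<times> (carrier R - {\<zero>})) (fraction_rel R)"
    by (auto simp: refl_on_def fraction_rel_def)
  show "sym (fraction_rel R)" by (auto simp: sym_def fraction_rel_def)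
  show "trans (fraction_rel R)"
  proof (rule transI, clarify)
    fix a b c d e f
    assume "((a, b), (c, d)) \<in> fraction_rel R" "((c, d), (e, f)) \<in> fraction_rel R"
    hence c: "a \<in> carrier R" "b \<in> carrier R" "c \<in> carrier R" "d \<in> carrier R" "e \<in> carrier R"
      "f \<in> carrier R" "b \<noteq> \<zero>" "d \<noteq> \<zero>" "f \<noteq> \<zero>"
      and e: "a \<otimes> d = c \<otimes> b" "c \<otimes> f = e \<otimes> d"
      by (auto simp: fraction_rel_def)
    have "d \<otimes> (a \<otimes> f) = (a \<otimes> d) \<otimes> f" using c by algebra
    also have "\<dots> = (c \<otimes> f) \<otimes> b" unfolding e(1) using c by algebra
    also have "\<dots> = d \<otimes> (e \<otimes> b)" unfolding e(2) using c by algebra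
    finally have "a \<otimes> f = e \<otimes> b" using c by (simp add: m_lcancel)
    thus "((a, b), (e, f)) \<in> fraction_rel R" using c by (simp add: fraction_rel_def)
  qed
qed

lemma fraction_eq_iff:
  assumes "a \<in> carrier R" "b \<in> carrier R - {\<zero>}" "c \<in> carrier R" "d \<in> carrier R - {\<zero>}"
  shows "fraction R a b = fraction R c d \<longleftrightarrow> a \<otimes> d = c \<otimes> b"
  unfolding fraction_def using assms
  by (subst eq_equiv_class_iff[OF equiv_fraction_rel]) (auto simp: fraction_rel_def)

lemma mem_fraction_iff:
  assumes "a \<in> carrier R" "b \<in> carrier R - {\<zero>}"
  shows "(c, d) \<in> fraction R a b \<longleftrightarrow> c \<in> carrier R \<and> d \<in> carrier R - {\<zero>} \<and> a \<otimes> d = c \<otimes> b"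
  using assms by (auto simp: fraction_def fraction_rel_def)

lemma fraction_closed [simp]:
  "a \<in> carrier R \<Longrightarrow> b \<in> carrier R - {\<zero>} \<Longrightarrow> fraction R a b \<in> carrier (Frac R)"
  by (auto simp: Frac_def fraction_def intro!: quotientI)

lemma fraction_cases:
  assumes "U \<in> carrier (Frac R)"
  obtains a b where "a \<in> carrier R" "b \<in> carrier R" "b \<noteq> \<zero>" "U = fraction R a b"
  using assms by (auto simp: Frac_def fraction_def elim!: quotientE)

lemma nonzero_prod:
  "b \<in> carrier R - {\<zero>} \<Longrightarrow> d \<in> carrier R - {\<zero>} \<Longrightarrow> b \<otimes> d \<in> carrier R - {\<zero>}"
  using integral by auto

lemma fraction_UN1:
  assumes "a \<in> carrier R" "b \<in> carrier R - {\<zero>}"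
    and "\<And>a' b'. a' \<in> carrier R \<Longrightarrow> b' \<in> carrier R \<Longrightarrow> b' \<noteq> \<zero> \<Longrightarrow> a \<otimes> b' = a' \<otimes> b \<Longrightarrow> f a' b' = f a b"
  shows "(\<Union>(a', b')\<in>fraction R a b. f a' b') = f a b"
proof -
  have mem: "(a, b) \<in> fraction R a b" using assms(1,2) by (simp add: mem_fraction_iff)
  have "(\<Union>(a', b')\<in>fraction R a b. f a' b') = (\<Union>p\<in>fraction R a b. f a b)"
  proof (rule SUP_cong[OF refl])
    fix p assume p: "p \<in> fraction R a b"
    obtain a' b' where p': "p = (a', b')" by (cases p)
    have "f a' b' = f a b"
      using p assms(1,2) unfolding p' by (intro assms(3)) (simp_all add: mem_fraction_iff)
    thus "(case p of (a', b') \<Rightarrow> f a' b') = f a b" by (simp only: p' prod.case)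
  qed
  thus ?thesis using mem by (simp only:) blast
qed

lemma fraction_mult:
  assumes "a \<in> carrier R" "b \<in> carrier R - {\<zero>}" "c \<in> carrier R" "d \<in> carrier R - {\<zero>}"
  shows "fraction R a b \<otimes>\<^bsub>Frac R\<^esub> fraction R c d = fraction R (a \<otimes> c) (b \<otimes> d)"
proof -
  have inner: "(\<Union>(c', d')\<in>fraction R c d. fraction R (a' \<otimes> c') (b' \<otimes> d')) = fraction R (a' \<otimes> c) (b' \<otimes> d)"
    if ab: "a' \<in> carrier R" "b' \<in> carrier R - {\<zero>}" for a' b'
  proof (rule fraction_UN1)
    fix c' d' assume c: "c' \<in> carrier R" "d' \<in> carrier R" "d' \<noteq> \<zero>" and e: "c \<otimes> d' = c' \<otimes> d"
    have carr: "d \<in> carrier R" "b' \<in> carrier R" using assms ab by auto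
    have "(a' \<otimes> c') \<otimes> (b' \<otimes> d) = a' \<otimes> b' \<otimes> (c' \<otimes> d)" using assms(3) ab(1) c carr by algebra
    also have "\<dots> = (a' \<otimes> c) \<otimes> (b' \<otimes> d')"
      unfolding e[symmetric] using assms(3) ab(1) c carr by algebra
    finally show "fraction R (a' \<otimes> c') (b' \<otimes> d') = fraction R (a' \<otimes> c) (b' \<otimes> d)"
      using c assms ab nonzero_prod by (subst fraction_eq_iff) auto
  qed (use assms in auto)
  have "fraction R a b \<otimes>\<^bsub>Frac R\<^esub> fraction R c d =
      (\<Union>(a', b')\<in>fraction R a b. \<Union>(c', d')\<in>fraction R c d. fraction R (a' \<otimes> c') (b' \<otimes> d'))"
    by (simp add: Frac_def)
  also have "\<dots> = (\<Union>(a', b')\<in>fraction R a b. fraction R (a' \<otimes> c) (b' \<otimes> d))"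
    using assms by (intro SUP_cong refl) (case_tac x, simp add: mem_fraction_iff inner)
  also have "\<dots> = fraction R (a \<otimes> c) (b \<otimes> d)"
  proof (rule fraction_UN1)
    fix a' b' assume c: "a' \<in> carrier R" "b' \<in> carrier R" "b' \<noteq> \<zero>" and e: "a \<otimes> b' = a' \<otimes> b"
    have carr: "d \<in> carrier R" "b \<in> carrier R" using assms by auto
    have "(a' \<otimes> c) \<otimes> (b \<otimes> d) = (a' \<otimes> b) \<otimes> c \<otimes> d" using assms(3) c carr by algebra
    also have "\<dots> = (a \<otimes> c) \<otimes> (b' \<otimes> d)"
      unfolding e[symmetric] using assms(1,3) c carr by algebra
    finally show "fraction R (a' \<otimes> c) (b' \<otimes> d) = fraction R (a \<otimes> c) (b \<otimes> d)"
      using c assms nonzero_prod by (subst fraction_eq_iff) auto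
  qed (use assms in auto)
  finally show ?thesis .
qed

lemma fraction_add:
  assumes "a \<in> carrier R" "b \<in> carrier R - {\<zero>}" "c \<in> carrier R" "d \<in> carrier R - {\<zero>}"
  shows "fraction R a b \<oplus>\<^bsub>Frac R\<^esub> fraction R c d = fraction R (a \<otimes> d \<oplus> c \<otimes> b) (b \<otimes> d)"
proof -
  have inner: "(\<Union>(c', d')\<in>fraction R c d. fraction R (a' \<otimes> d' \<oplus> c' \<otimes> b') (b' \<otimes> d'))
      = fraction R (a' \<otimes> d \<oplus> c \<otimes> b') (b' \<otimes> d)"
    if ab: "a' \<in> carrier R" "b' \<in> carrier R - {\<zero>}" for a' b'
  proof (rule fraction_UN1)
    fix c' d' assume c: "c' \<in> carrier R" "d' \<in> carrier R" "d' \<noteq> \<zero>" and e: "c \<otimes> d' = c' \<otimes> d"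
    have carr: "d \<in> carrier R" "b' \<in> carrier R" using assms ab by auto
    have "(a' \<otimes> d' \<oplus> c' \<otimes> b') \<otimes> (b' \<otimes> d) = a' \<otimes> d' \<otimes> b' \<otimes> d \<oplus> b' \<otimes> b' \<otimes> (c' \<otimes> d)"
      using assms(3) ab(1) c carr by algebra
    also have "\<dots> = (a' \<otimes> d \<oplus> c \<otimes> b') \<otimes> (b' \<otimes> d')"
      unfolding e[symmetric] using assms(3) ab(1) c carr by algebra
    finally show "fraction R (a' \<otimes> d' \<oplus> c' \<otimes> b') (b' \<otimes> d') = fraction R (a' \<otimes> d \<oplus> c \<otimes> b') (b' \<otimes> d)"
      using c assms ab nonzero_prod by (subst fraction_eq_iff) auto
  qed (use assms in auto)
  have "fraction R a b \<oplus>\<^bsub>Frac R\<^esub> fraction R c d =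
      (\<Union>(a', b')\<in>fraction R a b. \<Union>(c', d')\<in>fraction R c d. fraction R (a' \<otimes> d' \<oplus> c' \<otimes> b') (b' \<otimes> d'))"
    by (simp add: Frac_def)
  also have "\<dots> = (\<Union>(a', b')\<in>fraction R a b. fraction R (a' \<otimes> d \<oplus> c \<otimes> b') (b' \<otimes> d))"
    using assms by (intro SUP_cong refl) (case_tac x, simp add: mem_fraction_iff inner)
  also have "\<dots> = fraction R (a \<otimes> d \<oplus> c \<otimes> b) (b \<otimes> d)"
  proof (rule fraction_UN1)
    fix a' b' assume c: "a' \<in> carrier R" "b' \<in> carrier R" "b' \<noteq> \<zero>" and e: "a \<otimes> b' = a' \<otimes> b"
    have carr: "d \<in> carrier R" "b \<in> carrier R" using assms by auto
    have "(a' \<otimes> d \<oplus> c \<otimes> b') \<otimes> (b \<otimes> d) = d \<otimes> d \<otimes> (a' \<otimes> b) \<oplus> c \<otimes> b' \<otimes> b \<otimes> d"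
      using assms(3) c carr by algebra
    also have "\<dots> = (a \<otimes> d \<oplus> c \<otimes> b) \<otimes> (b' \<otimes> d)"
      unfolding e[symmetric] using assms(1,3) c carr by algebra
    finally show "fraction R (a' \<otimes> d \<oplus> c \<otimes> b') (b' \<otimes> d) = fraction R (a \<otimes> d \<oplus> c \<otimes> b) (b \<otimes> d)"
      using c assms nonzero_prod by (subst fraction_eq_iff) auto
  qed (use assms in auto)
  finally show ?thesis .
qed

lemma fraction_zero: "\<zero>\<^bsub>Frac R\<^esub> = fraction R \<zero> \<one>" and fraction_one: "\<one>\<^bsub>Frac R\<^esub> = fraction R \<one> \<one>"
  by (simp_all add: Frac_def)

lemma fraction_cancel:
  assumes "a \<in> carrier R" "b \<in> carrier R - {\<zero>}" "k \<in> carrier R - {\<zero>}"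
  shows "fraction R (a \<otimes> k) (b \<otimes> k) = fraction R a b"
  using assms nonzero_prod by (subst fraction_eq_iff) (auto simp: m_ac)

lemma fraction_add_same:
  assumes "a \<in> carrier R" "b \<in> carrier R - {\<zero>}" "c \<in> carrier R"
  shows "fraction R a b \<oplus>\<^bsub>Frac R\<^esub> fraction R c b = fraction R (a \<oplus> c) b"
  using assms fraction_cancel[of "a \<oplus> c" b b] by (simp add: fraction_add l_distr)

theorem Frac_field: "field (Frac R)"
proof -
  note fr = fraction_mult fraction_add fraction_zero fraction_one
  note nz = nonzero_prod[simplified]
  have "cring (Frac R)"
  proof (rule cringI)
    show "abelian_group (Frac R)"
    proof (rule abelian_groupI)
      fix U V assume "U \<in> carrier (Frac R)" "V \<in> carrier (Frac R)"
      then show "U \<oplus>\<^bsub>Frac R\<^esub> V \<in> carrier (Frac R)" "U \<oplus>\<^bsub>Frac R\<^esub> V = V \<oplus>\<^bsub>Frac R\<^esub> U"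
        by (auto elim!: fraction_cases simp: fraction_add nz a_comm m_comm)
    next
      fix U V W assume UVW: "U \<in> carrier (Frac R)" "V \<in> carrier (Frac R)" "W \<in> carrier (Frac R)"
      obtain a b where ab: "a \<in> carrier R" "b \<in> carrier R" "b \<noteq> \<zero>" "U = fraction R a b"
        using UVW(1) by (rule fraction_cases)
      obtain c d where cd: "c \<in> carrier R" "d \<in> carrier R" "d \<noteq> \<zero>" "V = fraction R c d"
        using UVW(2) by (rule fraction_cases)
      obtain e f where ef: "e \<in> carrier R" "f \<in> carrier R" "f \<noteq> \<zero>" "W = fraction R e f"
        using UVW(3) by (rule fraction_cases)
      note c = ab(1-3) cd(1-3) ef(1-3) and U = ab(4) cd(4) ef(4)
      have "(a \<otimes> d \<oplus> c \<otimes> b) \<otimes> f \<oplus> e \<otimes> (b \<otimes> d) = a \<otimes> (d \<otimes> f) \<oplus> (c \<otimes> f \<oplus> e \<otimes> d) \<otimes> b"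
        using c by algebra
      then show "(U \<oplus>\<^bsub>Frac R\<^esub> V) \<oplus>\<^bsub>Frac R\<^esub> W = U \<oplus>\<^bsub>Frac R\<^esub> (V \<oplus>\<^bsub>Frac R\<^esub> W)"
        using c by (simp add: U fraction_add nz m_assoc)
    next
      fix U assume "U \<in> carrier (Frac R)"
      then obtain a b where c: "a \<in> carrier R" "b \<in> carrier R" "b \<noteq> \<zero>" and U: "U = fraction R a b"
        by (rule fraction_cases)
      show "\<zero>\<^bsub>Frac R\<^esub> \<oplus>\<^bsub>Frac R\<^esub> U = U" using c by (simp add: U fr)
      show "\<exists>V\<in>carrier (Frac R). V \<oplus>\<^bsub>Frac R\<^esub> U = \<zero>\<^bsub>Frac R\<^esub>"
      proof (rule bexI)
        show "fraction R (\<ominus> a) b \<oplus>\<^bsub>Frac R\<^esub> U = \<zero>\<^bsub>Frac R\<^esub>"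
          using c by (simp add: U fr nz fraction_eq_iff l_minus l_neg)
      qed (use c in simp)
    qed (simp add: fraction_zero)
    show "Group.comm_monoid (Frac R)"
    proof (rule comm_monoidI)
      fix U V assume "U \<in> carrier (Frac R)" "V \<in> carrier (Frac R)"
      then show "U \<otimes>\<^bsub>Frac R\<^esub> V \<in> carrier (Frac R)" "U \<otimes>\<^bsub>Frac R\<^esub> V = V \<otimes>\<^bsub>Frac R\<^esub> U"
        by (auto elim!: fraction_cases simp: fraction_mult nz m_comm)
    next
      fix U V W assume "U \<in> carrier (Frac R)" "V \<in> carrier (Frac R)" "W \<in> carrier (Frac R)"
      then show "(U \<otimes>\<^bsub>Frac R\<^esub> V) \<otimes>\<^bsub>Frac R\<^esub> W = U \<otimes>\<^bsub>Frac R\<^esub> (V \<otimes>\<^bsub>Frac R\<^esub> W)"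
        by (auto elim!: fraction_cases simp: fraction_mult nz m_assoc)
    qed (auto elim!: fraction_cases simp: fr)
    fix U V W assume UVW: "U \<in> carrier (Frac R)" "V \<in> carrier (Frac R)" "W \<in> carrier (Frac R)"
    obtain a b where ab: "a \<in> carrier R" "b \<in> carrier R" "b \<noteq> \<zero>" "U = fraction R a b"
      using UVW(1) by (rule fraction_cases)
    obtain c d where cd: "c \<in> carrier R" "d \<in> carrier R" "d \<noteq> \<zero>" "V = fraction R c d"
      using UVW(2) by (rule fraction_cases)
    obtain e f where ef: "e \<in> carrier R" "f \<in> carrier R" "f \<noteq> \<zero>" "W = fraction R e f"
      using UVW(3) by (rule fraction_cases)
    note c = ab(1-3) cd(1-3) ef(1-3) and U = ab(4) cd(4) ef(4)
    have "(a \<otimes> e) \<otimes> (d \<otimes> f) \<oplus> (c \<otimes> e) \<otimes> (b \<otimes> f) = ((a \<otimes> d \<oplus> c \<otimes> b) \<otimes> e) \<otimes> f"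
      using c by algebra
    moreover have "(b \<otimes> f) \<otimes> (d \<otimes> f) = ((b \<otimes> d) \<otimes> f) \<otimes> f" using c by algebra
    moreover have "U \<otimes>\<^bsub>Frac R\<^esub> W \<oplus>\<^bsub>Frac R\<^esub> V \<otimes>\<^bsub>Frac R\<^esub> W =
      fraction R ((a \<otimes> e) \<otimes> (d \<otimes> f) \<oplus> (c \<otimes> e) \<otimes> (b \<otimes> f)) ((b \<otimes> f) \<otimes> (d \<otimes> f))"
      using c by (simp add: U fr nz)
    ultimately show "(U \<oplus>\<^bsub>Frac R\<^esub> V) \<otimes>\<^bsub>Frac R\<^esub> W = U \<otimes>\<^bsub>Frac R\<^esub> W \<oplus>\<^bsub>Frac R\<^esub> V \<otimes>\<^bsub>Frac R\<^esub> W"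
      using c by (simp add: U fr nz fraction_cancel)
  qed
  moreover have "\<exists>V\<in>carrier (Frac R). U \<otimes>\<^bsub>Frac R\<^esub> V = \<one>\<^bsub>Frac R\<^esub>"
    if "U \<in> carrier (Frac R) - {\<zero>\<^bsub>Frac R\<^esub>}" for U
  proof -
    have "U \<in> carrier (Frac R)" using that by simp
    then obtain a b where c: "a \<in> carrier R" "b \<in> carrier R" "b \<noteq> \<zero>" and U: "U = fraction R a b"
      by (rule fraction_cases)
    hence "a \<noteq> \<zero>" using that by (auto simp: fraction_zero fraction_eq_iff)
    hence "U \<otimes>\<^bsub>Frac R\<^esub> fraction R b a = \<one>\<^bsub>Frac R\<^esub>" "fraction R b a \<in> carrier (Frac R)"
      using c by (simp_all add: U fr nz fraction_eq_iff m_comm)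
    thus ?thesis by blast
  qed
  moreover have "\<zero>\<^bsub>Frac R\<^esub> \<noteq> \<one>\<^bsub>Frac R\<^esub>" by (simp add: fr fraction_eq_iff)
  ultimately show ?thesis
    by (intro cring.cring_fieldI2) auto
qed

text \<open>The quotient rule defines the unique extension of a derivation to the fraction field.\<close>

theorem frac_der_unique_extension:
  assumes "\<delta> \<in> ring_der R"
  shows "frac_der R \<delta> \<in> ring_der (Frac R)"
    and "\<And>a. a \<in> carrier R \<Longrightarrow> frac_der R \<delta> (fraction R a \<one>) = fraction R (\<delta> a) \<one>"
    and "\<And>E. E \<in> ring_der (Frac R) \<Longrightarrow>
           (\<And>a. a \<in> carrier R \<Longrightarrow> E (fraction R a \<one>) = fraction R (\<delta> a) \<one>) \<Longrightarrow> E = frac_der R \<delta>"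
proof -
  interpret F: field "Frac R" by (rule Frac_field)
  note nz = nonzero_prod[simplified]
  have dc [simp]: "\<And>a. a \<in> carrier R \<Longrightarrow> \<delta> a \<in> carrier R"
    and da: "\<And>a b. a \<in> carrier R \<Longrightarrow> b \<in> carrier R \<Longrightarrow> \<delta> (a \<oplus> b) = \<delta> a \<oplus> \<delta> b"
    and dm: "\<And>a b. a \<in> carrier R \<Longrightarrow> b \<in> carrier R \<Longrightarrow> \<delta> (a \<otimes> b) = \<delta> a \<otimes> b \<oplus> a \<otimes> \<delta> b"
    using assms by (auto simp: ring_der_def)
  have rule: "frac_der R \<delta> (fraction R a b) = fraction R (\<delta> a \<otimes> b \<ominus> a \<otimes> \<delta> b) (b \<otimes> b)"
    if ab: "a \<in> carrier R" "b \<in> carrier R" "b \<noteq> \<zero>" for a b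
  proof -
    have "(\<Union>(a', b')\<in>fraction R a b. fraction R (\<delta> a' \<otimes> b' \<ominus> a' \<otimes> \<delta> b') (b' \<otimes> b')) =
      fraction R (\<delta> a \<otimes> b \<ominus> a \<otimes> \<delta> b) (b \<otimes> b)"
    proof (rule fraction_UN1)
      fix a' b' assume c: "a' \<in> carrier R" "b' \<in> carrier R" "b' \<noteq> \<zero>" and e: "a \<otimes> b' = a' \<otimes> b"
      have d: "\<delta> a \<otimes> b' \<oplus> a \<otimes> \<delta> b' = \<delta> a' \<otimes> b \<oplus> a' \<otimes> \<delta> b"
        using arg_cong[OF e, of \<delta>] c ab by (simp add: dm)
      have k: "\<delta> a \<in> carrier R" "\<delta> b \<in> carrier R" "\<delta> a' \<in> carrier R" "\<delta> b' \<in> carrier R"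
        using c ab by simp_all
      have "(\<delta> a' \<otimes> b' \<ominus> a' \<otimes> \<delta> b') \<otimes> (b \<otimes> b) =
         (\<delta> a' \<otimes> b \<oplus> a' \<otimes> \<delta> b) \<otimes> b' \<otimes> b \<ominus> (a' \<otimes> b) \<otimes> \<delta> b \<otimes> b' \<ominus> (a' \<otimes> b) \<otimes> \<delta> b' \<otimes> b"
        using c ab k by algebra
      also have "\<dots> = (\<delta> a \<otimes> b \<ominus> a \<otimes> \<delta> b) \<otimes> (b' \<otimes> b')"
        unfolding d[symmetric] e[symmetric] using c ab k by algebra
      finally show "fraction R (\<delta> a' \<otimes> b' \<ominus> a' \<otimes> \<delta> b') (b' \<otimes> b') = fraction R (\<delta> a \<otimes> b \<ominus> a \<otimes> \<delta> b) (b \<otimes> b)"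
        using c ab by (subst fraction_eq_iff) (auto simp: nz)
    qed (use ab in auto)
    thus ?thesis using ab by (simp add: frac_der_def)
  qed
  have one: "\<delta> \<one> = \<zero>" using dm[of \<one> \<one>] by simp
  show ext: "frac_der R \<delta> (fraction R a \<one>) = fraction R (\<delta> a) \<one>" if "a \<in> carrier R" for a
    using that by (simp add: rule one minus_eq)
  show "frac_der R \<delta> \<in> ring_der (Frac R)"
    unfolding ring_der_def
  proof (intro CollectI conjI ballI PiE_I)
    fix U assume "U \<in> carrier (Frac R)"
    then show "frac_der R \<delta> U \<in> carrier (Frac R)" by (elim fraction_cases) (simp add: rule nz)
  next
    fix U assume "U \<notin> carrier (Frac R)"
    then show "frac_der R \<delta> U = undefined" by (simp add: frac_der_def)
  next
    fix U V assume UV: "U \<in> carrier (Frac R)" "V \<in> carrier (Frac R)"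
    obtain a b where ab: "a \<in> carrier R" "b \<in> carrier R" "b \<noteq> \<zero>" "U = fraction R a b"
      using UV(1) by (rule fraction_cases)
    obtain c d where cd: "c \<in> carrier R" "d \<in> carrier R" "d \<noteq> \<zero>" "V = fraction R c d"
      using UV(2) by (rule fraction_cases)
    note c = ab(1-3) cd(1-3) and U = ab(4) cd(4)
    have k: "\<delta> a \<in> carrier R" "\<delta> b \<in> carrier R" "\<delta> c \<in> carrier R" "\<delta> d \<in> carrier R"
      using c by simp_all
    have "(\<delta> a \<otimes> d \<oplus> a \<otimes> \<delta> d \<oplus> (\<delta> c \<otimes> b \<oplus> c \<otimes> \<delta> b)) \<otimes> (b \<otimes> d)
         \<ominus> (a \<otimes> d \<oplus> c \<otimes> b) \<otimes> (\<delta> b \<otimes> d \<oplus> b \<otimes> \<delta> d) =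
       (\<delta> a \<otimes> b \<ominus> a \<otimes> \<delta> b) \<otimes> (d \<otimes> d) \<oplus> (\<delta> c \<otimes> d \<ominus> c \<otimes> \<delta> d) \<otimes> (b \<otimes> b)"
      using c k by algebra
    moreover have "(b \<otimes> d) \<otimes> (b \<otimes> d) = (b \<otimes> b) \<otimes> (d \<otimes> d)" using c by algebra
    ultimately show "frac_der R \<delta> (U \<oplus>\<^bsub>Frac R\<^esub> V) = frac_der R \<delta> U \<oplus>\<^bsub>Frac R\<^esub> frac_der R \<delta> V"
      using c k by (simp add: U fraction_add rule nz da dm)
    have "(\<delta> a \<otimes> c \<oplus> a \<otimes> \<delta> c) \<otimes> (b \<otimes> d) \<ominus> (a \<otimes> c) \<otimes> (\<delta> b \<otimes> d \<oplus> b \<otimes> \<delta> d) =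
       ((\<delta> a \<otimes> b \<ominus> a \<otimes> \<delta> b) \<otimes> c) \<otimes> d \<oplus> (a \<otimes> (\<delta> c \<otimes> d \<ominus> c \<otimes> \<delta> d)) \<otimes> b"
      using c k by algebra
    hence "frac_der R \<delta> (U \<otimes>\<^bsub>Frac R\<^esub> V) = fraction R
        (((\<delta> a \<otimes> b \<ominus> a \<otimes> \<delta> b) \<otimes> c) \<otimes> d \<oplus> (a \<otimes> (\<delta> c \<otimes> d \<ominus> c \<otimes> \<delta> d)) \<otimes> b) ((b \<otimes> d) \<otimes> (b \<otimes> d))"
      using c k by (simp add: U fraction_mult rule nz dm)
    also have "\<dots> = fraction R (((\<delta> a \<otimes> b \<ominus> a \<otimes> \<delta> b) \<otimes> c) \<otimes> d) ((b \<otimes> d) \<otimes> (b \<otimes> d)) \<oplus>\<^bsub>Frac R\<^esub>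
        fraction R ((a \<otimes> (\<delta> c \<otimes> d \<ominus> c \<otimes> \<delta> d)) \<otimes> b) ((b \<otimes> d) \<otimes> (b \<otimes> d))"
      using c k by (simp add: fraction_add_same nz)
    also have "(b \<otimes> d) \<otimes> (b \<otimes> d) = ((b \<otimes> b) \<otimes> d) \<otimes> d" using c by algebra
    also have "fraction R (((\<delta> a \<otimes> b \<ominus> a \<otimes> \<delta> b) \<otimes> c) \<otimes> d) (((b \<otimes> b) \<otimes> d) \<otimes> d) = frac_der R \<delta> U \<otimes>\<^bsub>Frac R\<^esub> V"
      using c k by (simp add: U fraction_mult rule nz fraction_cancel)
    also have "((b \<otimes> b) \<otimes> d) \<otimes> d = (b \<otimes> (d \<otimes> d)) \<otimes> b" using c by algebra
    also have "fraction R ((a \<otimes> (\<delta> c \<otimes> d \<ominus> c \<otimes> \<delta> d)) \<otimes> b) ((b \<otimes> (d \<otimes> d)) \<otimes> b) = U \<otimes>\<^bsub>Frac R\<^esub> frac_der R \<delta> V"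
      using c k by (simp add: U fraction_mult rule nz fraction_cancel)
    finally show "frac_der R \<delta> (U \<otimes>\<^bsub>Frac R\<^esub> V) =
        frac_der R \<delta> U \<otimes>\<^bsub>Frac R\<^esub> V \<oplus>\<^bsub>Frac R\<^esub> U \<otimes>\<^bsub>Frac R\<^esub> frac_der R \<delta> V" .
  qed
  fix E assume E: "E \<in> ring_der (Frac R)"
    and Ext: "\<And>a. a \<in> carrier R \<Longrightarrow> E (fraction R a \<one>) = fraction R (\<delta> a) \<one>"
  show "E = frac_der R \<delta>"
  proof
    fix U
    show "E U = frac_der R \<delta> U"
    proof (cases "U \<in> carrier (Frac R)")
      case False
      then show ?thesis using E by (auto simp: frac_der_def ring_der_def)
    next
      case True
      then obtain a b where c: "a \<in> carrier R" "b \<in> carrier R" "b \<noteq> \<zero>" and U: "U = fraction R a b"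
        by (rule fraction_cases)
      have key: "G U \<otimes>\<^bsub>Frac R\<^esub> fraction R b \<one> = fraction R (\<delta> a) \<one> \<ominus>\<^bsub>Frac R\<^esub> U \<otimes>\<^bsub>Frac R\<^esub> fraction R (\<delta> b) \<one>"
        if G: "G \<in> ring_der (Frac R)" "\<And>a. a \<in> carrier R \<Longrightarrow> G (fraction R a \<one>) = fraction R (\<delta> a) \<one>" for G
      proof -
        have GX: "G U \<in> carrier (Frac R)" using G True by (auto simp: ring_der_def)
        have "U \<otimes>\<^bsub>Frac R\<^esub> fraction R b \<one> = fraction R a \<one>"
          using c by (simp add: U fraction_mult fraction_eq_iff nz m_assoc)
        hence "fraction R (\<delta> a) \<one> = G (U \<otimes>\<^bsub>Frac R\<^esub> fraction R b \<one>)" using G c by simp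
        also have "\<dots> = G U \<otimes>\<^bsub>Frac R\<^esub> fraction R b \<one> \<oplus>\<^bsub>Frac R\<^esub> U \<otimes>\<^bsub>Frac R\<^esub> fraction R (\<delta> b) \<one>"
          using G(1) True c by (simp add: ring_der_def G(2))
        finally have eq: "fraction R (\<delta> a) \<one> = \<dots>" .
        show ?thesis unfolding eq
          using GX True c
          by (simp add: F.minus_eq F.a_assoc F.r_neg)
      qed
      have "fraction R b \<one> \<noteq> \<zero>\<^bsub>Frac R\<^esub>" using c by (simp add: fraction_zero fraction_eq_iff)
      moreover have "E U \<in> carrier (Frac R)" "frac_der R \<delta> U \<in> carrier (Frac R)"
        using E True \<open>frac_der R \<delta> \<in> ring_der (Frac R)\<close> by (auto simp: ring_der_def)
      moreover have "E U \<otimes>\<^bsub>Frac R\<^esub> fraction R b \<one> = frac_der R \<delta> U \<otimes>\<^bsub>Frac R\<^esub> fraction R b \<one>"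
        using key[OF E Ext] key[OF \<open>frac_der R \<delta> \<in> ring_der (Frac R)\<close> ext] by simp
      ultimately show ?thesis using c by (simp add: F.m_rcancel)
    qed
  qed
qed

end

theorem quot_der_induced:
  assumes "delta_ideal R \<Delta> P" "\<Delta> \<subseteq> ring_der R" "\<delta> \<in> \<Delta>"
  shows "\<And>r. r \<in> carrier R \<Longrightarrow> quot_der R P \<delta> (P +>\<^bsub>R\<^esub> r) = P +>\<^bsub>R\<^esub> \<delta> r"
    and "quot_der R P \<delta> \<in> ring_der (R Quot P)"
proof -
  interpret P: ideal P R using assms by (simp add: delta_ideal_def)
  interpret Q: ring "R Quot P" by (rule P.quotient_is_ring)
  have stable: "\<And>p. p \<in> P \<Longrightarrow> \<delta> p \<in> P" using assms by (auto simp: delta_ideal_def)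
  have dc: "\<And>a. a \<in> carrier R \<Longrightarrow> \<delta> a \<in> carrier R"
    and da: "\<And>a b. a \<in> carrier R \<Longrightarrow> b \<in> carrier R \<Longrightarrow> \<delta> (a \<oplus>\<^bsub>R\<^esub> b) = \<delta> a \<oplus>\<^bsub>R\<^esub> \<delta> b"
    and dm: "\<And>a b. a \<in> carrier R \<Longrightarrow> b \<in> carrier R \<Longrightarrow>
      \<delta> (a \<otimes>\<^bsub>R\<^esub> b) = \<delta> a \<otimes>\<^bsub>R\<^esub> b \<oplus>\<^bsub>R\<^esub> a \<otimes>\<^bsub>R\<^esub> \<delta> b"
    using assms by (auto simp: ring_der_def)
  have hom: "(+>\<^bsub>R\<^esub>) P \<in> ring_hom R (R Quot P)" by (rule P.rcos_ring_hom)
  have carr: "carrier (R Quot P) = (\<lambda>r. P +>\<^bsub>R\<^esub> r) ` carrier R"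
    by (auto simp: FactRing_def A_RCOSETS_def')
  show ind: "quot_der R P \<delta> (P +>\<^bsub>R\<^esub> r) = P +>\<^bsub>R\<^esub> \<delta> r" if r: "r \<in> carrier R" for r
  proof -
    have "P +>\<^bsub>R\<^esub> \<delta> x = P +>\<^bsub>R\<^esub> \<delta> r" if x: "x \<in> P +>\<^bsub>R\<^esub> r" for x
    proof -
      obtain p where p: "p \<in> P" "x = p \<oplus>\<^bsub>R\<^esub> r" using x by (auto simp: a_r_coset_def')
      have "\<delta> x = \<delta> p \<oplus>\<^bsub>R\<^esub> \<delta> r" using p r P.a_subset by (auto simp: da)
      hence "\<delta> x \<in> P +>\<^bsub>R\<^esub> \<delta> r" using stable p by (auto simp: a_r_coset_def')
      thus ?thesis using P.a_repr_independence'[of "\<delta> x" "\<delta> r"] dc r by simp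
    qed
    hence "(\<Union>x\<in>P +>\<^bsub>R\<^esub> r. P +>\<^bsub>R\<^esub> \<delta> x) = (\<Union>x\<in>P +>\<^bsub>R\<^esub> r. P +>\<^bsub>R\<^esub> \<delta> r)"
      by (rule SUP_cong[OF refl])
    also have "\<dots> = P +>\<^bsub>R\<^esub> \<delta> r" using P.a_rcos_self[OF r] by blast
    finally show ?thesis using r by (simp add: quot_der_def carr)
  qed
  show "quot_der R P \<delta> \<in> ring_der (R Quot P)"
    unfolding ring_der_def
  proof (intro CollectI conjI ballI PiE_I)
    fix U assume "U \<in> carrier (R Quot P)"
    then show "quot_der R P \<delta> U \<in> carrier (R Quot P)" by (auto simp: carr ind dc)
  next
    fix U assume "U \<notin> carrier (R Quot P)"
    then show "quot_der R P \<delta> U = undefined" by (simp add: quot_der_def)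
  next
    fix U V assume "U \<in> carrier (R Quot P)" "V \<in> carrier (R Quot P)"
    then show "quot_der R P \<delta> (U \<oplus>\<^bsub>R Quot P\<^esub> V) = quot_der R P \<delta> U \<oplus>\<^bsub>R Quot P\<^esub> quot_der R P \<delta> V"
      and "quot_der R P \<delta> (U \<otimes>\<^bsub>R Quot P\<^esub> V) = quot_der R P \<delta> U \<otimes>\<^bsub>R Quot P\<^esub> V \<oplus>\<^bsub>R Quot P\<^esub>
        U \<otimes>\<^bsub>R Quot P\<^esub> quot_der R P \<delta> V"
      by (auto simp: carr ind dc da dm simp flip: ring_hom_add[OF hom] ring_hom_mult[OF hom])
  qed
qed

definition frac_const :: "('a, 'n) ring_scheme \<Rightarrow> ('a \<Rightarrow> 'a) set \<Rightarrow> 'a set \<Rightarrow> ('a set \<times> 'a set) set set" where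
  "frac_const R \<Delta> P = {x \<in> carrier (Frac (R Quot P)).
     \<forall>\<delta>\<in>\<Delta>. frac_der (R Quot P) (quot_der R P \<delta>) x = \<zero>\<^bsub>Frac (R Quot P)\<^esub>}"

text \<open>The image of \<open>K\<close> under the structure map \<open>K \<rightarrow> R \<rightarrow> R/P \<rightarrow> Frac(R/P)\<close>.\<close>

definition base_image ::
    "('k, 'm) ring_scheme \<Rightarrow> ('k, 'a, 'n) module_scheme \<Rightarrow> 'a set \<Rightarrow> ('a set \<times> 'a set) set set" where
  "base_image K R P =
     (\<lambda>c. fraction (R Quot P) (P +>\<^bsub>R\<^esub> (c \<odot>\<^bsub>R\<^esub> \<one>\<^bsub>R\<^esub>)) \<one>\<^bsub>R Quot P\<^esub>) ` carrier K"

definition delta_rational ::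
    "('k, 'm) ring_scheme \<Rightarrow> ('k, 'a, 'n) module_scheme \<Rightarrow> ('a \<Rightarrow> 'a) set \<Rightarrow> 'a set \<Rightarrow> bool" where
  "delta_rational K R \<Delta> P \<longleftrightarrow> delta_prime R \<Delta> P \<and>
     (\<forall>x\<in>frac_const R \<Delta> P. ring.algebraic (Frac (R Quot P)) (base_image K R P) x)"

definition spec_topology :: "('a, 'n) ring_scheme \<Rightarrow> 'a set topology" where
  "spec_topology R = topology (\<lambda>U. \<exists>I. ideal I R \<and> U = {P. primeideal P R \<and> \<not> I \<subseteq> P})"

lemma openin_spec_topology:
  assumes "cring R"
  shows "openin (spec_topology R) U \<longleftrightarrow> (\<exists>I. ideal I R \<and> U = {P. primeideal P R \<and> \<not> I \<subseteq> P})"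
proof -
  interpret cring R by fact
  have "istopology (\<lambda>U. \<exists>I. ideal I R \<and> U = {P. primeideal P R \<and> \<not> I \<subseteq> P})"
    unfolding istopology_def
  proof (intro conjI allI impI)
    fix S T
    assume "\<exists>I. ideal I R \<and> S = {P. primeideal P R \<and> \<not> I \<subseteq> P}"
      and "\<exists>I. ideal I R \<and> T = {P. primeideal P R \<and> \<not> I \<subseteq> P}"
    then obtain I J where I: "ideal I R" "S = {P. primeideal P R \<and> \<not> I \<subseteq> P}"
      and J: "ideal J R" "T = {P. primeideal P R \<and> \<not> J \<subseteq> P}" by blast
    have "S \<inter> T = {P. primeideal P R \<and> \<not> I \<cdot>\<^bsub>R\<^esub> J \<subseteq> P}"
      using I J primeideal_divides_ideal_prod[OF _ I(1) J(1)] ideal_prod_inter[OF I(1) J(1)] by auto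
    thus "\<exists>I. ideal I R \<and> S \<inter> T = {P. primeideal P R \<and> \<not> I \<subseteq> P}"
      using ideal_prod_is_ideal[OF I(1) J(1)] by blast
  next
    fix \<U> assume "\<forall>U\<in>\<U>. \<exists>I. ideal I R \<and> U = {P. primeideal P R \<and> \<not> I \<subseteq> P}"
    then obtain i where i: "\<And>U. U \<in> \<U> \<Longrightarrow> ideal (i U) R \<and> U = {P. primeideal P R \<and> \<not> i U \<subseteq> P}"
      by metis
    hence i1: "ideal (i U) R" and i2: "P \<in> U \<longleftrightarrow> primeideal P R \<and> \<not> i U \<subseteq> P"
      if "U \<in> \<U>" for U P
      using that by blast+
    let ?J = "Idl\<^bsub>R\<^esub> (\<Union>U\<in>\<U>. i U)"
    have sub: "(\<Union>U\<in>\<U>. i U) \<subseteq> carrier R" using i1 ideal.Icarr by fast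
    have J: "ideal ?J R" using sub by (rule genideal_ideal)
    have jp: "?J \<subseteq> P \<longleftrightarrow> (\<forall>U\<in>\<U>. i U \<subseteq> P)" if "primeideal P R" for P
      using Idl_subset_ideal[OF primeideal.axioms(1)[OF that] sub] by auto
    have "P \<in> \<Union>\<U> \<longleftrightarrow> primeideal P R \<and> \<not> ?J \<subseteq> P" for P
      using jp i2 unfolding Union_iff by meson
    hence "\<Union>\<U> = {P. primeideal P R \<and> \<not> ?J \<subseteq> P}" by blast
    thus "\<exists>I. ideal I R \<and> \<Union>\<U> = {P. primeideal P R \<and> \<not> I \<subseteq> P}" using J by blast
  qed
  thus ?thesis by (simp add: spec_topology_def)
qed

definition delta_spec_topology :: "('a, 'n) ring_scheme \<Rightarrow> ('a \<Rightarrow> 'a) set \<Rightarrow> 'a set topology" where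
  "delta_spec_topology R \<Delta> = subtopology (spec_topology R) (delta_spec R \<Delta>)"

definition locally_closed_pt :: "'p topology \<Rightarrow> 'p \<Rightarrow> bool" where
  "locally_closed_pt T p \<longleftrightarrow> (\<exists>U C. openin T U \<and> closedin T C \<and> {p} = U \<inter> C)"

definition DME ::
    "('k, 'm) ring_scheme \<Rightarrow> ('k, 'a, 'n) module_scheme \<Rightarrow> ('a \<Rightarrow> 'a) set \<Rightarrow> bool" where
  "DME K R \<Delta> \<longleftrightarrow> (\<forall>P\<in>delta_spec R \<Delta>.
     (locally_closed_pt (delta_spec_topology R \<Delta>) P \<longleftrightarrow> delta_primitive R \<Delta> P) \<and>
     (delta_primitive R \<Delta> P \<longleftrightarrow> delta_rational K R \<Delta> P))"

text \<open>A cardinal \<open>\<kappa>\<close> is given as a cardinal order, such as \<open>|A|\<close> or \<open>natLeq\<close> (for \<open>\<aleph>\<^sub>0\<close>).\<close>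

definition top_separable :: "'c rel \<Rightarrow> 'p topology \<Rightarrow> 'p \<Rightarrow> bool" where
  "top_separable \<kappa> T p \<longleftrightarrow> (\<exists>\<Lambda>. \<Lambda> \<subseteq> T closure_of {p} - {p} \<and> |\<Lambda>| <o \<kappa> \<and>
     T closure_of {p} - {p} = (\<Union>q\<in>\<Lambda>. T closure_of {q}))"

definition poset_covers :: "'p::order set \<Rightarrow> 'p \<Rightarrow> 'p set" where
  "poset_covers S s = {t \<in> S. s < t \<and> (\<forall>u\<in>S. s < u \<and> u \<le> t \<longrightarrow> u = t)}"

definition poset_separable :: "'c rel \<Rightarrow> 'p::order set \<Rightarrow> 'p \<Rightarrow> bool" where
  "poset_separable \<kappa> S s \<longleftrightarrow> |poset_covers S s| <o \<kappa>"

end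

theory Submission
  imports Defs
begin

text \<open>
  Write \<open>\<kappa> = |k|\<close>. In \<open>\<Delta>-spec R\<close>, being locally closed is the same as being \<open>\<aleph>\<^sub>0\<close>-separable, since \<open>R\<close> is
  noetherian, and the topological and the order-theoretic notions of separability agree because
  primes satisfy the descending chain condition (Krull). So everything follows once primitive,
  rational and \<open>\<kappa>\<close>-separable are shown to be equivalent.

  \<open>\<kappa>\<close>-separable implies primitive: pick \<open>f\<^sub>q \<in> q - P\<close> for fewer than \<open>\<kappa>\<close> primes \<open>q\<close> and a prime
  \<open>N \<supseteq> P\<close> maximal among the ideals avoiding all products of the \<open>f\<^sub>q\<close>. If \<open>t\<close> were transcendental modulo \<open>N\<close>,
  the \<open>\<kappa>\<close> many fractions \<open>1/(t - c)\<close> would be linearly independent in a localization of \<open>R/N\<close> whose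
  dimension is less than \<open>\<kappa>\<close>. So \<open>N\<close> is maximal, and its core is \<open>P\<close>.

  Primitive implies rational: if \<open>P\<close> is the core of the maximal ideal \<open>M\<close>, then constants of \<open>Frac(R/P)\<close>
  have denominators outside \<open>M\<close>, so the field of constants embeds into \<open>R/M\<close>, and the same fractions show
  that it is algebraic.

  Rational implies \<open>\<kappa>\<close>-separable: close a basis of \<open>R\<close> under \<open>(v, w) \<mapsto> v \<delta>(w) - w \<delta>(v)\<close>. Let \<open>Q \<supset> P\<close> and take \<open>f \<in> Q - P\<close>
  in the span of few elements of this closure, one of them \<open>v\<close>. Either some \<open>v \<delta>(f) - f \<delta>(v) \<in> Q - P\<close>
  lies in a smaller span, or \<open>f/v\<close> is a constant, hence algebraic, which forces \<open>v \<in> Q\<close>. So fewer than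
  \<open>\<kappa>\<close> elements outside \<open>P\<close> meet all such \<open>Q\<close>.
\<close>

section \<open>Noetherian rings and the height theorem\<close>

text \<open>The dimension count in the localizations is carried out as a pigeonhole argument. Every
  c in k is assigned a finite part of the spanning set that expresses the numerator of 1/(t - c),
  together with a denominator. There are fewer than |k| such pairs, so infinitely many c share one,
  and infinitely many vectors in a finite-dimensional space are dependent. Only an infinite fiber is
  asked for, so |k| may be singular.

  Finite-dimensional R is a case of its own: k may then be countable, and a closure built in
  countably many steps can be as large as k. There every prime is maximal, which settles the matter
  directly.

  Characteristic zero serves twice: it makes k infinite, and it allows division by the exponent when
  b^m is differentiated. The latter is why a prime minimal over a \<Delta>-ideal is again a
  \<Delta>-ideal, and so why primes and \<Delta>-primes can be traded for each other.

  Local rings and residue fields are never constructed; saturated ideals of R and relations inside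
  Frac(R/P) represent them.\<close>

lemma (in cring) ideal_cringI:
  assumes "I \<subseteq> carrier R" "\<zero> \<in> I"
    and "\<And>x y. x \<in> I \<Longrightarrow> y \<in> I \<Longrightarrow> x \<oplus> y \<in> I"
    and "\<And>r x. r \<in> carrier R \<Longrightarrow> x \<in> I \<Longrightarrow> r \<otimes> x \<in> I"
  shows "ideal I R"
proof (rule idealI)
  show "subgroup I (add_monoid R)"
  proof (rule add.subgroupI)
    fix a assume a: "a \<in> I"
    have "\<ominus> a = (\<ominus> \<one>) \<otimes> a" using a assms(1) l_minus[of \<one> a] by (simp add: subset_iff)
    thus "\<ominus> a \<in> I" using assms(4)[of "\<ominus> \<one>" a] a by simp
  qed (use assms in auto)
  fix a x assume "a \<in> I" "x \<in> carrier R"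
  then show "x \<otimes> a \<in> I" "a \<otimes> x \<in> I" using assms(4)[of x a] assms(1) m_comm[of a x] by auto
qed (rule ring_axioms)

lemma (in cring) ideal_facts:
  assumes "ideal I R"
  shows "I \<subseteq> carrier R" "\<zero> \<in> I"
    and "\<And>x y. x \<in> I \<Longrightarrow> y \<in> I \<Longrightarrow> x \<oplus> y \<in> I"
    and "\<And>x y. x \<in> I \<Longrightarrow> y \<in> I \<Longrightarrow> x \<ominus> y \<in> I"
    and "\<And>r x. r \<in> carrier R \<Longrightarrow> x \<in> I \<Longrightarrow> r \<otimes> x \<in> I"
    and "\<And>r x. r \<in> carrier R \<Longrightarrow> x \<in> I \<Longrightarrow> x \<otimes> r \<in> I"
proof -
  interpret I: ideal I R by fact
  show "I \<subseteq> carrier R" "\<zero> \<in> I" using I.a_subset I.zero_closed by auto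
  show "\<And>x y. x \<in> I \<Longrightarrow> y \<in> I \<Longrightarrow> x \<oplus> y \<in> I" by simp
  show "\<And>x y. x \<in> I \<Longrightarrow> y \<in> I \<Longrightarrow> x \<ominus> y \<in> I" by (simp add: minus_eq)
  show "\<And>r x. r \<in> carrier R \<Longrightarrow> x \<in> I \<Longrightarrow> r \<otimes> x \<in> I" by (rule I.I_l_closed)
  show "\<And>r x. r \<in> carrier R \<Longrightarrow> x \<in> I \<Longrightarrow> x \<otimes> r \<in> I" by (rule I.I_r_closed)
qed

lemma (in cring) ideal_add_cancel:
  assumes "ideal I R" "x \<oplus> y \<in> I" "x \<in> carrier R" "y \<in> I"
  shows "x \<in> I"
proof -
  have y: "y \<in> carrier R" using assms ideal.Icarr by metis
  have "(x \<oplus> y) \<ominus> y = x" using assms(3) y by algebra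
  thus ?thesis using ideal_facts(4)[OF assms(1,2,4)] by simp
qed

lemma (in cring) prime_mult_notin:
  assumes "primeideal p R" "a \<in> carrier R - p" "b \<in> carrier R - p"
  shows "a \<otimes> b \<in> carrier R - p"
  using assms primeideal.I_prime[OF assms(1)] by auto

lemma (in cring) prime_one_notin: "primeideal p R \<Longrightarrow> \<one> \<in> carrier R - p"
  using primeideal.I_notcarr ideal.one_imp_carrier primeideal.axioms(1) by fastforce

lemma (in cring) prime_pow_notin:
  fixes n :: nat
  assumes "primeideal p R" "a \<in> carrier R - p"
  shows "a [^] n \<in> carrier R - p"
  by (induction n) (use assms prime_one_notin prime_mult_notin in auto)

section \<open>Sums \<open>I + Ra\<close> and saturation at a prime\<close>

definition adjoin :: "('a, 'n) ring_scheme \<Rightarrow> 'a set \<Rightarrow> 'a \<Rightarrow> 'a set" where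
  "adjoin R I a = {y \<oplus>\<^bsub>R\<^esub> r \<otimes>\<^bsub>R\<^esub> a | y r. y \<in> I \<and> r \<in> carrier R}"

lemma (in cring) adjoin_facts:
  assumes I: "ideal I R" and a: "a \<in> carrier R"
  shows "ideal (adjoin R I a) R" "I \<subseteq> adjoin R I a" "a \<in> adjoin R I a"
    and "\<And>J. ideal J R \<Longrightarrow> I \<subseteq> J \<Longrightarrow> a \<in> J \<Longrightarrow> adjoin R I a \<subseteq> J"
proof -
  note F = ideal_facts[OF I]
  have carr: "\<And>y. y \<in> I \<Longrightarrow> y \<in> carrier R" using F by auto
  show sub: "I \<subseteq> adjoin R I a"
  proof
    fix y assume y: "y \<in> I"
    have "y = y \<oplus> \<zero> \<otimes> a" using y carr a by simp
    thus "y \<in> adjoin R I a" unfolding adjoin_def using y by blast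
  qed
  have "a = \<zero> \<oplus> \<one> \<otimes> a" using a by simp
  thus "a \<in> adjoin R I a" unfolding adjoin_def using F(2) by blast
  show "ideal (adjoin R I a) R"
  proof (rule ideal_cringI)
    show "adjoin R I a \<subseteq> carrier R" using carr a by (auto simp: adjoin_def)
    show "\<zero> \<in> adjoin R I a" using sub F by blast
    fix x y assume "x \<in> adjoin R I a" "y \<in> adjoin R I a"
    then obtain u r v s where e: "x = u \<oplus> r \<otimes> a" "y = v \<oplus> s \<otimes> a"
      and c: "u \<in> I" "v \<in> I" "r \<in> carrier R" "s \<in> carrier R" by (auto simp: adjoin_def)
    have "x \<oplus> y = (u \<oplus> v) \<oplus> (r \<oplus> s) \<otimes> a" unfolding e using c carr[OF c(1)] carr[OF c(2)] a by algebra
    thus "x \<oplus> y \<in> adjoin R I a" unfolding adjoin_def using F(3) c by blast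
  next
    fix t x assume t: "t \<in> carrier R" "x \<in> adjoin R I a"
    then obtain u r where e: "x = u \<oplus> r \<otimes> a"
      and c: "u \<in> I" "r \<in> carrier R" by (auto simp: adjoin_def)
    have "t \<otimes> x = t \<otimes> u \<oplus> (t \<otimes> r) \<otimes> a" unfolding e using c carr[OF c(1)] t a by algebra
    thus "t \<otimes> x \<in> adjoin R I a" unfolding adjoin_def using F(5) c t by blast
  qed
  show "adjoin R I a \<subseteq> J" if "ideal J R" "I \<subseteq> J" "a \<in> J" for J
    using ideal_facts(3,5)[OF that(1)] that(2,3) by (auto simp: adjoin_def)
qed

text \<open>The contraction to \<open>R\<close> of the extension of \<open>I\<close> to the localization at \<open>p\<close>.\<close>

definition sat :: "('a, 'n) ring_scheme \<Rightarrow> 'a set \<Rightarrow> 'a set \<Rightarrow> 'a set" where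
  "sat R p I = {x \<in> carrier R. \<exists>s\<in>carrier R - p. s \<otimes>\<^bsub>R\<^esub> x \<in> I}"

lemma sat_mono: "I \<subseteq> J \<Longrightarrow> sat R p I \<subseteq> sat R p J"
  by (auto simp: sat_def)

text \<open>Saturation is a closure operator, so the fixed points \<open>sat R p I = I\<close>
  correspond to the ideals of the local ring at \<open>p\<close>. Arguments about that ring can then
  be run inside \<open>R\<close>.\<close>

lemma (in cring) sat_facts:
  assumes p: "primeideal p R" and I: "ideal I R"
  shows "ideal (sat R p I) R" "I \<subseteq> sat R p I" "sat R p (sat R p I) = sat R p I"
proof -
  note F = ideal_facts[OF I]
  have carr: "\<And>y. y \<in> I \<Longrightarrow> y \<in> carrier R" using F by auto
  show sub: "I \<subseteq> sat R p I"
  proof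
    fix x assume "x \<in> I"
    hence "x \<in> carrier R" "\<one> \<otimes> x \<in> I" using carr by auto
    thus "x \<in> sat R p I" unfolding sat_def using prime_one_notin[OF p] by blast
  qed
  show id: "ideal (sat R p I) R"
  proof (rule ideal_cringI)
    show "sat R p I \<subseteq> carrier R" by (auto simp: sat_def)
    show "\<zero> \<in> sat R p I" using sub F by blast
    fix x y assume "x \<in> sat R p I" "y \<in> sat R p I"
    then obtain s t where c: "x \<in> carrier R" "y \<in> carrier R" "s \<in> carrier R - p" "t \<in> carrier R - p"
      and e: "s \<otimes> x \<in> I" "t \<otimes> y \<in> I" by (auto simp: sat_def)
    have c': "s \<in> carrier R" "t \<in> carrier R" using c by auto
    have "(s \<otimes> t) \<otimes> (x \<oplus> y) = t \<otimes> (s \<otimes> x) \<oplus> s \<otimes> (t \<otimes> y)" using c(1,2) c' by algebra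
    hence "(s \<otimes> t) \<otimes> (x \<oplus> y) \<in> I" using e F c' by auto
    thus "x \<oplus> y \<in> sat R p I" unfolding sat_def using prime_mult_notin[OF p c(3,4)] c by blast
  next
    fix r x assume r: "r \<in> carrier R" "x \<in> sat R p I"
    then obtain s where c: "x \<in> carrier R" "s \<in> carrier R - p" and e: "s \<otimes> x \<in> I" by (auto simp: sat_def)
    have "s \<otimes> (r \<otimes> x) = r \<otimes> (s \<otimes> x)" using c r by (simp add: m_lcomm)
    hence "s \<otimes> (r \<otimes> x) \<in> I" using F e r by simp
    thus "r \<otimes> x \<in> sat R p I" unfolding sat_def using c r by blast
  qed
  show "sat R p (sat R p I) = sat R p I"
  proof
    show "sat R p (sat R p I) \<subseteq> sat R p I"
    proof
      fix x assume "x \<in> sat R p (sat R p I)"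
      then obtain s t where c: "x \<in> carrier R" "s \<in> carrier R - p" "t \<in> carrier R - p" "t \<otimes> (s \<otimes> x) \<in> I"
        by (auto simp: sat_def)
      have "(t \<otimes> s) \<otimes> x \<in> I" using c by (simp add: m_assoc)
      thus "x \<in> sat R p I" unfolding sat_def using prime_mult_notin[OF p c(3,2)] c(1) by blast
    qed
    show "sat R p I \<subseteq> sat R p (sat R p I)" using sat_mono[OF sub] .
  qed
qed

lemma satD: "sat R p I = I \<Longrightarrow> s \<in> carrier R - p \<Longrightarrow> x \<in> carrier R \<Longrightarrow> s \<otimes>\<^bsub>R\<^esub> x \<in> I \<Longrightarrow> x \<in> I"
  by (auto simp: sat_def)

text \<open>Elements outside \<open>p\<close> are units of the local ring, so its proper ideals lie
  in its maximal ideal.\<close>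

lemma (in cring) sat_proper:
  assumes p: "primeideal p R" and I: "ideal I R" "sat R p I = I" "I \<noteq> carrier R"
  shows "I \<subseteq> p"
proof
  fix x assume x: "x \<in> I"
  show "x \<in> p"
  proof (rule ccontr)
    assume "x \<notin> p"
    hence "x \<in> carrier R - p" using x ideal_facts(1)[OF I(1)] by auto
    hence "\<one> \<in> I" using satD[OF I(2), of x \<one>] x by simp
    thus False using I(1,3) ideal.one_imp_carrier by blast
  qed
qed

text \<open>\<open>I\<close> may be any set, because the height theorem applies this to finite sets
  of generators.\<close>

definition minimal_prime :: "('a, 'n) ring_scheme \<Rightarrow> 'a set \<Rightarrow> 'a set \<Rightarrow> bool" where
  "minimal_prime R I p \<longleftrightarrow> primeideal p R \<and> I \<subseteq> p \<and> (\<forall>q. primeideal q R \<longrightarrow> I \<subseteq> q \<longrightarrow> q \<subseteq> p \<longrightarrow> q = p)"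

section \<open>Noetherian induction and primes avoiding a multiplicative set\<close>

locale noetherian_cring = noetherian_ring R + cring R for R (structure)
begin

text \<open>Zorn's lemma applies because a nonempty chain of ideals of a noetherian ring contains
  its own union.\<close>

lemma ex_maximal_ideal:
  assumes "Fam \<noteq> {}" "\<And>I. I \<in> Fam \<Longrightarrow> ideal I R"
  obtains M where "M \<in> Fam" "\<And>J. J \<in> Fam \<Longrightarrow> M \<subseteq> J \<Longrightarrow> J = M"
proof -
  have "\<exists>M\<in>Fam. \<forall>W\<in>Fam. M \<subseteq> W \<longrightarrow> W = M"
  proof (rule subset_Zorn_nonempty[OF assms(1)])
    fix C assume C: "C \<noteq> {}" "subset.chain Fam C"
    have "subset.chain {I. ideal I R} C" using C assms(2) by (auto simp: pred_on.chain_def)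
    hence "\<Union>C \<in> C" using ideal_chain_is_trivial C by blast
    thus "\<Union>C \<in> Fam" using C by (auto simp: pred_on.chain_def)
  qed
  thus ?thesis using that by metis
qed

lemma ideal_induct [consumes 1, case_names less]:
  assumes "ideal I R"
    and step: "\<And>I. ideal I R \<Longrightarrow> (\<And>J. ideal J R \<Longrightarrow> I \<subset> J \<Longrightarrow> \<Phi> J) \<Longrightarrow> \<Phi> I"
  shows "\<Phi> I"
proof (rule ccontr)
  assume "\<not> \<Phi> I"
  hence "{J. ideal J R \<and> \<not> \<Phi> J} \<noteq> {}" using assms by blast
  then obtain M where M: "M \<in> {J. ideal J R \<and> \<not> \<Phi> J}"
    "\<And>J. J \<in> {J. ideal J R \<and> \<not> \<Phi> J} \<Longrightarrow> M \<subseteq> J \<Longrightarrow> J = M"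
    by (rule ex_maximal_ideal) auto
  have "\<Phi> M"
  proof (rule step)
    show "ideal M R" using M(1) by simp
    fix J assume "ideal J R" "M \<subset> J"
    then show "\<Phi> J" using M(2)[of J] by blast
  qed
  thus False using M by simp
qed

text \<open>An ideal maximal among those avoiding \<open>S\<close> is prime: if \<open>a\<close> and
  \<open>b\<close> lay outside, members of \<open>p + Ra\<close> and \<open>p + Rb\<close> would lie
  in \<open>S\<close>, and their product would lie in \<open>p\<close> when \<open>a b\<close> does.
  The last clause keeps the maximality; it makes the localization of \<open>R/p\<close> at
  \<open>S\<close> a field.\<close>

lemma ex_prime_disjoint:
  assumes S: "S \<noteq> {}" "S \<subseteq> carrier R" "\<And>x y. x \<in> S \<Longrightarrow> y \<in> S \<Longrightarrow> x \<otimes> y \<in> S"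
    and J: "ideal J R" "J \<inter> S = {}"
  shows "\<exists>p. primeideal p R \<and> J \<subseteq> p \<and> p \<inter> S = {} \<and>
    (\<forall>L. ideal L R \<longrightarrow> p \<subset> L \<longrightarrow> L \<inter> S \<noteq> {})"
proof -
  let ?Fam = "{L. ideal L R \<and> J \<subseteq> L \<and> L \<inter> S = {}}"
  have "?Fam \<noteq> {}" using J by blast
  then obtain p where p: "p \<in> ?Fam" "\<And>L. L \<in> ?Fam \<Longrightarrow> p \<subseteq> L \<Longrightarrow> L = p"
    by (rule ex_maximal_ideal) auto
  have big: "L \<inter> S \<noteq> {}" if "ideal L R" "p \<subset> L" for L
    using p that by blast
  have pid: "ideal p R" using p by simp
  note F = ideal_facts[OF pid]
  have "primeideal p R"
  proof (rule primeidealI[OF pid is_cring])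
    show "carrier R \<noteq> p" using p S by blast
    fix a b assume ab: "a \<in> carrier R" "b \<in> carrier R" "a \<otimes> b \<in> p"
    show "a \<in> p \<or> b \<in> p"
    proof (rule ccontr)
      assume n: "\<not> (a \<in> p \<or> b \<in> p)"
      have "adjoin R p a \<inter> S \<noteq> {}" "adjoin R p b \<inter> S \<noteq> {}"
        using big adjoin_facts[OF pid ab(1)] adjoin_facts[OF pid ab(2)] n by blast+
      then obtain u r v s where c: "u \<in> p" "v \<in> p" "r \<in> carrier R" "s \<in> carrier R"
        and e: "u \<oplus> r \<otimes> a \<in> S" "v \<oplus> s \<otimes> b \<in> S" by (auto simp: adjoin_def)
      have c': "u \<in> carrier R" "v \<in> carrier R" using c F by auto
      have "(u \<oplus> r \<otimes> a) \<otimes> (v \<oplus> s \<otimes> b) = (v \<oplus> s \<otimes> b) \<otimes> u \<oplus> (r \<otimes> a) \<otimes> v \<oplus> (r \<otimes> s) \<otimes> (a \<otimes> b)"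
        using c(3,4) c' ab(1,2) by algebra
      also have "\<dots> \<in> p" using F(3,5) c c' ab by simp
      finally show False using S(3)[OF e] p by blast
    qed
  qed
  thus ?thesis using p(1) big by (intro exI[of _ p]) simp
qed

lemma minimal_prime_local_nilpotent:
  assumes p: "minimal_prime R J p" and J: "ideal J R" and b: "b \<in> p"
  obtains s and m :: nat where "s \<in> carrier R - p" "s \<otimes> b [^] m \<in> J"
proof (rule ccontr)
  assume "\<not> thesis"
  hence no: "\<And>s m. s \<in> carrier R - p \<Longrightarrow> s \<otimes> b [^] (m::nat) \<notin> J" using that by blast
  have pp: "primeideal p R" using p by (simp add: minimal_prime_def)
  have bc: "b \<in> carrier R" using b ideal.Icarr[OF primeideal.axioms(1)[OF pp]] by blast
  let ?S = "{s \<otimes> b [^] m | s m. s \<in> carrier R - p \<and> m \<in> (UNIV::nat set)}"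
  have one: "s \<in> ?S" if "s \<in> carrier R - p" for s
  proof -
    have "s = s \<otimes> b [^] (0::nat)" using that by simp
    thus ?thesis using that by blast
  qed
  have "\<one> \<in> ?S" using one prime_one_notin[OF pp] by blast
  moreover have "?S \<subseteq> carrier R" using bc by auto
  moreover have "x \<otimes> y \<in> ?S" if xy: "x \<in> ?S" "y \<in> ?S" for x y
  proof -
    obtain s m t n where c: "s \<in> carrier R - p" "t \<in> carrier R - p" "x = s \<otimes> b [^] (m::nat)" "y = t \<otimes> b [^] (n::nat)"
      using xy by auto
    have "x \<otimes> y = (s \<otimes> t) \<otimes> b [^] (m + n)"
      using c bc by (simp add: nat_pow_mult[symmetric] m_ac)
    thus ?thesis using prime_mult_notin[OF pp c(1,2)] by blast
  qed
  moreover have "J \<inter> ?S = {}" using no by auto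
  ultimately have "\<exists>q. primeideal q R \<and> J \<subseteq> q \<and> q \<inter> ?S = {} \<and>
      (\<forall>L. ideal L R \<longrightarrow> q \<subset> L \<longrightarrow> L \<inter> ?S \<noteq> {})"
    using J by (intro ex_prime_disjoint) blast+
  then obtain q where q: "primeideal q R" "J \<subseteq> q" "q \<inter> ?S = {}" by (elim exE conjE)
  have "q \<subseteq> carrier R" using ideal_facts(1) primeideal.axioms(1) q by blast
  hence "q \<subseteq> p" using q one by blast
  hence "q = p" using p q by (simp add: minimal_prime_def)
  have "\<one> \<otimes> b [^] (1::nat) \<in> ?S" using prime_one_notin[OF pp] by blast
  hence "b \<in> ?S" using bc by simp
  thus False using q \<open>q = p\<close> b by blast
qed

section \<open>Descending chains over a minimal prime and Krull's height theorem\<close>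

text \<open>The local ring at a minimal prime of \<open>J\<close> is artinian modulo \<open>J\<close>.\<close>

lemma minimal_prime_dcc:
  assumes p: "minimal_prime R J p" and I: "ideal I R"
  shows "J \<subseteq> I \<Longrightarrow> sat R p I = I \<Longrightarrow> (\<And>n. ideal (C n) R \<and> sat R p (C n) = C n \<and> I \<subseteq> C n) \<Longrightarrow>
    (\<And>n. C (Suc n) \<subseteq> C n) \<Longrightarrow> \<exists>n. \<forall>m\<ge>n. C m = C n"
  using I
proof (induction I arbitrary: C rule: ideal_induct)
  case (less I)
  note F = ideal_facts[OF less.hyps]
  have pp: "primeideal p R" using p by (simp add: minimal_prime_def)
  have Cid: "ideal (C n) R" and Csat: "sat R p (C n) = C n" and CI: "I \<subseteq> C n" for n
    using less.prems(3) by blast+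
  have anti: "C m \<subseteq> C n" if "n \<le> m" for n m using lift_Suc_antimono_le[of C, OF less.prems(4) that] .
  \<comment> \<open>If \<open>I\<close> is prime it equals \<open>p\<close>, and only
    \<open>p\<close> and \<open>R\<close> are saturated ideals above it. If \<open>I\<close> is
    proper and not prime, a product \<open>a b\<close> in \<open>I\<close> allows passing to two
    strictly larger ideals.\<close>
  consider "I = carrier R" | "I \<noteq> carrier R" "primeideal I R"
    | a b where "a \<in> carrier R" "b \<in> carrier R" "a \<otimes> b \<in> I" "a \<notin> I" "b \<notin> I"
    using ideal.primeidealCD[OF less.hyps is_cring] by metis
  then show ?case
  proof cases
    case 1
    hence "C n = carrier R" for n using CI[of n] ideal_facts(1)[OF Cid[of n]] by blast
    thus ?thesis by blast
  next
    case 2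
    have "I \<subseteq> p" using sat_proper[OF pp less.hyps less.prems(2) 2(1)] .
    hence "I = p" using p 2 less.prems(1) by (auto simp: minimal_prime_def)
    have d: "C n = p \<or> C n = carrier R" for n
      using sat_proper[OF pp Cid Csat, of n] CI[of n] \<open>I = p\<close> by blast
    show ?thesis
    proof (cases "\<exists>n. C n = p")
      case True
      then obtain n where n: "C n = p" by blast
      have "C m = p" if "m \<ge> n" for m using anti[OF that] n CI[of m] \<open>I = p\<close> by blast
      thus ?thesis using n by blast
    next
      case False
      thus ?thesis using d by metis
    qed
  next
    case 3
    note a = 3(1) and b = 3(2)
    \<comment> \<open>A chain member is controlled by its sum with \<open>Ra\<close> and its colon
      by \<open>a\<close>, as in the exact sequence 0 -> R/(C:a) -> R/C -> R/(C+Ra) -> 0. The sums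
      lie above \<open>?A\<close>, which contains \<open>a\<close>, and the colons above
      \<open>?B\<close>, which contains \<open>b\<close>, so the induction hypothesis stops both
      chains.\<close>
    let ?A = "sat R p (adjoin R I a)"
    let ?B = "{r \<in> carrier R. a \<otimes> r \<in> I}"
    let ?D = "\<lambda>n. sat R p (adjoin R (C n) a)"
    let ?E = "\<lambda>n. {r \<in> carrier R. a \<otimes> r \<in> C n}"
    have colon_sat: "sat R p {r \<in> carrier R. a \<otimes> r \<in> W} = {r \<in> carrier R. a \<otimes> r \<in> W}"
      if W: "ideal W R" "sat R p W = W" for W
    proof
      show "sat R p {r \<in> carrier R. a \<otimes> r \<in> W} \<subseteq> {r \<in> carrier R. a \<otimes> r \<in> W}"
      proof
        fix r assume "r \<in> sat R p {r \<in> carrier R. a \<otimes> r \<in> W}"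
        then obtain s where s: "r \<in> carrier R" "s \<in> carrier R - p" "a \<otimes> (s \<otimes> r) \<in> W" by (auto simp: sat_def)
        have "s \<otimes> (a \<otimes> r) \<in> W" using s a by (simp add: m_lcomm)
        thus "r \<in> {r \<in> carrier R. a \<otimes> r \<in> W}" using satD[OF W(2) s(2), of "a \<otimes> r"] a s by simp
      qed
    qed (use sat_facts(2)[OF pp ideal.helper_max_prime[OF W(1) is_cring a]] in blast)
    have "\<exists>n. \<forall>m\<ge>n. ?D m = ?D n"
    proof (rule less.IH[of ?A ?D])
      show "ideal ?A R" "sat R p ?A = ?A" using sat_facts[OF pp adjoin_facts(1)[OF less.hyps a]] by auto
      show "I \<subset> ?A" "J \<subseteq> ?A"
        using sat_facts(2)[OF pp adjoin_facts(1)[OF less.hyps a]] adjoin_facts(2,3)[OF less.hyps a] 3 less.prems(1)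
        by blast+
      fix n
      have "adjoin R I a \<subseteq> adjoin R (C n) a" using CI[of n] by (auto simp: adjoin_def)
      thus "ideal (?D n) R \<and> sat R p (?D n) = ?D n \<and> ?A \<subseteq> ?D n"
        using sat_facts[OF pp adjoin_facts(1)[OF Cid[of n] a]] sat_mono by metis
      have "adjoin R (C (Suc n)) a \<subseteq> adjoin R (C n) a" using less.prems(4)[of n] by (auto simp: adjoin_def)
      thus "?D (Suc n) \<subseteq> ?D n" by (rule sat_mono)
    qed
    then obtain n1 where n1: "\<And>m. m \<ge> n1 \<Longrightarrow> ?D m = ?D n1" by blast
    have "\<exists>n. \<forall>m\<ge>n. ?E m = ?E n"
    proof (rule less.IH[of ?B ?E])
      show "ideal ?B R" by (rule ideal.helper_max_prime[OF less.hyps is_cring a])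
      have "I \<subseteq> ?B" using F a by auto
      thus "I \<subset> ?B" "J \<subseteq> ?B" using 3 less.prems(1) by blast+
      show "sat R p ?B = ?B" by (rule colon_sat[OF less.hyps less.prems(2)])
      fix n show "ideal (?E n) R \<and> sat R p (?E n) = ?E n \<and> ?B \<subseteq> ?E n"
        using ideal.helper_max_prime[OF Cid is_cring a] colon_sat[OF Cid Csat] CI[of n] by blast
      show "?E (Suc n) \<subseteq> ?E n" using less.prems(4)[of n] by blast
    qed
    then obtain n2 where n2: "\<And>m. m \<ge> n2 \<Longrightarrow> ?E m = ?E n2" by blast
    define n where "n = max n1 n2"
    have "C m = C n" if m: "m \<ge> n" for m
    proof
      show "C m \<subseteq> C n" by (rule anti[OF m])
      have De: "?D m = ?D n" using n1[of m] n1[of n] m by (simp add: n_def)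
      have "?E m = ?E n" using n2[of m] n2[of n] m by (simp add: n_def)
      hence Ee: "a \<otimes> r \<in> C n \<Longrightarrow> r \<in> carrier R \<Longrightarrow> a \<otimes> r \<in> C m" for r by blast
      show "C n \<subseteq> C m"
      proof
        fix x assume x: "x \<in> C n"
        have xc: "x \<in> carrier R" using x ideal_facts(1)[OF Cid] by blast
        have "x \<in> ?D n"
          using sat_facts(2)[OF pp adjoin_facts(1)[OF Cid a]] adjoin_facts(2)[OF Cid a] x by blast
        hence "x \<in> ?D m" using De by simp
        then obtain s y r where s: "s \<in> carrier R - p" and y: "y \<in> C m" and r: "r \<in> carrier R"
          and e: "s \<otimes> x = y \<oplus> r \<otimes> a" by (auto simp: sat_def adjoin_def)
        have yc: "y \<in> carrier R" using y ideal_facts(1)[OF Cid] by blast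
        \<comment> \<open>Here \<open>s x = y + r a\<close> with \<open>y\<close> already in the
          smaller ideal, so only the multiple of \<open>a\<close> is in question, and the stable
          colon decides it.\<close>
        have "a \<otimes> r \<oplus> y \<in> C n"
          using ideal_facts(5)[OF Cid, of s x n] x s e a r yc by (simp add: m_comm a_comm)
        hence "a \<otimes> r \<in> C n" using ideal_add_cancel[OF Cid] anti[OF m] a r y by blast
        hence "a \<otimes> r \<in> C m" using Ee r by blast
        hence "s \<otimes> x \<in> C m" unfolding e using ideal_facts(3)[OF Cid y] a r m_comm by simp
        thus "x \<in> C m" using satD[OF Csat s xc] by blast
      qed
    qed
    thus ?thesis by blast
  qed
qed

text \<open>Nakayama's lemma in the localization at \<open>p\<close>, for the ideal generated by \<open>a\<close>.\<close>

lemma nakayama_sat: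
  assumes p: "primeideal p R" and a: "a \<in> p"
    and N: "ideal N R" "sat R p N = N" and N': "ideal N' R" "sat R p N' = N'" "N' \<subseteq> N"
    and eq: "\<And>x. x \<in> N \<Longrightarrow> \<exists>s\<in>carrier R - p. \<exists>y\<in>N'. \<exists>z\<in>N. s \<otimes> x = y \<oplus> a \<otimes> z"
  shows "N' = N"
proof (rule ccontr)
  assume ne: "N' \<noteq> N"
  have pid: "ideal p R" using p by (rule primeideal.axioms(1))
  have ac: "a \<in> carrier R" using a ideal_facts(1)[OF pid] by blast
  \<comment> \<open>A maximal saturated \<open>L\<close> properly below \<open>N\<close> replaces a
    minimal generating set: locally \<open>N\<close> is then \<open>L + Rx\<close>, and a single
    element has to be eliminated.\<close>
  let ?Fam = "{L. ideal L R \<and> sat R p L = L \<and> N' \<subseteq> L \<and> L \<subset> N}"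
  have "?Fam \<noteq> {}" using N' ne by blast
  then obtain L where L: "L \<in> ?Fam" "\<And>L'. L' \<in> ?Fam \<Longrightarrow> L \<subseteq> L' \<Longrightarrow> L' = L"
    by (rule ex_maximal_ideal) auto
  have Lid: "ideal L R" and Ls: "sat R p L = L" using L by auto
  obtain x where x: "x \<in> N" "x \<notin> L" using L by blast
  have xc: "x \<in> carrier R" using x ideal_facts(1)[OF N(1)] by blast
  let ?L = "sat R p (adjoin R L x)"
  note A = adjoin_facts[OF Lid xc]
  note S = sat_facts[OF p A(1)]
  have "adjoin R L x \<subseteq> N" using A(4)[OF N(1)] L x by blast
  hence LN: "?L \<subseteq> N" using sat_mono[of _ N R p] N by simp
  have xL: "x \<in> ?L" "L \<subseteq> ?L" using A S by auto
  have eqL: "?L = N"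
  proof (rule ccontr)
    assume "?L \<noteq> N"
    hence "?L \<in> ?Fam" using L(1) S(1,3) LN xL(2) by blast
    hence "?L = L" using L(2) xL(2) by blast
    thus False using x(2) xL(1) by blast
  qed
  obtain s y z where s: "s \<in> carrier R - p" and y: "y \<in> N'" and z: "z \<in> N" and e: "s \<otimes> x = y \<oplus> a \<otimes> z"
    using eq[OF x(1)] by blast
  have "z \<in> ?L" using z eqL by simp
  then obtain t l r where t: "t \<in> carrier R - p" and l: "l \<in> L" and r: "r \<in> carrier R"
    and e2: "t \<otimes> z = l \<oplus> r \<otimes> x" by (auto simp: sat_def adjoin_def)
  have c: "s \<in> carrier R" "t \<in> carrier R" "y \<in> carrier R" "z \<in> carrier R" "l \<in> carrier R"
    using s t y z l ideal_facts(1)[OF N(1)] N'(3) ideal_facts(1)[OF Lid] by auto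
  have "(s \<otimes> t \<ominus> a \<otimes> r) \<otimes> x = t \<otimes> (s \<otimes> x) \<ominus> a \<otimes> r \<otimes> x" using c xc ac r by algebra
  also have "\<dots> = t \<otimes> y \<oplus> a \<otimes> (t \<otimes> z) \<ominus> a \<otimes> r \<otimes> x" unfolding e using c xc ac r by algebra
  also have "\<dots> = t \<otimes> y \<oplus> a \<otimes> l" unfolding e2 using c xc ac r by algebra
  also have "\<dots> \<in> L" using ideal_facts[OF Lid] L y l c ac by auto
  finally have mem: "(s \<otimes> t \<ominus> a \<otimes> r) \<otimes> x \<in> L" .
  \<comment> \<open>As \<open>a\<close> lies in \<open>p\<close> and \<open>s t\<close> does not,
    the factor is a unit of the local ring and can be cancelled.\<close>
  have "s \<otimes> t \<ominus> a \<otimes> r \<notin> p"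
  proof
    assume "s \<otimes> t \<ominus> a \<otimes> r \<in> p"
    moreover have "s \<otimes> t = (s \<otimes> t \<ominus> a \<otimes> r) \<oplus> a \<otimes> r" using c ac r by algebra
    moreover have "a \<otimes> r \<in> p" using ideal_facts(6)[OF pid r a] .
    ultimately have "s \<otimes> t \<in> p" using ideal_facts(3)[OF pid] by metis
    thus False using prime_mult_notin[OF p s t] by simp
  qed
  hence "x \<in> L" using satD[OF Ls _ xc mem] c ac r by auto
  thus False using x by simp
qed

text \<open>For \<open>y \<in> q - q'\<close> the ideals \<open>y\<^sup>n R\<^sub>q \<inter> R\<close> form a descending
  chain. It stabilizes modulo \<open>a\<close>, so by Nakayama it stabilizes, which makes \<open>y\<close> a unit in \<open>R\<^sub>q/q'\<close>.\<close>

theorem principal_ideal_theorem: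
  assumes q': "primeideal q' R" and q: "primeideal q R" and "q' \<subset> q" "q \<subset> p"
    and ap: "minimal_prime R (adjoin R q' a) p" and a: "a \<in> carrier R"
  shows False
proof -
  have p: "primeideal p R" using ap by (simp add: minimal_prime_def)
  have pid: "ideal p R" and qid: "ideal q R" and qid': "ideal q' R"
    using p q q' by (auto simp: primeideal.axioms)
  note A = adjoin_facts[OF qid' a]
  have a_p: "a \<in> p" using A(3) ap by (auto simp: minimal_prime_def)
  have a_q: "a \<notin> q" using A(4)[OF qid] ap q \<open>q' \<subset> q\<close> \<open>q \<subset> p\<close> by (auto simp: minimal_prime_def)
  have a_q2: "a \<in> carrier R - q" using a a_q by simp
  obtain y where y: "y \<in> q" "y \<notin> q'" using \<open>q' \<subset> q\<close> by blast
  have yc: "y \<in> carrier R" using y ideal_facts(1)[OF qid] by blast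
  \<comment> \<open>Modulo \<open>q'\<close> these are the symbolic powers, at \<open>q\<close>, of
    the principal ideal of \<open>y\<close>.\<close>
  define N where "N n = sat R q (adjoin R q' (y [^] (n::nat)))" for n
  have An: "ideal (adjoin R q' (y [^] (n::nat))) R" for n using adjoin_facts(1)[OF qid'] yc by simp
  have Nid: "ideal (N n) R" for n using sat_facts(1)[OF q An] by (simp add: N_def)
  have Nsub: "N (Suc n) \<subseteq> N n" for n
  proof -
    have "y [^] Suc n \<in> adjoin R q' (y [^] n)"
      using ideal_facts(5)[OF An[of n] yc adjoin_facts(3)[OF qid', of "y [^] n"]] yc
      by (simp add: m_comm)
    hence "adjoin R q' (y [^] Suc n) \<subseteq> adjoin R q' (y [^] n)"
      using adjoin_facts(4)[OF qid' _ An[of n], of "y [^] Suc n"] adjoin_facts(2)[OF qid', of "y [^] n"] yc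
      by simp
    thus ?thesis unfolding N_def by (rule sat_mono)
  qed
  have NS: "sat R q (N n) = N n" for n unfolding N_def by (rule sat_facts(3)[OF q An])
  \<comment> \<open>Elements outside \<open>p\<close> are also outside \<open>q\<close>, so
    saturation at \<open>q\<close> entails saturation at \<open>p\<close>.\<close>
  have Nsat: "sat R p (N n) = N n" for n
  proof
    show "sat R p (N n) \<subseteq> N n" using NS[of n] \<open>q \<subset> p\<close> unfolding sat_def by blast
  qed (rule sat_facts(2)[OF p Nid])
  have qN: "q' \<subseteq> N n" for n
    using sat_facts(2)[OF q An] adjoin_facts(2)[OF qid'] yc unfolding N_def by (meson nat_pow_closed subset_trans)
  let ?D = "\<lambda>n. sat R p (adjoin R (N n) a)"
  have "\<exists>n. \<forall>m\<ge>n. ?D m = ?D n"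
  proof (rule minimal_prime_dcc[OF ap, of "sat R p (adjoin R q' a)" ?D])
    show "ideal (sat R p (adjoin R q' a)) R" "adjoin R q' a \<subseteq> sat R p (adjoin R q' a)"
      "sat R p (sat R p (adjoin R q' a)) = sat R p (adjoin R q' a)" using sat_facts[OF p A(1)] by auto
    fix n
    have "adjoin R q' a \<subseteq> adjoin R (N n) a" using qN[of n] by (auto simp: adjoin_def)
    thus "ideal (?D n) R \<and> sat R p (?D n) = ?D n \<and> sat R p (adjoin R q' a) \<subseteq> ?D n"
      using sat_facts[OF p adjoin_facts(1)[OF Nid a]] sat_mono by metis
    have "adjoin R (N (Suc n)) a \<subseteq> adjoin R (N n) a" using Nsub[of n] by (auto simp: adjoin_def)
    thus "?D (Suc n) \<subseteq> ?D n" by (rule sat_mono)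
  qed
  then obtain n where n: "?D (Suc n) = ?D n" using le_SucI by blast
  \<comment> \<open>Stability modulo \<open>a\<close> gives \<open>s x = u + z a\<close> with
    \<open>u\<close> in \<open>N (Suc n)\<close>. Since \<open>a\<close> lies outside
    \<open>q\<close>, the coefficient \<open>z\<close> falls back into \<open>N n\<close>, which is
    the shape Nakayama's lemma asks for.\<close>
  have "N (Suc n) = N n"
  proof (rule nakayama_sat[OF p a_p Nid Nsat Nid Nsat Nsub])
    fix x assume x: "x \<in> N n"
    have xc: "x \<in> carrier R" using x ideal_facts(1)[OF Nid] by blast
    have "x \<in> ?D n"
      using sat_facts(2)[OF p adjoin_facts(1)[OF Nid a]] adjoin_facts(2)[OF Nid a] x by blast
    hence "x \<in> ?D (Suc n)" using n by simp
    then obtain s u z where s: "s \<in> carrier R - p" and u: "u \<in> N (Suc n)" and z: "z \<in> carrier R"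
      and e: "s \<otimes> x = u \<oplus> z \<otimes> a" by (auto simp: sat_def adjoin_def)
    have uc: "u \<in> carrier R" using u ideal_facts(1)[OF Nid] by blast
    have "a \<otimes> z \<oplus> u \<in> N n"
      using ideal_facts(5)[OF Nid, of s x n] x s e a z uc by (simp add: m_comm a_comm)
    hence "a \<otimes> z \<in> N n" using ideal_add_cancel[OF Nid] Nsub a z u by blast
    hence "z \<in> N n" using satD[OF NS a_q2 z] by blast
    thus "\<exists>s\<in>carrier R - p. \<exists>y\<in>N (Suc n). \<exists>z\<in>N n. s \<otimes> x = y \<oplus> a \<otimes> z"
      using s u e z a m_comm by metis
  qed
  moreover have "y [^] n \<in> N n"
    using sat_facts(2)[OF q An] adjoin_facts(3)[OF qid', of "y [^] n"] yc by (auto simp: N_def)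
  ultimately have "y [^] n \<in> N (Suc n)" by simp
  then obtain s u r where s: "s \<in> carrier R - q" and u: "u \<in> q'" and r: "r \<in> carrier R"
    and e: "s \<otimes> y [^] n = u \<oplus> r \<otimes> y [^] Suc n" by (auto simp: N_def sat_def adjoin_def)
  have c: "s \<in> carrier R" "u \<in> carrier R" "y [^] n \<in> carrier R" using s u yc ideal_facts(1)[OF qid'] by auto
  have "(s \<ominus> r \<otimes> y) \<otimes> y [^] n = s \<otimes> y [^] n \<ominus> r \<otimes> (y [^] n \<otimes> y)" using c yc r by algebra
  also have "\<dots> = u" unfolding e using c yc r by (simp add: minus_eq a_assoc r_neg)
  finally have "(s \<ominus> r \<otimes> y) \<otimes> y [^] n \<in> q'" using u by simp
  moreover have "y [^] n \<notin> q'" using prime_pow_notin[OF q', of y n] y yc by simp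
  ultimately have "s \<ominus> r \<otimes> y \<in> q'" using primeideal.I_prime[OF q', of "s \<ominus> r \<otimes> y" "y [^] n"] c r yc by auto
  hence "s \<ominus> r \<otimes> y \<in> q" using \<open>q' \<subset> q\<close> by blast
  moreover have "r \<otimes> y \<in> q" using ideal_facts(5)[OF qid r y(1)] .
  moreover have "s = (s \<ominus> r \<otimes> y) \<oplus> r \<otimes> y" using c r yc by algebra
  ultimately have "s \<in> q" using ideal_facts(3)[OF qid] by metis
  thus False using s by simp
qed

text \<open>The induction on the number of generators in Krull's height theorem.\<close>

lemma minimal_prime_acc:
  assumes "finite A" "card A \<le> n" "A \<subseteq> carrier R" "minimal_prime R A p"
  shows "p \<in> Wellfounded.acc {(q, p). primeideal q R \<and> primeideal p R \<and> q \<subset> p}"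
  using assms
proof (induction n arbitrary: A p)
  case 0
  hence "A = {}" by simp
  show ?case
  proof (rule accI)
    fix q assume "(q, p) \<in> {(q, p). primeideal q R \<and> primeideal p R \<and> q \<subset> p}"
    thus "q \<in> Wellfounded.acc {(q, p). primeideal q R \<and> primeideal p R \<and> q \<subset> p}"
      using 0 \<open>A = {}\<close> by (auto simp: minimal_prime_def)
  qed
next
  case (Suc n)
  let ?Acc = "Wellfounded.acc {(q, p). primeideal q R \<and> primeideal p R \<and> q \<subset> p}"
  have p: "primeideal p R" and Ap: "A \<subseteq> p" using Suc.prems by (auto simp: minimal_prime_def)
  have pid: "ideal p R" using p by (rule primeideal.axioms)
  show ?case
  proof (rule accI)
    fix q0 assume "(q0, p) \<in> {(q, p). primeideal q R \<and> primeideal p R \<and> q \<subset> p}"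
    hence q0: "primeideal q0 R" "q0 \<subset> p" by auto
    \<comment> \<open>Accessibility passes to smaller primes, so it is enough to reach a prime
      \<open>q\<close> maximal among those between \<open>q0\<close> and \<open>p\<close>. For such
      a \<open>q\<close> and any \<open>a\<close> in \<open>p - q\<close>, the prime
      \<open>p\<close> is minimal over \<open>q + Ra\<close>.\<close>
    let ?Fam = "{q. primeideal q R \<and> q0 \<subseteq> q \<and> q \<subset> p}"
    have "?Fam \<noteq> {}" using q0 by blast
    then obtain q where q: "q \<in> ?Fam" "\<And>r. r \<in> ?Fam \<Longrightarrow> q \<subseteq> r \<Longrightarrow> r = q"
      by (rule ex_maximal_ideal) (auto simp: primeideal.axioms)
    have qp: "primeideal q R" "q0 \<subseteq> q" "q \<subset> p" using q by auto
    have qid: "ideal q R" using qp by (auto simp: primeideal.axioms)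
    have "\<not> A \<subseteq> q" using Suc.prems(4) qp by (auto simp: minimal_prime_def)
    then obtain a where a: "a \<in> A" "a \<notin> q" by blast
    have ac: "a \<in> carrier R" using a Suc.prems by blast
    note AJ = adjoin_facts[OF qid ac]
    have minp: "minimal_prime R (adjoin R q a) p"
      unfolding minimal_prime_def
    proof (intro conjI allI impI)
      show "adjoin R q a \<subseteq> p" using AJ(4)[OF pid] qp Ap a by blast
      fix r assume r: "primeideal r R" "adjoin R q a \<subseteq> r" "r \<subseteq> p"
      show "r = p"
      proof (rule ccontr)
        assume "r \<noteq> p"
        hence "r \<in> ?Fam" using r qp AJ by blast
        hence "r = q" using q(2) r AJ by blast
        thus False using r AJ a by blast
      qed
    qed (rule p)
    \<comment> \<open>Modulo \<open>a\<close>, a power of each remaining generator is traded, up to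
      a local unit, for an element \<open>c b\<close> of \<open>q\<close>. This leaves one generator
      fewer for \<open>q\<close>.\<close>
    have "\<forall>b\<in>A - {a}. \<exists>c\<in>q. \<exists>s\<in>carrier R - p. \<exists>m::nat. \<exists>r\<in>carrier R. s \<otimes> b [^] m = c \<oplus> r \<otimes> a"
    proof
      fix b assume "b \<in> A - {a}"
      hence "b \<in> p" using Ap by blast
      then obtain s and m :: nat where "s \<in> carrier R - p" "s \<otimes> b [^] m \<in> adjoin R q a"
        by (rule minimal_prime_local_nilpotent[OF minp AJ(1)])
      thus "\<exists>c\<in>q. \<exists>s\<in>carrier R - p. \<exists>m::nat. \<exists>r\<in>carrier R. s \<otimes> b [^] m = c \<oplus> r \<otimes> a"
        unfolding adjoin_def by blast
    qed
    then obtain c where c: "\<And>b. b \<in> A - {a} \<Longrightarrow> c b \<in> q \<and>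
        (\<exists>s\<in>carrier R - p. \<exists>m::nat. \<exists>r\<in>carrier R. s \<otimes> b [^] m = c b \<oplus> r \<otimes> a)" by metis
    let ?A = "c ` (A - {a})"
    have Aq: "?A \<subseteq> q" using c by auto
    have p_min: "r = p" if r: "primeideal r R" "?A \<subseteq> r" "a \<in> r" "r \<subseteq> p" for r
    proof -
      have rid: "ideal r R" using r by (auto simp: primeideal.axioms)
      have "b \<in> r" if b: "b \<in> A" for b
      proof (cases "b = a")
        case False
        hence bA: "b \<in> A - {a}" using b by simp
        then obtain s z and m :: nat where s: "s \<in> carrier R - p" "z \<in> carrier R" "s \<otimes> b [^] m = c b \<oplus> z \<otimes> a"
          using c[OF bA] by blast
        have "c b \<in> r" using r(2) bA by blast
        hence "s \<otimes> b [^] m \<in> r" using s(3) ideal_facts(3,5)[OF rid] s(2) r(3) by auto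
        moreover have "s \<in> carrier R - r" using s r by blast
        moreover have bc: "b \<in> carrier R" using b Suc.prems by blast
        ultimately show ?thesis
          using prime_mult_notin[OF r(1), of s "b [^] m"] prime_pow_notin[OF r(1), of b m] by blast
      qed (use r in simp)
      thus ?thesis using Suc.prems(4) r by (auto simp: minimal_prime_def)
    qed
    \<comment> \<open>A prime \<open>r\<close> properly inside \<open>q\<close> containing all
      \<open>c b\<close> would make \<open>p\<close> minimal over \<open>r + Ra\<close>, and the
      chain \<open>r\<close>, \<open>q\<close>, \<open>p\<close> contradicts the principal ideal
      theorem.\<close>
    have minq: "minimal_prime R ?A q"
      unfolding minimal_prime_def
    proof (intro conjI allI impI Aq)
      fix r assume r: "primeideal r R" "?A \<subseteq> r" "r \<subseteq> q"
      show "r = q"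
      proof (rule ccontr)
        assume "r \<noteq> q"
        hence rq: "r \<subset> q" using r by blast
        have rid: "ideal r R" using r by (auto simp: primeideal.axioms)
        note AR = adjoin_facts[OF rid ac]
        have "minimal_prime R (adjoin R r a) p"
          unfolding minimal_prime_def
        proof (intro conjI allI impI p)
          show "adjoin R r a \<subseteq> p" using AR(4)[OF pid] r(3) qp(3) Ap a(1) by blast
          fix r' assume r': "primeideal r' R" "adjoin R r a \<subseteq> r'" "r' \<subseteq> p"
          have "?A \<subseteq> r'" "a \<in> r'" using r(2) r'(2) AR(2,3) by blast+
          thus "r' = p" using p_min[OF r'(1) _ _ r'(3)] by blast
        qed
        thus False using principal_ideal_theorem[OF r(1) qp(1) rq qp(3) _ ac] by blast
      qed
    qed (rule qp)
    have "card (A - {a}) \<le> n" using Suc.prems a by simp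
    hence "card ?A \<le> n" using card_image_le[of "A - {a}" c] Suc.prems by simp
    hence "q \<in> ?Acc"
      using Suc.IH[of ?A q] minq Suc.prems Aq ideal_facts(1)[OF qid] by blast
    show "q0 \<in> ?Acc"
    proof (cases "q0 = q")
      case False
      thus ?thesis using \<open>q \<in> ?Acc\<close> qp q0 by (auto intro: acc_downward)
    qed (use \<open>q \<in> ?Acc\<close> in simp)
  qed
qed

text \<open>Every prime is finitely generated, hence minimal over a finite set, namely its own
  generators.\<close>

lemma wf_primes: "wf {(q, p). primeideal q R \<and> primeideal p R \<and> q \<subset> p}"
proof -
  have "p \<in> Wellfounded.acc {(q, p). primeideal q R \<and> primeideal p R \<and> q \<subset> p}" for p
  proof (cases "primeideal p R")
    case True
    hence pid: "ideal p R" by (rule primeideal.axioms)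
    then obtain A where A: "A \<subseteq> carrier R" "finite A" "p = Idl A"
      using finetely_gen by blast
    have "minimal_prime R A p"
      unfolding minimal_prime_def
      using True A genideal_self[OF A(1)] genideal_minimal primeideal.axioms(1) by blast
    thus ?thesis using minimal_prime_acc[OF A(2) order_refl A(1)] by blast
  next
    case False
    thus ?thesis by (auto intro: accI)
  qed
  thus ?thesis using acc_wfI by blast
qed

lemma ex_minimal_among_primes:
  assumes q: "q \<in> Fam" and primes: "\<And>p. p \<in> Fam \<Longrightarrow> primeideal p R"
  shows "\<exists>p\<in>Fam. \<forall>p'\<in>Fam. p' \<subseteq> p \<longrightarrow> p' = p"
proof -
  obtain p where p: "p \<in> Fam"
    "\<And>y. (y, p) \<in> {(q, p). primeideal q R \<and> primeideal p R \<and> q \<subset> p} \<Longrightarrow> y \<notin> Fam"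
    by (rule wfE_min[OF wf_primes q]) blast
  have "p' = p" if "p' \<in> Fam" "p' \<subseteq> p" for p'
  proof (rule ccontr)
    assume "p' \<noteq> p"
    hence "(p', p) \<in> {(q, p). primeideal q R \<and> primeideal p R \<and> q \<subset> p}"
      using that primes[OF p(1)] primes[OF that(1)] by auto
    hence "p' \<notin> Fam" by (rule p(2))
    thus False using that(1) by simp
  qed
  thus ?thesis using p(1) by blast
qed

lemma ex_minimal_prime:
  assumes "primeideal q R" "I \<subseteq> q"
  obtains p where "minimal_prime R I p" "p \<subseteq> q"
proof -
  let ?Fam = "{p. primeideal p R \<and> I \<subseteq> p \<and> p \<subseteq> q}"
  have "\<exists>p\<in>?Fam. \<forall>p'\<in>?Fam. p' \<subseteq> p \<longrightarrow> p' = p"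
    by (rule ex_minimal_among_primes[of q]) (use assms in auto)
  then obtain p where p: "p \<in> ?Fam" "\<forall>p'\<in>?Fam. p' \<subseteq> p \<longrightarrow> p' = p" by blast
  have "minimal_prime R I p" unfolding minimal_prime_def
  proof (intro conjI allI impI)
    fix p' assume p': "primeideal p' R" "I \<subseteq> p'" "p' \<subseteq> p"
    hence "p' \<in> ?Fam" using p(1) by auto
    thus "p' = p" using p(2) p'(3) by blast
  qed (use p(1) in auto)
  thus ?thesis using that p(1) by blast
qed

end

section \<open>Differential prime ideals\<close>

text \<open>Collects what depends on the ring and its derivations alone. Characteristic zero arrives
  as \<open>rational_units\<close>: positive integers can be divided by.\<close>

locale noetherian_diff_ring = noetherian_cring R for R (structure) +
  fixes \<Delta> :: "('a \<Rightarrow> 'a) set"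
  assumes derivation: "\<delta> \<in> \<Delta> \<Longrightarrow> \<delta> \<in> ring_der R"
    and rational_units: "(n::nat) > 0 \<Longrightarrow> [n] \<cdot> \<one> \<in> Units R"
begin

abbreviation "DSpec \<equiv> delta_spec R \<Delta>"
abbreviation "DTop \<equiv> delta_spec_topology R \<Delta>"
abbreviation "cl \<equiv> Abstract_Topology.closure_of DTop"
abbreviation "core \<equiv> delta_core R \<Delta>"
abbreviation "Dideal \<equiv> delta_ideal R \<Delta>"
text \<open>A finite coinitial set among the \<Delta>-primes over \<open>I\<close>. Its members may
  be comparable with each other; only finiteness matters for counting.\<close>

abbreviation "minorants I \<Lambda> \<equiv> finite \<Lambda> \<and> \<Lambda> \<subseteq> DSpec \<and> (\<forall>q\<in>\<Lambda>. I \<subseteq> q) \<and>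
  (\<forall>Q\<in>DSpec. I \<subseteq> Q \<longrightarrow> (\<exists>q\<in>\<Lambda>. q \<subseteq> Q))"

section \<open>Derivations and \<Delta>-ideals\<close>

lemma der_closed: "\<delta> \<in> \<Delta> \<Longrightarrow> a \<in> carrier R \<Longrightarrow> \<delta> a \<in> carrier R"
  and der_add: "\<delta> \<in> \<Delta> \<Longrightarrow> a \<in> carrier R \<Longrightarrow> b \<in> carrier R \<Longrightarrow> \<delta> (a \<oplus> b) = \<delta> a \<oplus> \<delta> b"
  and der_mult: "\<delta> \<in> \<Delta> \<Longrightarrow> a \<in> carrier R \<Longrightarrow> b \<in> carrier R \<Longrightarrow> \<delta> (a \<otimes> b) = \<delta> a \<otimes> b \<oplus> a \<otimes> \<delta> b"
  using derivation by (auto simp: ring_der_def)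

lemma der_zero: "\<delta> \<in> \<Delta> \<Longrightarrow> \<delta> \<zero> = \<zero>"
  using der_add[of \<delta> \<zero> \<zero>] der_closed[of \<delta> \<zero>] by simp

lemma der_one: "\<delta> \<in> \<Delta> \<Longrightarrow> \<delta> \<one> = \<zero>"
  using der_mult[of \<delta> \<one> \<one>] der_closed[of \<delta> \<one>] by simp

lemma der_pow:
  assumes "\<delta> \<in> \<Delta>" "b \<in> carrier R"
  shows "\<delta> (b [^] Suc n) = [Suc n] \<cdot> (b [^] n \<otimes> \<delta> b)"
proof (induction n)
  case 0
  show ?case using assms der_closed by simp
next
  case (Suc n)
  note d = der_closed[OF assms]
  have "\<delta> (b [^] Suc (Suc n)) = \<delta> (b [^] Suc n) \<otimes> b \<oplus> b [^] Suc n \<otimes> \<delta> b"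
    using der_mult[OF assms(1), of "b [^] Suc n" b] assms by simp
  also have "\<dots> = [Suc n] \<cdot> (b [^] n \<otimes> \<delta> b) \<otimes> b \<oplus> b [^] Suc n \<otimes> \<delta> b" by (simp only: Suc.IH)
  also have "[Suc n] \<cdot> (b [^] n \<otimes> \<delta> b) \<otimes> b = [Suc n] \<cdot> ((b [^] n \<otimes> \<delta> b) \<otimes> b)"
    using add_pow_ldistr[of "b [^] n \<otimes> \<delta> b" b "Suc n"] assms d by simp
  also have "(b [^] n \<otimes> \<delta> b) \<otimes> b = b [^] Suc n \<otimes> \<delta> b" using assms d by (simp add: m_ac)
  also have "[Suc n] \<cdot> (b [^] Suc n \<otimes> \<delta> b) \<oplus> b [^] Suc n \<otimes> \<delta> b = [Suc (Suc n)] \<cdot> (b [^] Suc n \<otimes> \<delta> b)"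
    using assms d by simp
  finally show ?case .
qed

lemma delta_idealD:
  assumes "Dideal I"
  shows "ideal I R" "\<And>\<delta> x. \<delta> \<in> \<Delta> \<Longrightarrow> x \<in> I \<Longrightarrow> \<delta> x \<in> I"
  using assms by (auto simp: delta_ideal_def)

lemma delta_idealI:
  assumes "ideal I R" "\<And>\<delta> x. \<delta> \<in> \<Delta> \<Longrightarrow> x \<in> I \<Longrightarrow> \<delta> x \<in> I"
  shows "Dideal I"
  using assms by (auto simp: delta_ideal_def)

lemma delta_ideal_carrier: "Dideal (carrier R)"
  using der_closed oneideal by (intro delta_idealI)

lemma delta_ideal_zero: "Dideal {\<zero>}"
  using der_zero zeroideal by (intro delta_idealI) auto

lemma delta_ideal_Inter:
  assumes "\<And>I. I \<in> C \<Longrightarrow> Dideal I" "C \<noteq> {}"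
  shows "Dideal (\<Inter>C)"
  using assms i_Intersect[of C] delta_idealD by (intro delta_idealI) auto

lemma ideal_sum_facts:
  assumes "ideal I R" "ideal J R"
  shows "ideal (I <+>\<^bsub>R\<^esub> J) R" "I \<subseteq> I <+>\<^bsub>R\<^esub> J" "J \<subseteq> I <+>\<^bsub>R\<^esub> J"
    "\<And>L. ideal L R \<Longrightarrow> I \<subseteq> L \<Longrightarrow> J \<subseteq> L \<Longrightarrow> I <+>\<^bsub>R\<^esub> J \<subseteq> L"
proof -
  have c: "I \<union> J \<subseteq> carrier R" using ideal_facts(1) assms by blast
  show "ideal (I <+>\<^bsub>R\<^esub> J) R" using assms by (rule add_ideals)
  show "I \<subseteq> I <+>\<^bsub>R\<^esub> J" "J \<subseteq> I <+>\<^bsub>R\<^esub> J" "\<And>L. ideal L R \<Longrightarrow> I \<subseteq> L \<Longrightarrow> J \<subseteq> L \<Longrightarrow> I <+>\<^bsub>R\<^esub> J \<subseteq> L"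
    using genideal_self[OF c] genideal_minimal[of _ "I \<union> J"] union_genideal[OF assms] by auto
qed

lemma delta_ideal_sum:
  assumes "Dideal I" "Dideal J"
  shows "Dideal (I <+>\<^bsub>R\<^esub> J)"
proof (rule delta_idealI)
  note I = delta_idealD[OF assms(1)] and J = delta_idealD[OF assms(2)]
  show "ideal (I <+>\<^bsub>R\<^esub> J) R" using I J by (simp add: ideal_sum_facts)
  fix \<delta> x assume d: "\<delta> \<in> \<Delta>" and "x \<in> I <+>\<^bsub>R\<^esub> J"
  then obtain a b where ab: "a \<in> I" "b \<in> J" "x = a \<oplus> b" by (auto simp: set_add_def')
  have "\<delta> x = \<delta> a \<oplus> \<delta> b"
    using ab ideal_facts(1)[OF I(1)] ideal_facts(1)[OF J(1)] der_add[OF d] by auto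
  thus "\<delta> x \<in> I <+>\<^bsub>R\<^esub> J" using I(2)[OF d] J(2)[OF d] ab by (auto simp: set_add_def')
qed

lemma delta_ideal_prod:
  assumes "Dideal I" "Dideal J"
  shows "Dideal (I \<cdot> J)"
proof (rule delta_idealI)
  note I = delta_idealD[OF assms(1)] and J = delta_idealD[OF assms(2)]
  show id: "ideal (I \<cdot> J) R" using I J by (simp add: ideal_prod_is_ideal)
  fix \<delta> x assume d: "\<delta> \<in> \<Delta>" and "x \<in> I \<cdot> J"
  from this(2) show "\<delta> x \<in> I \<cdot> J"
  proof induction
    case (prod i j)
    have "i \<in> carrier R" "j \<in> carrier R" using prod ideal_facts(1) I J by blast+
    thus ?case using der_mult[OF d] I(2)[OF d] J(2)[OF d] prod
      by (simp add: ideal_prod.sum ideal_prod.prod)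
  next
    case (sum s1 s2)
    have "s1 \<in> carrier R" "s2 \<in> carrier R" using sum ideal_facts(1)[OF id] by blast+
    thus ?case using der_add[OF d] sum by (simp add: ideal_prod.sum)
  qed
qed

text \<open>A maximal \<Delta>-ideal inside \<open>J\<close> exists because \<open>R\<close> is
  noetherian, and it is the greatest one because sums of \<Delta>-ideals are
  \<Delta>-ideals.\<close>

lemma delta_core_facts:
  assumes J: "ideal J R"
  shows "Dideal (core J)" "core J \<subseteq> J"
    "\<And>I. Dideal I \<Longrightarrow> I \<subseteq> J \<Longrightarrow> I \<subseteq> core J"
proof -
  let ?Fam = "{I. Dideal I \<and> I \<subseteq> J}"
  have "?Fam \<noteq> {}" using delta_ideal_zero ideal_facts(2)[OF J] by blast
  then obtain C where C: "C \<in> ?Fam" "\<And>I. I \<in> ?Fam \<Longrightarrow> C \<subseteq> I \<Longrightarrow> I = C"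
    by (rule ex_maximal_ideal) (auto simp: delta_ideal_def)
  have max: "I \<subseteq> C" if I: "Dideal I" "I \<subseteq> J" for I
  proof -
    note S = ideal_sum_facts[of I C]
    have "I <+>\<^bsub>R\<^esub> C \<in> ?Fam" using delta_ideal_sum I C S(4)[OF _ _ J] delta_idealD(1) by auto
    thus ?thesis using C I S delta_idealD(1) by auto
  qed
  have "core J = C"
    unfolding delta_core_def by (rule Greatest_equality) (use C max in auto)
  thus "Dideal (core J)" "core J \<subseteq> J"
    "\<And>I. Dideal I \<Longrightarrow> I \<subseteq> J \<Longrightarrow> I \<subseteq> core J"
    using C max by simp_all
qed

text \<open>Differentiating \<open>s b\<^sup>m d\<^sup>l \<in> I\<close>, where \<open>d = \<delta> b\<close>, and multiplying by \<open>s d\<close> lowers the exponent of \<open>b\<close>.\<close>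

lemma delta_ideal_lower_exponent:
  fixes m l :: nat
  assumes I: "Dideal I" and d: "\<delta> \<in> \<Delta>" and c: "s \<in> carrier R" "b \<in> carrier R"
    and mem: "s \<otimes> b [^] Suc m \<otimes> \<delta> b [^] l \<in> I"
  shows "(s \<otimes> s) \<otimes> b [^] m \<otimes> \<delta> b [^] (l + 2) \<in> I"
proof -
  note Id = delta_idealD(1)[OF I] note F = ideal_facts[OF Id]
  define e where "e = \<delta> b"
  define x where "x = s \<otimes> b [^] Suc m \<otimes> e [^] l"
  have ec: "e \<in> carrier R" using der_closed d c by (simp add: e_def)
  have dc: "\<delta> s \<in> carrier R" "\<delta> e \<in> carrier R" using der_closed d c ec by auto
  have xI: "x \<in> I" using mem by (simp add: x_def e_def)
  \<comment> \<open>The derivative of \<open>e^l\<close> contains only \<open>e^(l-1)\<close>; one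
    extra factor \<open>e\<close> restores a multiple of \<open>e^l\<close>. For
    \<open>l = 0\<close> the derivative vanishes.\<close>
  have dl: "\<exists>r\<in>carrier R. e \<otimes> \<delta> (e [^] l) = r \<otimes> e [^] l"
  proof (cases l)
    case 0
    thus ?thesis using der_one[OF d] ec by (intro bexI[of _ \<zero>]) auto
  next
    case (Suc k)
    have "e \<otimes> \<delta> (e [^] l) = [l] \<cdot> (e \<otimes> (e [^] k \<otimes> \<delta> e))"
      using der_pow[OF d ec, of k] Suc add_pow_rdistr[of e "e [^] k \<otimes> \<delta> e" l] ec dc by simp
    also have "e \<otimes> (e [^] k \<otimes> \<delta> e) = \<delta> e \<otimes> e [^] l" using ec dc Suc by (simp add: m_ac)
    also have "[l] \<cdot> (\<delta> e \<otimes> e [^] l) = ([l] \<cdot> \<delta> e) \<otimes> e [^] l"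
      using add_pow_ldistr[of "\<delta> e" "e [^] l" l] ec dc by simp
    finally show ?thesis using dc by blast
  qed
  then obtain r where r: "r \<in> carrier R" "e \<otimes> \<delta> (e [^] l) = r \<otimes> e [^] l" by blast
  define B where "B = b [^] m"
  define E where "E = e [^] l"
  have bc: "B \<in> carrier R" "E \<in> carrier R" "\<delta> E \<in> carrier R" using c ec der_closed[OF d] by (auto simp: B_def E_def)
  let ?n = "[Suc m] \<cdot> \<one>"
  have nc: "?n \<in> carrier R" by simp
  have db: "\<delta> (b [^] Suc m) = ?n \<otimes> (B \<otimes> e)"
    using der_pow[OF d c(2), of m] add_pow_ldistr[of \<one> "B \<otimes> e" "Suc m"] bc ec by (simp add: B_def e_def)
  have r': "e \<otimes> \<delta> E = r \<otimes> E" using r(2) by (simp add: E_def)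
  have x': "x = s \<otimes> (B \<otimes> b) \<otimes> E" by (simp add: x_def B_def E_def)
  have "\<delta> x = (\<delta> s \<otimes> (B \<otimes> b) \<oplus> s \<otimes> (?n \<otimes> (B \<otimes> e))) \<otimes> E \<oplus> s \<otimes> (B \<otimes> b) \<otimes> \<delta> E"
    using der_mult[OF d] db c bc by (simp add: x' B_def)
  \<comment> \<open>The factor \<open>s e\<close> turns the terms with the derivatives of
    \<open>s\<close> and of \<open>E\<close> into multiples of \<open>x\<close>, which lie in
    \<open>I\<close>; the term with the lowered exponent of \<open>b\<close> survives.\<close>
  hence "s \<otimes> e \<otimes> \<delta> x = s \<otimes> e \<otimes> ((\<delta> s \<otimes> (B \<otimes> b) \<oplus> s \<otimes> (?n \<otimes> (B \<otimes> e))) \<otimes> E \<oplus> s \<otimes> (B \<otimes> b) \<otimes> \<delta> E)"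
    by simp
  also have "\<dots> = \<delta> s \<otimes> e \<otimes> (s \<otimes> (B \<otimes> b) \<otimes> E) \<oplus> ?n \<otimes> ((s \<otimes> s) \<otimes> B \<otimes> (E \<otimes> e \<otimes> e)) \<oplus> s \<otimes> s \<otimes> (B \<otimes> b) \<otimes> (e \<otimes> \<delta> E)"
    using c bc ec dc nc by algebra
  also have "\<dots> = ?n \<otimes> ((s \<otimes> s) \<otimes> B \<otimes> (E \<otimes> e \<otimes> e)) \<oplus> (\<delta> s \<otimes> e \<oplus> s \<otimes> r) \<otimes> x"
    unfolding r' x' using c bc ec dc nc r(1) by algebra
  finally have eq: "s \<otimes> e \<otimes> \<delta> x = \<dots>" .
  have "s \<otimes> e \<otimes> \<delta> x \<in> I" using F(5)[of "s \<otimes> e"] delta_idealD(2)[OF I d xI] c ec by simp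
  hence "?n \<otimes> ((s \<otimes> s) \<otimes> B \<otimes> (E \<otimes> e \<otimes> e)) \<oplus> (\<delta> s \<otimes> e \<oplus> s \<otimes> r) \<otimes> x \<in> I" using eq by simp
  moreover have "(\<delta> s \<otimes> e \<oplus> s \<otimes> r) \<otimes> x \<in> I" using F(5)[OF _ xI] dc ec c r by simp
  ultimately have "?n \<otimes> ((s \<otimes> s) \<otimes> B \<otimes> (E \<otimes> e \<otimes> e)) \<in> I"
    using ideal_add_cancel[OF Id] c bc ec nc by blast
  \<comment> \<open>The exponent \<open>Suc m\<close>, brought down by differentiation, is divided
    out here by characteristic zero.\<close>
  hence "inv ?n \<otimes> (?n \<otimes> ((s \<otimes> s) \<otimes> B \<otimes> (E \<otimes> e \<otimes> e))) \<in> I"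
    using F(5) rational_units[of "Suc m"] by blast
  hence "(s \<otimes> s) \<otimes> B \<otimes> (E \<otimes> e \<otimes> e) \<in> I"
    using rational_units[of "Suc m"] c bc ec nc by (simp add: m_assoc[symmetric])
  moreover have "E \<otimes> e \<otimes> e = \<delta> b [^] (l + 2)" by (simp add: E_def e_def)
  ultimately show ?thesis by (simp add: B_def)
qed

text \<open>Locally nilpotent \<open>b\<close> gives \<open>s b^m\<close> in \<open>I\<close> with
  \<open>s\<close> outside \<open>p\<close>. Lowering the exponent \<open>m\<close> times leaves a
  multiple of a power of the derivative of \<open>b\<close> by an element outside \<open>p\<close>,
  so that derivative lies in \<open>p\<close>. In characteristic p this fails: for d/dx on
  F_p[x]/(x^p), the ideal (x) is minimal over zero.\<close>

theorem minimal_prime_delta_ideal: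
  assumes I: "Dideal I" and p: "minimal_prime R I p"
  shows "Dideal p"
proof -
  have pp: "primeideal p R" and Ip: "I \<subseteq> p" using p by (auto simp: minimal_prime_def)
  have pid: "ideal p R" using pp by (rule primeideal.axioms)
  show ?thesis
  proof (rule delta_idealI[OF pid])
    fix \<delta> b assume d: "\<delta> \<in> \<Delta>" and b: "b \<in> p"
    have bc: "b \<in> carrier R" using b ideal_facts(1)[OF pid] by blast
    have dc: "\<delta> b \<in> carrier R" using der_closed d bc by simp
    obtain s and m :: nat where s: "s \<in> carrier R - p" "s \<otimes> b [^] m \<in> I"
      by (rule minimal_prime_local_nilpotent[OF p delta_idealD(1)[OF I] b])
    have "\<exists>t\<in>carrier R - p. \<exists>l. t \<otimes> b [^] (m - j) \<otimes> \<delta> b [^] (l::nat) \<in> I" if "j \<le> m" for j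
      using that
    proof (induction j)
      case 0
      have "s \<otimes> b [^] m \<otimes> \<delta> b [^] (0::nat) \<in> I" using s bc by simp
      thus ?case using s(1) by (intro bexI[of _ s] exI[of _ "0::nat"]) simp_all
    next
      case (Suc j)
      then obtain t l where t: "t \<in> carrier R - p" "t \<otimes> b [^] (m - j) \<otimes> \<delta> b [^] (l::nat) \<in> I" by auto
      have e: "m - j = Suc (m - Suc j)" using Suc by simp
      have "(t \<otimes> t) \<otimes> b [^] (m - Suc j) \<otimes> \<delta> b [^] (l + 2) \<in> I"
        using delta_ideal_lower_exponent[OF I d _ bc, of t "m - Suc j" l] t unfolding e by simp
      thus ?case using prime_mult_notin[OF pp t(1) t(1)] by blast
    qed
    from this[of m] obtain t l where t: "t \<in> carrier R - p" "t \<otimes> \<delta> b [^] (l::nat) \<in> I" by auto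
    show "\<delta> b \<in> p"
    proof (rule ccontr)
      assume "\<delta> b \<notin> p"
      hence "t \<otimes> \<delta> b [^] l \<in> carrier R - p"
        using prime_mult_notin[OF pp t(1)] prime_pow_notin[OF pp] dc by blast
      thus False using t Ip by blast
    qed
  qed
qed

text \<open>A prime minimal over \<open>core q\<close> and inside \<open>q\<close> is a
  \<Delta>-ideal, so it is contained in the core and equals it.\<close>

lemma delta_core_prime:
  assumes "primeideal q R"
  shows "primeideal (core q) R"
proof -
  note C = delta_core_facts[OF primeideal.axioms(1)[OF assms]]
  obtain p where p: "minimal_prime R (core q) p" "p \<subseteq> q"
    by (rule ex_minimal_prime[OF assms C(2)])
  have "p = core q"
    using C(3)[OF minimal_prime_delta_ideal[OF C(1) p(1)] p(2)] p(1) by (auto simp: minimal_prime_def)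
  thus ?thesis using p by (auto simp: minimal_prime_def)
qed

theorem delta_prime_iff: "delta_prime R \<Delta> P \<longleftrightarrow> Dideal P \<and> primeideal P R"
proof
  assume P: "Dideal P \<and> primeideal P R"
  show "delta_prime R \<Delta> P"
    unfolding delta_prime_def
    using P primeideal_divides_ideal_prod[of P] primeideal.I_notcarr[of P R] delta_idealD(1) by blast
next
  assume P: "delta_prime R \<Delta> P"
  hence Pd: "Dideal P" by (simp add: delta_prime_def)
  have Pp: "I \<subseteq> P \<or> J \<subseteq> P" if "Dideal I" "Dideal J" "I \<cdot> J \<subseteq> P" for I J
    using P that by (auto simp: delta_prime_def)
  \<comment> \<open>The key to the forward direction, by noetherian induction. If \<open>a b\<close>
    lies in \<open>I\<close>, the cores of \<open>I + Ra\<close> and \<open>I + Rb\<close> have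
    product inside \<open>core I\<close>, so one of them lies in \<open>P\<close>, and the induction
    passes to the larger ideal. At \<open>I = P\<close> this produces a prime \<open>q\<close> whose
    core is \<open>P\<close>, and cores of primes are prime.\<close>
  have "core I \<subseteq> P \<longrightarrow> (\<exists>q. primeideal q R \<and> I \<subseteq> q \<and> core q \<subseteq> P)" if "ideal I R" for I
    using that
  proof (induction I rule: ideal_induct)
    case (less I)
    show ?case
    proof (intro impI)
      assume CP: "core I \<subseteq> P"
      have nc: "carrier R \<noteq> I"
        using delta_core_facts(3)[OF less.hyps delta_ideal_carrier] CP P ideal_facts(1)[OF delta_idealD(1)[OF Pd]]
        by (auto simp: delta_prime_def)
      show "\<exists>q. primeideal q R \<and> I \<subseteq> q \<and> core q \<subseteq> P"
      proof (cases "primeideal I R")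
        case True
        thus ?thesis using CP by blast
      next
        case False
        then obtain a b where ab: "a \<in> carrier R" "b \<in> carrier R" "a \<otimes> b \<in> I" "a \<notin> I" "b \<notin> I"
          using ideal.primeidealCE[OF less.hyps is_cring False] nc by metis
        note A = adjoin_facts[OF less.hyps ab(1)] and B = adjoin_facts[OF less.hyps ab(2)]
        note CA = delta_core_facts[OF A(1)] and CB = delta_core_facts[OF B(1)]
        have IAB: "I \<subset> adjoin R I a" "I \<subset> adjoin R I b" using A B ab by blast+
        have mem: "x \<otimes> y \<in> I" if xy: "x \<in> adjoin R I a" "y \<in> adjoin R I b" for x y
        proof -
          obtain u r v s where c: "u \<in> I" "v \<in> I" "r \<in> carrier R" "s \<in> carrier R"
            and e: "x = u \<oplus> r \<otimes> a" "y = v \<oplus> s \<otimes> b" using xy by (auto simp: adjoin_def)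
          note F = ideal_facts[OF less.hyps]
          have c': "u \<in> carrier R" "v \<in> carrier R" using c F by auto
          have "x \<otimes> y = (v \<oplus> s \<otimes> b) \<otimes> u \<oplus> (r \<otimes> a) \<otimes> v \<oplus> (r \<otimes> s) \<otimes> (a \<otimes> b)"
            unfolding e using c(3,4) c' ab(1,2) by algebra
          also have "\<dots> \<in> I" using F(3,5) c c' ab by simp
          finally show ?thesis .
        qed
        have "core (adjoin R I a) \<cdot> core (adjoin R I b) \<subseteq> I"
        proof
          fix x assume "x \<in> core (adjoin R I a) \<cdot> core (adjoin R I b)"
          thus "x \<in> I"
            by induction (use mem CA(2) CB(2) ideal_facts(3)[OF less.hyps] in auto)
        qed
        hence "core (adjoin R I a) \<cdot> core (adjoin R I b) \<subseteq> P"
          using delta_core_facts(3)[OF less.hyps delta_ideal_prod[OF CA(1) CB(1)]] CP by blast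
        hence "core (adjoin R I a) \<subseteq> P \<or> core (adjoin R I b) \<subseteq> P"
          using Pp CA(1) CB(1) by blast
        thus ?thesis using less.IH[OF A(1) IAB(1)] less.IH[OF B(1) IAB(2)] IAB by blast
      qed
    qed
  qed
  moreover have "ideal P R" using delta_idealD(1)[OF Pd] .
  ultimately obtain q where q: "primeideal q R" "P \<subseteq> q" "core q \<subseteq> P"
    using delta_core_facts(2) by blast
  have "P \<subseteq> core q" using delta_core_facts(3)[OF primeideal.axioms(1)[OF q(1)] Pd q(2)] .
  hence "P = core q" using q by blast
  thus "Dideal P \<and> primeideal P R" using Pd delta_core_prime[OF q(1)] by simp
qed

lemma delta_specD:
  assumes "P \<in> DSpec"
  shows "Dideal P" "primeideal P R" "ideal P R"
  using assms delta_prime_iff by (auto simp: delta_spec_def primeideal.axioms)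

lemma delta_specI: "Dideal P \<Longrightarrow> primeideal P R \<Longrightarrow> P \<in> DSpec"
  using delta_prime_iff by (auto simp: delta_spec_def)

text \<open>If \<open>I\<close> is proper and not \<Delta>-prime, \<Delta>-ideals \<open>A\<close>
  and \<open>B\<close> outside \<open>I\<close> have product inside \<open>I\<close>. Every
  \<Delta>-prime over \<open>I\<close> then contains \<open>I + A\<close> or \<open>I + B\<close>,
  and noetherian induction supplies a finite set for each.\<close>

lemma finite_minimal_delta_primes:
  assumes "ideal I R"
  shows "Dideal I \<longrightarrow> (\<exists>\<Lambda>. minorants I \<Lambda>)"
  using assms
proof (induction I rule: ideal_induct)
  case (less I)
  show ?case
  proof
    assume I: "Dideal I"
    consider "I = carrier R" | "delta_prime R \<Delta> I"
      | A B where "Dideal A" "Dideal B" "A \<cdot> B \<subseteq> I" "\<not> A \<subseteq> I" "\<not> B \<subseteq> I"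
      using I by (auto simp: delta_prime_def)
    then show "\<exists>\<Lambda>. minorants I \<Lambda>"
    proof cases
      case 1
      have "\<not> I \<subseteq> Q" if "Q \<in> DSpec" for Q
        using that 1 ideal_facts(1)[OF delta_specD(3)[OF that]] by (auto simp: delta_spec_def delta_prime_def)
      thus ?thesis by (intro exI[of _ "{}"]) auto
    next
      case 2
      thus ?thesis by (intro exI[of _ "{I}"]) (auto simp: delta_spec_def)
    next
      case 3
      note IA = ideal_sum_facts[OF less.hyps delta_idealD(1)[OF 3(1)]]
        and IB = ideal_sum_facts[OF less.hyps delta_idealD(1)[OF 3(2)]]
      have "I \<subset> I <+>\<^bsub>R\<^esub> A" "I \<subset> I <+>\<^bsub>R\<^esub> B" using IA(2,3) IB(2,3) 3 by blast+
      note IH = less.IH[OF IA(1) \<open>I \<subset> I <+>\<^bsub>R\<^esub> A\<close>, THEN mp, OF delta_ideal_sum[OF I 3(1)]]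
        less.IH[OF IB(1) \<open>I \<subset> I <+>\<^bsub>R\<^esub> B\<close>, THEN mp, OF delta_ideal_sum[OF I 3(2)]]
      obtain \<Lambda> where L: "finite \<Lambda>" "\<Lambda> \<subseteq> DSpec" "\<forall>q\<in>\<Lambda>. I <+>\<^bsub>R\<^esub> A \<subseteq> q"
          "\<forall>Q\<in>DSpec. I <+>\<^bsub>R\<^esub> A \<subseteq> Q \<longrightarrow> (\<exists>q\<in>\<Lambda>. q \<subseteq> Q)"
        using IH(1) by (elim exE conjE)
      obtain \<Lambda>' where L': "finite \<Lambda>'" "\<Lambda>' \<subseteq> DSpec" "\<forall>q\<in>\<Lambda>'. I <+>\<^bsub>R\<^esub> B \<subseteq> q"
          "\<forall>Q\<in>DSpec. I <+>\<^bsub>R\<^esub> B \<subseteq> Q \<longrightarrow> (\<exists>q\<in>\<Lambda>'. q \<subseteq> Q)"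
        using IH(2) by (elim exE conjE)
      have "\<exists>q\<in>\<Lambda> \<union> \<Lambda>'. q \<subseteq> Q" if Q: "Q \<in> DSpec" "I \<subseteq> Q" for Q
      proof -
        have "A \<subseteq> Q \<or> B \<subseteq> Q"
          using Q 3 by (auto simp: delta_spec_def delta_prime_def)
        hence "I <+>\<^bsub>R\<^esub> A \<subseteq> Q \<or> I <+>\<^bsub>R\<^esub> B \<subseteq> Q" using IA(4) IB(4) delta_specD(3)[OF Q(1)] Q(2) by blast
        hence "(\<exists>q\<in>\<Lambda>. q \<subseteq> Q) \<or> (\<exists>q\<in>\<Lambda>'. q \<subseteq> Q)"
          using bspec[OF L(4) Q(1)] bspec[OF L'(4) Q(1)] by argo
        thus ?thesis unfolding bex_Un .
      qed
      moreover have "finite (\<Lambda> \<union> \<Lambda>')" "\<Lambda> \<union> \<Lambda>' \<subseteq> DSpec" "\<forall>q\<in>\<Lambda> \<union> \<Lambda>'. I \<subseteq> q"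
        using L(1-3) L'(1-3) IA(2) IB(2) by blast+
      ultimately show ?thesis by (intro exI[of _ "\<Lambda> \<union> \<Lambda>'"]) blast
    qed
  qed
qed

section \<open>Topology and order of the \<Delta>-spectrum\<close>

lemma openin_delta_spec:
  "openin DTop U \<longleftrightarrow> (\<exists>I. ideal I R \<and> U = {P \<in> DSpec. \<not> I \<subseteq> P})"
proof -
  have eq: "{P. primeideal P R \<and> \<not> I \<subseteq> P} \<inter> DSpec = {P \<in> DSpec. \<not> I \<subseteq> P}" for I
    using delta_specD by blast
  have "openin DTop U \<longleftrightarrow>
      (\<exists>I. ideal I R \<and> U = {P. primeideal P R \<and> \<not> I \<subseteq> P} \<inter> DSpec)"
    unfolding delta_spec_topology_def openin_subtopology openin_spec_topology[OF is_cring] by blast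
  thus ?thesis by (simp only: eq)
qed

lemma topspace_delta_spec: "topspace DTop = DSpec"
proof
  show "topspace DTop \<subseteq> DSpec"
    by (auto simp: delta_spec_topology_def)
  have "\<not> carrier R \<subseteq> P" if "P \<in> DSpec" for P
    using ideal_facts(1)[OF delta_specD(3)[OF that]] primeideal.I_notcarr[OF delta_specD(2)[OF that]] by blast
  hence "DSpec = {P \<in> DSpec. \<not> carrier R \<subseteq> P}" by blast
  hence "openin DTop DSpec"
    unfolding openin_delta_spec using oneideal by blast
  thus "DSpec \<subseteq> topspace DTop" by (rule openin_subset)
qed

lemma delta_spec_closure:
  assumes "P \<in> DSpec"
  shows "cl {P} = {Q \<in> DSpec. P \<subseteq> Q}"
proof -
  have "Q \<in> cl {P} \<longleftrightarrow> Q \<in> DSpec \<and> P \<subseteq> Q" for Q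
  proof
    assume Q: "Q \<in> cl {P}"
    hence Qs: "Q \<in> DSpec" by (simp add: in_closure_of topspace_delta_spec)
    have "openin DTop {Q \<in> DSpec. \<not> P \<subseteq> Q}"
      unfolding openin_delta_spec using delta_specD(3)[OF assms] by blast
    moreover have "P \<in> U" if "openin DTop U" "Q \<in> U" for U
      using Q that by (simp add: in_closure_of)
    ultimately have "P \<subseteq> Q" using Qs by force
    thus "Q \<in> DSpec \<and> P \<subseteq> Q" using Qs by simp
  next
    assume Q: "Q \<in> DSpec \<and> P \<subseteq> Q"
    have "P \<in> U" if U: "openin DTop U" "Q \<in> U" for U
    proof -
      obtain I where I: "U = {P \<in> DSpec. \<not> I \<subseteq> P}" using U(1) openin_delta_spec by blast
      show ?thesis using U(2) Q assms unfolding I by simp blast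
    qed
    thus "Q \<in> cl {P}"
      using Q by (auto simp: in_closure_of topspace_delta_spec)
  qed
  thus ?thesis by blast
qed

text \<open>A locally closed point is open in its closure, and the basic open sets given by single
  elements \<open>f\<close> suffice to isolate it.\<close>

lemma locally_closed_delta_spec_iff:
  assumes P: "P \<in> DSpec"
  shows "locally_closed_pt DTop P \<longleftrightarrow>
    (\<exists>f\<in>carrier R - P. \<forall>Q\<in>DSpec. P \<subset> Q \<longrightarrow> f \<in> Q)"
proof
  assume "locally_closed_pt DTop P"
  then obtain U C where U: "openin DTop U" and C: "closedin DTop C"
    and PUC: "{P} = U \<inter> C" by (auto simp: locally_closed_pt_def)
  obtain I where I: "ideal I R" "U = {P \<in> DSpec. \<not> I \<subseteq> P}" using U openin_delta_spec by blast
  have "P \<in> U" "P \<in> C" using PUC by blast+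
  then obtain f where f: "f \<in> I" "f \<notin> P" using I by blast
  have "f \<in> Q" if Q: "Q \<in> DSpec" "P \<subset> Q" for Q
  proof -
    have "Q \<in> cl {P}" using Q delta_spec_closure[OF P] by blast
    hence "Q \<in> C" using closure_of_minimal[OF _ C, of "{P}"] \<open>P \<in> C\<close> by blast
    thus ?thesis using PUC Q I f by blast
  qed
  thus "\<exists>f\<in>carrier R - P. \<forall>Q\<in>DSpec. P \<subset> Q \<longrightarrow> f \<in> Q"
    using f ideal_facts(1)[OF I(1)] by blast
next
  assume "\<exists>f\<in>carrier R - P. \<forall>Q\<in>DSpec. P \<subset> Q \<longrightarrow> f \<in> Q"
  then obtain f where f: "f \<in> carrier R" "f \<notin> P" "\<And>Q. Q \<in> DSpec \<Longrightarrow> P \<subset> Q \<Longrightarrow> f \<in> Q" by blast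
  let ?U = "{Q \<in> DSpec. \<not> PIdl f \<subseteq> Q}"
  have g: "PIdl f \<subseteq> Q \<longleftrightarrow> f \<in> Q" if "Q \<in> DSpec" for Q
    using cgenideal_minimal[OF delta_specD(3)[OF that]] cgenideal_self[OF f(1)] by blast
  have "openin DTop ?U"
    unfolding openin_delta_spec using cgenideal_ideal[OF f(1)] by blast
  moreover have eq: "{P} = ?U \<inter> (cl {P})"
    using f P g by (auto simp: delta_spec_closure[OF P])
  ultimately show "locally_closed_pt DTop P"
    unfolding locally_closed_pt_def by (intro exI conjI) (assumption, rule closedin_closure_of, rule eq)
qed

text \<open>Closures of points are upward closed sets of \<Delta>-primes, so separability asks for a
  coinitial set of fewer than \<open>\<kappa>\<close> \<Delta>-primes strictly above
  \<open>P\<close>. Later arguments use this form.\<close>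

lemma top_separable_delta_spec_iff:
  assumes P: "P \<in> DSpec"
  shows "top_separable \<kappa> DTop P \<longleftrightarrow>
    (\<exists>\<Lambda>\<subseteq>{Q \<in> DSpec. P \<subset> Q}. |\<Lambda>| <o \<kappa> \<and> (\<forall>Q\<in>DSpec. P \<subset> Q \<longrightarrow> (\<exists>q\<in>\<Lambda>. q \<subseteq> Q)))"
proof -
  have d: "{Q \<in> DSpec. P \<subseteq> Q} - {P} = {Q \<in> DSpec. P \<subset> Q}" by blast
  have key: "{Q \<in> DSpec. P \<subset> Q} = (\<Union>q\<in>\<Lambda>. cl {q}) \<longleftrightarrow>
      (\<forall>Q\<in>DSpec. P \<subset> Q \<longrightarrow> (\<exists>q\<in>\<Lambda>. q \<subseteq> Q))"
    if L: "\<Lambda> \<subseteq> {Q \<in> DSpec. P \<subset> Q}" for \<Lambda>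
  proof -
    have "(\<Union>q\<in>\<Lambda>. cl {q}) = (\<Union>q\<in>\<Lambda>. {Q \<in> DSpec. q \<subseteq> Q})"
      using L by (intro SUP_cong refl delta_spec_closure) auto
    also have "\<dots> = {Q \<in> DSpec. \<exists>q\<in>\<Lambda>. q \<subseteq> Q}" by blast
    finally have U: "(\<Union>q\<in>\<Lambda>. cl {q}) = \<dots>" .
    have "{Q \<in> DSpec. \<exists>q\<in>\<Lambda>. q \<subseteq> Q} \<subseteq> {Q \<in> DSpec. P \<subset> Q}" using L by blast
    thus ?thesis unfolding U by blast
  qed
  thus ?thesis unfolding top_separable_def delta_spec_closure[OF P] d 
    by (intro iff_exI conj_cong refl key)
qed

lemma top_separable_delta_specI:
  assumes P: "P \<in> DSpec" and L: "\<Lambda> \<subseteq> {Q \<in> DSpec. P \<subset> Q}" "|\<Lambda>| <o \<kappa>"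
    and cof: "\<And>Q. Q \<in> DSpec \<Longrightarrow> P \<subset> Q \<Longrightarrow> \<exists>q\<in>\<Lambda>. q \<subseteq> Q"
  shows "top_separable \<kappa> DTop P"
  unfolding top_separable_delta_spec_iff[OF P]
  by (intro exI[of _ \<Lambda>] conjI L ballI impI cof)

lemma top_separable_delta_specE:
  assumes P: "P \<in> DSpec" and S: "top_separable \<kappa> DTop P"
  obtains \<Lambda> where "\<Lambda> \<subseteq> {Q \<in> DSpec. P \<subset> Q}" "|\<Lambda>| <o \<kappa>"
    "\<forall>Q\<in>DSpec. P \<subset> Q \<longrightarrow> (\<exists>q\<in>\<Lambda>. q \<subseteq> Q)"
  using S unfolding top_separable_delta_spec_iff[OF P] by (elim exE conjE)

text \<open>An element common to all \<Delta>-primes strictly above \<open>P\<close> makes their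
  intersection \<open>J\<close> larger than \<open>P\<close>, and finitely many \<Delta>-primes over
  \<open>J\<close> are coinitial. Conversely, from finitely many primes strictly above
  \<open>P\<close> such an element is obtained as a product.\<close>

lemma locally_closed_iff_top_separable:
  assumes P: "P \<in> DSpec"
  shows "locally_closed_pt DTop P \<longleftrightarrow> top_separable natLeq DTop P"
proof
  assume "locally_closed_pt DTop P"
  then obtain f where f: "f \<in> carrier R" "f \<notin> P" "\<And>Q. Q \<in> DSpec \<Longrightarrow> P \<subset> Q \<Longrightarrow> f \<in> Q"
    using locally_closed_delta_spec_iff[OF P] by blast
  \<comment> \<open>Inserting \<open>carrier R\<close> covers the case of no \<Delta>-prime strictly
    above \<open>P\<close>, where the bare intersection would be the whole type.\<close>
  define J where "J = \<Inter>(insert (carrier R) {Q \<in> DSpec. P \<subset> Q})"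
  have J: "Dideal J" unfolding J_def
    by (rule delta_ideal_Inter) (auto simp: delta_specD delta_ideal_carrier)
  have fJ: "f \<in> J" using f by (auto simp: J_def)
  have JQ: "J \<subseteq> Q" if "Q \<in> DSpec" "P \<subset> Q" for Q using that by (auto simp: J_def)
  have PJ: "P \<subseteq> J" using ideal_facts(1)[OF delta_specD(3)[OF P]] by (auto simp: J_def)
  obtain \<Lambda> where L: "finite \<Lambda>" "\<Lambda> \<subseteq> DSpec" "\<forall>q\<in>\<Lambda>. J \<subseteq> q"
      "\<forall>Q\<in>DSpec. J \<subseteq> Q \<longrightarrow> (\<exists>q\<in>\<Lambda>. q \<subseteq> Q)"
    using finite_minimal_delta_primes[OF delta_idealD(1)[OF J]] J by blast
  have "\<Lambda> \<subseteq> {Q \<in> DSpec. P \<subset> Q}" using L PJ fJ f by blast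
  moreover have "|\<Lambda>| <o natLeq" using L finite_iff_ordLess_natLeq by blast
  ultimately show "top_separable natLeq DTop P"
  proof (rule top_separable_delta_specI[OF P])
    fix Q assume Q: "Q \<in> DSpec" "P \<subset> Q"
    show "\<exists>q\<in>\<Lambda>. q \<subseteq> Q" using bspec[OF L(4) Q(1)] JQ[OF Q] by (rule mp)
  qed
next
  assume "top_separable natLeq DTop P"
  then obtain \<Lambda> where L: "\<Lambda> \<subseteq> {Q \<in> DSpec. P \<subset> Q}" "|\<Lambda>| <o natLeq"
    "\<forall>Q\<in>DSpec. P \<subset> Q \<longrightarrow> (\<exists>q\<in>\<Lambda>. q \<subseteq> Q)"
    by (rule top_separable_delta_specE[OF P])
  have "finite \<Lambda>" using L(2) finite_iff_ordLess_natLeq by blast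
  \<comment> \<open>One factor from each \<open>q - P\<close>; the product stays outside
    \<open>P\<close> because \<open>P\<close> is prime. The empty product is one.\<close>
  hence "\<exists>f\<in>carrier R - P. \<forall>q\<in>\<Lambda>. f \<in> q" using L(1)
  proof induction
    case empty
    thus ?case using prime_one_notin[OF delta_specD(2)[OF P]] by blast
  next
    case (insert q \<Lambda>)
    then obtain f where f: "f \<in> carrier R - P" "\<forall>q\<in>\<Lambda>. f \<in> q" by blast
    have q: "q \<in> DSpec" "P \<subset> q" using insert by auto
    note qF = ideal_facts[OF delta_specD(3)[OF q(1)]]
    obtain g where g: "g \<in> q" "g \<notin> P" using q by blast
    have gc: "g \<in> carrier R" using g qF by blast
    have "f \<otimes> g \<in> q'" if "q' \<in> insert q \<Lambda>" for q'
    proof (cases "q' = q")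
      case True
      thus ?thesis using qF(5)[of f g] f g by simp
    next
      case False
      hence "q' \<in> \<Lambda>" using that by simp
      hence "q' \<in> DSpec" "f \<in> q'" using insert.prems f by auto
      thus ?thesis using ideal_facts(6)[OF delta_specD(3) gc] by simp
    qed
    thus ?case using prime_mult_notin[OF delta_specD(2)[OF P] f(1), of g] g gc by blast
  qed
  thus "locally_closed_pt DTop P"
    unfolding locally_closed_delta_spec_iff[OF P] using L(3) by (meson subsetD)
qed

text \<open>Any coinitial set contains all covers, which gives one direction. In the other, the
  covers are themselves coinitial: by the descending chain condition on primes, each \<Delta>-prime
  strictly above \<open>P\<close> contains a minimal one.\<close>

lemma top_separable_iff_poset_separable:
  assumes P: "P \<in> DSpec"
  shows "top_separable \<kappa> DTop P \<longleftrightarrow> poset_separable \<kappa> DSpec P"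
proof
  assume "top_separable \<kappa> DTop P"
  then obtain \<Lambda> where L: "\<Lambda> \<subseteq> {Q \<in> DSpec. P \<subset> Q}" "|\<Lambda>| <o \<kappa>"
    "\<forall>Q\<in>DSpec. P \<subset> Q \<longrightarrow> (\<exists>q\<in>\<Lambda>. q \<subseteq> Q)"
    by (rule top_separable_delta_specE[OF P])
  have "poset_covers DSpec P \<subseteq> \<Lambda>"
  proof
    fix t assume t: "t \<in> poset_covers DSpec P"
    hence "t \<in> DSpec" "P \<subset> t" by (auto simp: poset_covers_def)
    then obtain q where q: "q \<in> \<Lambda>" "q \<subseteq> t" using L(3) by blast
    hence "q = t" using t L(1) by (auto simp: poset_covers_def)
    thus "t \<in> \<Lambda>" using q by simp
  qed
  thus "poset_separable \<kappa> DSpec P"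
    unfolding poset_separable_def using L(2) card_of_mono1 ordLeq_ordLess_trans by blast
next
  assume S: "poset_separable \<kappa> DSpec P"
  let ?\<Lambda> = "poset_covers DSpec P"
  have "\<exists>q\<in>?\<Lambda>. q \<subseteq> Q" if Q: "Q \<in> DSpec" "P \<subset> Q" for Q
  proof -
    let ?Fam = "{t \<in> DSpec. P \<subset> t \<and> t \<subseteq> Q}"
    have "\<exists>t\<in>?Fam. \<forall>u\<in>?Fam. u \<subseteq> t \<longrightarrow> u = t"
      by (rule ex_minimal_among_primes[of Q ?Fam]) (use Q delta_specD in auto)
    then obtain t where t: "t \<in> ?Fam" "\<forall>u\<in>?Fam. u \<subseteq> t \<longrightarrow> u = t" by blast
    have "u = t" if u: "u \<in> DSpec" "P \<subset> u" "u \<subseteq> t" for u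
    proof -
      have "u \<in> ?Fam" using u t(1) by auto
      thus ?thesis using t(2) u(3) by blast
    qed
    hence "t \<in> ?\<Lambda>" using t(1) by (simp add: poset_covers_def)
    thus ?thesis using t(1) by blast
  qed
  moreover have "?\<Lambda> \<subseteq> {Q \<in> DSpec. P \<subset> Q}" by (auto simp: poset_covers_def)
  ultimately show "top_separable \<kappa> DTop P"
    using S unfolding poset_separable_def by (intro top_separable_delta_specI[OF P])
qed

end

section \<open>Cardinality and linear dependence\<close>

text \<open>Closure under a family of binary operations indexed by \<open>J\<close>. It is used for
  unions (finite subsets), for products (multiplicative sets, with a one-element \<open>J\<close>)
  and for Wronskians indexed by the derivations.\<close>

inductive_set op_closure :: "'i set \<Rightarrow> ('i \<Rightarrow> 'a \<Rightarrow> 'a \<Rightarrow> 'a) \<Rightarrow> 'a set \<Rightarrow> 'a set"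
  for J f A where
    base: "a \<in> A \<Longrightarrow> a \<in> op_closure J f A"
  | step: "i \<in> J \<Longrightarrow> a \<in> op_closure J f A \<Longrightarrow> b \<in> op_closure J f A \<Longrightarrow> f i a b \<in> op_closure J f A"

text \<open>The closure is exhausted by countably many stages, each of size at most
  \<open>|Y|\<close>. The auxiliary infinite set \<open>Y\<close> leaves room for finite
  \<open>A\<close> or \<open>J\<close>.\<close>

lemma card_of_op_closure:
  assumes inf: "infinite Y" and J: "|J| \<le>o |Y|" and A: "|A| \<le>o |Y|"
  shows "|op_closure J f A| \<le>o |Y|"
proof -
  define st where "st = rec_nat A (\<lambda>_ B. B \<union> (\<lambda>(i, a, b). f i a b) ` (J \<times> B \<times> B))"
  have st0: "st 0 = A" and stS: "st (Suc n) = st n \<union> (\<lambda>(i, a, b). f i a b) ` (J \<times> st n \<times> st n)" for n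
    by (simp_all add: st_def)
  have mono: "m \<le> n \<Longrightarrow> st m \<subseteq> st n" for m n
    using lift_Suc_mono_le[of st m n] stS by blast
  have card: "|st n| \<le>o |Y|" for n
  proof (induction n)
    case 0
    show ?case using A by (simp add: st0)
  next
    case (Suc n)
    have "|st n \<times> st n| \<le>o |Y|"
      by (rule card_of_Sigma_ordLeq_infinite[OF inf Suc.IH]) (use Suc.IH in simp)
    hence "|J \<times> st n \<times> st n| \<le>o |Y|"
      by (intro card_of_Sigma_ordLeq_infinite[OF inf J]) simp
    hence "|(\<lambda>(i, a, b). f i a b) ` (J \<times> st n \<times> st n)| \<le>o |Y|"
      using card_of_image ordLeq_transitive by blast
    thus ?case unfolding stS using Suc.IH inf
      by (intro card_of_Un_ordLeq_infinite_Field[of "|Y|", simplified Field_card_of card_of_Card_order]) auto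
  qed
  have "op_closure J f A \<subseteq> (\<Union>n. st n)"
  proof
    fix x assume "x \<in> op_closure J f A"
    thus "x \<in> (\<Union>n. st n)"
    proof induction
      case (base a)
      thus ?case using st0 by blast
    next
      case (step i a b)
      then obtain m n where "a \<in> st m" "b \<in> st n" by blast
      hence "a \<in> st (max m n)" "b \<in> st (max m n)" using mono[of m "max m n"] mono[of n "max m n"] by auto
      hence "f i a b \<in> st (Suc (max m n))" unfolding stS using step.hyps(1) by force
      thus ?case by blast
    qed
  qed
  moreover have "|\<Union>n. st n| \<le>o |Y|"
    using inf card infinite_iff_card_of_nat[of Y] by (intro card_of_UNION_ordLeq_infinite) auto
  ultimately show ?thesis using card_of_mono1 ordLeq_transitive by blast
qed

lemma card_of_insert_ordLeq_infinite:
  assumes "infinite Y" "|A| \<le>o |Y|"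
  shows "|insert a A| \<le>o |Y|"
proof -
  have "|{a}| \<le>o |Y|" using assms(1) by (metis card_of_singl_ordLeq finite.emptyI)
  hence "|{a} \<union> A| \<le>o |Y|" using assms
    by (intro card_of_Un_ordLeq_infinite_Field[of "|Y|", simplified Field_card_of card_of_Card_order]) auto
  thus ?thesis by simp
qed

text \<open>Finite subsets arise from the empty set and singletons by binary unions.\<close>

lemma card_of_finite_subsets:
  assumes inf: "infinite Y" and B: "|B| \<le>o |Y|"
  shows "|{T. finite T \<and> T \<subseteq> B}| \<le>o |Y|"
proof -
  let ?A = "insert {} ((\<lambda>b. {b}) ` B)"
  have "T \<in> op_closure {()} (\<lambda>_. (\<union>)) ?A" if "finite T" "T \<subseteq> B" for T
    using that
  proof induction
    case empty
    show ?case by (intro op_closure.base) simp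
  next
    case (insert b T)
    have "{b} \<union> T \<in> op_closure {()} (\<lambda>_. (\<union>)) ?A"
      using insert op_closure.base[of "{b}" ?A] by (intro op_closure.step) auto
    thus ?case by simp
  qed
  hence sub: "{T. finite T \<and> T \<subseteq> B} \<subseteq> op_closure {()} (\<lambda>_. (\<union>)) ?A" by blast
  have "|(\<lambda>b. {b}) ` B| \<le>o |Y|" using card_of_image B ordLeq_transitive by blast
  hence A: "|?A| \<le>o |Y|" by (rule card_of_insert_ordLeq_infinite[OF inf])
  have "|{()}| \<le>o |Y|" using inf by (metis card_of_singl_ordLeq finite.emptyI)
  thus ?thesis using card_of_op_closure[OF inf _ A] card_of_mono1[OF sub] ordLeq_transitive by blast
qed

text \<open>With all fibers finite, \<open>A\<close> would be a union of \<open>|B|\<close> finite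
  sets: finite if \<open>B\<close> is finite, and of size at most \<open>|B|\<close>
  otherwise.\<close>

lemma infinite_fiber:
  assumes inf: "infinite A" and less: "|B| <o |A|" and f: "f ` A \<subseteq> B"
  shows "\<exists>b\<in>B. infinite {a \<in> A. f a = b}"
proof (rule ccontr)
  assume "\<not> ?thesis"
  hence fin: "finite {a \<in> A. f a = b}" if "b \<in> B" for b using that by blast
  have A: "A = (\<Union>b\<in>B. {a \<in> A. f a = b})" using f by auto
  show False
  proof (cases "finite B")
    case True
    hence "finite (\<Union>b\<in>B. {a \<in> A. f a = b})" using fin by blast
    thus False using A inf by simp
  next
    case False
    have "|{a \<in> A. f a = b}| \<le>o |B|" if "b \<in> B" for b
      using finite_ordLess_infinite2[OF fin[OF that] False] by (rule ordLess_imp_ordLeq)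
    hence "|\<Union>b\<in>B. {a \<in> A. f a = b}| \<le>o |B|"
      using False by (intro card_of_UNION_ordLeq_infinite) auto
    hence "|A| \<le>o |B|" using A by simp
    thus False using less not_ordLess_ordLeq by blast
  qed
qed

section \<open>Spans and dependence of infinite families\<close>

context module
begin

text \<open>The linear span built one summand at a time, with vectors allowed to recur, so that
  induction replaces the handling of coefficient functions.\<close>

inductive_set ind_span :: "'c set \<Rightarrow> 'c set" for T where
    zero: "\<zero>\<^bsub>M\<^esub> \<in> ind_span T"
  | step: "c \<in> carrier R \<Longrightarrow> t \<in> T \<Longrightarrow> x \<in> ind_span T \<Longrightarrow> c \<odot>\<^bsub>M\<^esub> t \<oplus>\<^bsub>M\<^esub> x \<in> ind_span T"

lemma ind_span_closed: "T \<subseteq> carrier M \<Longrightarrow> ind_span T \<subseteq> carrier M"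
proof
  fix x assume T: "T \<subseteq> carrier M" and "x \<in> ind_span T"
  from this(2) show "x \<in> carrier M" by induction (use T in auto)
qed

lemma ind_span_add:
  assumes T: "T \<subseteq> carrier M" and x: "x \<in> ind_span T" and y: "y \<in> ind_span T"
  shows "x \<oplus>\<^bsub>M\<^esub> y \<in> ind_span T"
  using x
proof induction
  case zero
  thus ?case using y ind_span_closed[OF T] by (auto simp: subset_iff)
next
  case (step c t x)
  have c: "x \<in> carrier M" "y \<in> carrier M" "t \<in> carrier M" using step y ind_span_closed[OF T] T by auto
  have "c \<odot>\<^bsub>M\<^esub> t \<oplus>\<^bsub>M\<^esub> x \<oplus>\<^bsub>M\<^esub> y = c \<odot>\<^bsub>M\<^esub> t \<oplus>\<^bsub>M\<^esub> (x \<oplus>\<^bsub>M\<^esub> y)"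
    using c step by (simp add: M.a_assoc)
  thus ?case using ind_span.step[OF step.hyps(1,2) step.IH] by simp
qed

lemma ind_span_smult:
  assumes T: "T \<subseteq> carrier M" and a: "a \<in> carrier R" and x: "x \<in> ind_span T"
  shows "a \<odot>\<^bsub>M\<^esub> x \<in> ind_span T"
  using x
proof induction
  case zero
  thus ?case using a ind_span.zero by simp
next
  case (step c t x)
  have c: "x \<in> carrier M" "t \<in> carrier M" using step ind_span_closed[OF T] T by auto
  have "a \<odot>\<^bsub>M\<^esub> (c \<odot>\<^bsub>M\<^esub> t \<oplus>\<^bsub>M\<^esub> x) = (a \<otimes> c) \<odot>\<^bsub>M\<^esub> t \<oplus>\<^bsub>M\<^esub> a \<odot>\<^bsub>M\<^esub> x"
    using c step a by (simp add: smult_r_distr smult_assoc1)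
  thus ?case using ind_span.step[of "a \<otimes> c" t T, OF _ step.hyps(2) step.IH] a step.hyps by simp
qed

lemma ind_span_insert:
  assumes T: "insert v T \<subseteq> carrier M" and x: "x \<in> ind_span (insert v T)"
  shows "\<exists>a\<in>carrier R. \<exists>h\<in>ind_span T. x = a \<odot>\<^bsub>M\<^esub> v \<oplus>\<^bsub>M\<^esub> h"
  using x
proof induction
  case zero
  have "\<zero>\<^bsub>M\<^esub> = \<zero> \<odot>\<^bsub>M\<^esub> v \<oplus>\<^bsub>M\<^esub> \<zero>\<^bsub>M\<^esub>" using T by simp
  thus ?case using ind_span.zero by blast
next
  case (step c t x)
  then obtain a h where a: "a \<in> carrier R" "h \<in> ind_span T" and x: "x = a \<odot>\<^bsub>M\<^esub> v \<oplus>\<^bsub>M\<^esub> h" by blast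
  have h: "h \<in> carrier M" using a T ind_span_closed[of T] by auto
  show ?case
  proof (cases "t = v")
    case True
    have "c \<odot>\<^bsub>M\<^esub> t \<oplus>\<^bsub>M\<^esub> x = (c \<oplus> a) \<odot>\<^bsub>M\<^esub> v \<oplus>\<^bsub>M\<^esub> h"
      unfolding x True using T h a step.hyps by (simp add: smult_l_distr M.a_assoc)
    moreover have "c \<oplus> a \<in> carrier R" using a step.hyps by simp
    ultimately show ?thesis using a(2) by blast
  next
    case False
    hence t: "t \<in> T" using step.hyps by simp
    have "c \<odot>\<^bsub>M\<^esub> t \<oplus>\<^bsub>M\<^esub> x = a \<odot>\<^bsub>M\<^esub> v \<oplus>\<^bsub>M\<^esub> (c \<odot>\<^bsub>M\<^esub> t \<oplus>\<^bsub>M\<^esub> h)"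
      unfolding x using T h a step.hyps t by (simp add: M.a_lcomm subset_iff)
    thus ?thesis using a(1) ind_span.step[OF step.hyps(1) t a(2)] by blast
  qed
qed

lemma finsum_in_ind_span:
  assumes "finite A" "A \<subseteq> T" "T \<subseteq> carrier M" "c \<in> A \<rightarrow> carrier R"
  shows "(\<Oplus>\<^bsub>M\<^esub>b\<in>A. c b \<odot>\<^bsub>M\<^esub> b) \<in> ind_span T"
  using assms(1,2,4)
proof (induction A)
  case empty
  show ?case by (simp add: ind_span.zero)
next
  case (insert b A)
  have "(\<Oplus>\<^bsub>M\<^esub>b\<in>insert b A. c b \<odot>\<^bsub>M\<^esub> b) = c b \<odot>\<^bsub>M\<^esub> b \<oplus>\<^bsub>M\<^esub> (\<Oplus>\<^bsub>M\<^esub>b\<in>A. c b \<odot>\<^bsub>M\<^esub> b)"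
    using insert assms(3) by (intro M.finsum_insert) auto
  thus ?case using insert ind_span.step[of "c b" b T] by simp
qed

lemma ex_finite_ind_span:
  assumes "lin_span R M B = carrier M" "B \<subseteq> carrier M" "x \<in> carrier M"
  shows "\<exists>T. finite T \<and> T \<subseteq> B \<and> x \<in> ind_span T"
proof -
  have "x \<in> lin_span R M B" using assms by simp
  then obtain A c where "finite A" "A \<subseteq> B" "c \<in> A \<rightarrow> carrier R" "x = (\<Oplus>\<^bsub>M\<^esub>b\<in>A. c b \<odot>\<^bsub>M\<^esub> b)"
    unfolding lin_span_def by blast
  thus ?thesis using finsum_in_ind_span[of A A c] assms(2) by blast
qed

lemma finsum_smult_rdistr:
  assumes "finite A" "f \<in> A \<rightarrow> carrier R" "x \<in> carrier M"
  shows "(\<Oplus>i\<in>A. f i) \<odot>\<^bsub>M\<^esub> x = (\<Oplus>\<^bsub>M\<^esub>i\<in>A. f i \<odot>\<^bsub>M\<^esub> x)"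
  using assms(1,2)
proof (induction A)
  case (insert i A)
  have "(\<Oplus>i\<in>A. f i) \<in> carrier R" using insert by (intro R.finsum_closed) auto
  thus ?case using insert assms(3) by (simp add: Pi_def smult_l_distr)
qed (use assms in simp)

text \<open>Gaussian elimination on the spanning vectors. Dependence is that of the family indexed
  by \<open>A\<close>: equal vectors at two indices already count as dependent.\<close>

lemma infinite_family_dependent:
  assumes K: "field R" and "finite T" "T \<subseteq> carrier M" "infinite A" "\<And>x. x \<in> A \<Longrightarrow> g x \<in> ind_span T"
  shows "\<exists>C \<alpha>. finite C \<and> C \<subseteq> A \<and> \<alpha> \<in> C \<rightarrow> carrier R \<and> (\<exists>x\<in>C. \<alpha> x \<noteq> \<zero>) \<and>
    (\<Oplus>\<^bsub>M\<^esub>x\<in>C. \<alpha> x \<odot>\<^bsub>M\<^esub> g x) = \<zero>\<^bsub>M\<^esub>"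
  using assms(2-)
proof (induction T arbitrary: A g)
  case empty
  interpret K: field R by fact
  obtain x where x: "x \<in> A" using empty by fastforce
  have "y = \<zero>\<^bsub>M\<^esub>" if "y \<in> ind_span {}" for y using that by induction auto
  hence "g x = \<zero>\<^bsub>M\<^esub>" using empty x by blast
  thus ?case using x by (intro exI[of _ "{x}"] exI[of _ "\<lambda>_. \<one>"]) auto
next
  case (insert v T)
  interpret K: field R by fact
  have T: "T \<subseteq> carrier M" "v \<in> carrier M" using insert.prems by auto
  have gc: "g x \<in> carrier M" if "x \<in> A" for x
    using insert.prems(3)[OF that] ind_span_closed[OF insert.prems(1)] by blast
  have "\<forall>x\<in>A. \<exists>a\<in>carrier R. \<exists>h\<in>ind_span T. g x = a \<odot>\<^bsub>M\<^esub> v \<oplus>\<^bsub>M\<^esub> h"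
    using ind_span_insert[OF insert.prems(1)] insert.prems(3) by blast
  then obtain a h where ah: "\<And>x. x \<in> A \<Longrightarrow> a x \<in> carrier R" "\<And>x. x \<in> A \<Longrightarrow> h x \<in> ind_span T"
    "\<And>x. x \<in> A \<Longrightarrow> g x = a x \<odot>\<^bsub>M\<^esub> v \<oplus>\<^bsub>M\<^esub> h x" by metis
  have hc: "h x \<in> carrier M" if "x \<in> A" for x using ah(2)[OF that] ind_span_closed[OF T(1)] by blast
  show ?case
  proof (cases "\<forall>x\<in>A. a x = \<zero>")
    case True
    have "g x \<in> ind_span T" if "x \<in> A" for x using True that ah T hc by simp
    thus ?thesis using insert.IH[OF T(1) insert.prems(2)] by blast
  next
    case False
    then obtain x0 where x0: "x0 \<in> A" "a x0 \<noteq> \<zero>" by blast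
    \<comment> \<open>Adding \<open>b x\<close> times the vector at the pivot \<open>x0\<close>
      cancels the component along \<open>v\<close>.\<close>
    define b where "b x = \<ominus> (a x \<otimes> inv (a x0))" for x
    have i0: "inv (a x0) \<in> carrier R" "a x0 \<otimes> inv (a x0) = \<one>" "inv (a x0) \<otimes> a x0 = \<one>" 
      using x0 ah(1)[OF x0(1)] K.field_Units by auto
    have bc: "b x \<in> carrier R" if "x \<in> A" for x using ah(1)[OF that] i0 by (simp add: b_def)
    have sp: "g x \<oplus>\<^bsub>M\<^esub> b x \<odot>\<^bsub>M\<^esub> g x0 \<in> ind_span T" if x: "x \<in> A - {x0}" for x
    proof -
      have xA: "x \<in> A" using x by simp
      have e: "b x \<otimes> a x0 = \<ominus> a x"
        using ah(1)[OF xA] ah(1)[OF x0(1)] i0 by (simp add: b_def R.l_minus R.m_assoc)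
      have "g x \<oplus>\<^bsub>M\<^esub> b x \<odot>\<^bsub>M\<^esub> g x0 = (a x \<odot>\<^bsub>M\<^esub> v \<oplus>\<^bsub>M\<^esub> h x) \<oplus>\<^bsub>M\<^esub> ((b x \<otimes> a x0) \<odot>\<^bsub>M\<^esub> v \<oplus>\<^bsub>M\<^esub> b x \<odot>\<^bsub>M\<^esub> h x0)"
        using ah(3)[OF xA] ah(3)[OF x0(1)] ah(1)[OF xA] ah(1)[OF x0(1)] bc[OF xA] hc[OF xA] hc[OF x0(1)] T
        by (simp add: smult_r_distr smult_assoc1)
      also have "(b x \<otimes> a x0) \<odot>\<^bsub>M\<^esub> v = \<ominus>\<^bsub>M\<^esub> (a x \<odot>\<^bsub>M\<^esub> v)"
        unfolding e using ah(1)[OF xA] T by (simp add: smult_l_minus)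
      also have "(a x \<odot>\<^bsub>M\<^esub> v \<oplus>\<^bsub>M\<^esub> h x) \<oplus>\<^bsub>M\<^esub> (\<ominus>\<^bsub>M\<^esub> (a x \<odot>\<^bsub>M\<^esub> v) \<oplus>\<^bsub>M\<^esub> b x \<odot>\<^bsub>M\<^esub> h x0) = h x \<oplus>\<^bsub>M\<^esub> b x \<odot>\<^bsub>M\<^esub> h x0"
      proof -
        define y z where "y = a x \<odot>\<^bsub>M\<^esub> v" and "z = b x \<odot>\<^bsub>M\<^esub> h x0"
        have c: "y \<in> carrier M" "z \<in> carrier M" "h x \<in> carrier M"
          using ah(1)[OF xA] bc[OF xA] hc[OF xA] hc[OF x0(1)] T by (auto simp: y_def z_def)
        have "(y \<oplus>\<^bsub>M\<^esub> h x) \<oplus>\<^bsub>M\<^esub> (\<ominus>\<^bsub>M\<^esub> y \<oplus>\<^bsub>M\<^esub> z) = (y \<oplus>\<^bsub>M\<^esub> \<ominus>\<^bsub>M\<^esub> y) \<oplus>\<^bsub>M\<^esub> (h x \<oplus>\<^bsub>M\<^esub> z)"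
          using c by (simp add: M.a_ac)
        thus ?thesis using c by (simp add: M.r_neg y_def z_def)
      qed
      finally show ?thesis
        using ind_span_add[OF T(1) ah(2)[OF xA] ind_span_smult[OF T(1) bc[OF xA] ah(2)[OF x0(1)]]] by simp
    qed
    have inf: "infinite (A - {x0})" using insert.prems(2) by simp
    have "\<exists>C \<alpha>. finite C \<and> C \<subseteq> A - {x0} \<and> \<alpha> \<in> C \<rightarrow> carrier R \<and> (\<exists>x\<in>C. \<alpha> x \<noteq> \<zero>) \<and>
        (\<Oplus>\<^bsub>M\<^esub>x\<in>C. \<alpha> x \<odot>\<^bsub>M\<^esub> (g x \<oplus>\<^bsub>M\<^esub> b x \<odot>\<^bsub>M\<^esub> g x0)) = \<zero>\<^bsub>M\<^esub>"
      by (rule insert.IH[OF T(1) inf]) (rule sp)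
    then obtain C \<alpha> where C: "finite C" "C \<subseteq> A - {x0}" and \<alpha>: "\<alpha> \<in> C \<rightarrow> carrier R"
      and nz: "\<exists>x\<in>C. \<alpha> x \<noteq> \<zero>" and eq: "(\<Oplus>\<^bsub>M\<^esub>x\<in>C. \<alpha> x \<odot>\<^bsub>M\<^esub> (g x \<oplus>\<^bsub>M\<^esub> b x \<odot>\<^bsub>M\<^esub> g x0)) = \<zero>\<^bsub>M\<^esub>"
      by (elim exE conjE)
    have CA: "x \<in> A" if "x \<in> C" for x using C that by auto
    have ac: "\<alpha> x \<in> carrier R" if "x \<in> C" for x using \<alpha> that by auto
    define s where "s = (\<Oplus>x\<in>C. \<alpha> x \<otimes> b x)"
    have sc: "s \<in> carrier R" unfolding s_def using ac bc CA by (intro R.finsum_closed) auto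
    have "\<zero>\<^bsub>M\<^esub> = (\<Oplus>\<^bsub>M\<^esub>x\<in>C. \<alpha> x \<odot>\<^bsub>M\<^esub> g x \<oplus>\<^bsub>M\<^esub> (\<alpha> x \<otimes> b x) \<odot>\<^bsub>M\<^esub> g x0)"
      unfolding eq[symmetric] using ac bc CA gc x0
      by (intro M.finsum_cong' refl) (auto simp: smult_r_distr smult_assoc1)
    also have "\<dots> = (\<Oplus>\<^bsub>M\<^esub>x\<in>C. \<alpha> x \<odot>\<^bsub>M\<^esub> g x) \<oplus>\<^bsub>M\<^esub> (\<Oplus>\<^bsub>M\<^esub>x\<in>C. (\<alpha> x \<otimes> b x) \<odot>\<^bsub>M\<^esub> g x0)"
      using ac bc CA gc x0 by (intro M.finsum_addf) auto
    also have "(\<Oplus>\<^bsub>M\<^esub>x\<in>C. (\<alpha> x \<otimes> b x) \<odot>\<^bsub>M\<^esub> g x0) = s \<odot>\<^bsub>M\<^esub> g x0"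
      unfolding s_def using C ac bc CA gc x0 by (intro finsum_smult_rdistr[symmetric]) auto
    finally have z: "\<zero>\<^bsub>M\<^esub> = (\<Oplus>\<^bsub>M\<^esub>x\<in>C. \<alpha> x \<odot>\<^bsub>M\<^esub> g x) \<oplus>\<^bsub>M\<^esub> s \<odot>\<^bsub>M\<^esub> g x0" .
    \<comment> \<open>Undoing the elimination gathers all contributions of the pivot vector in its
      coefficient \<open>s\<close>. Since \<open>x0\<close> is outside \<open>C\<close>, the nonzero
      coefficient found before survives.\<close>
    let ?\<beta> = "\<alpha>(x0 := s)"
    have x0C: "x0 \<notin> C" using C by auto
    have same: "(\<Oplus>\<^bsub>M\<^esub>x\<in>C. ?\<beta> x \<odot>\<^bsub>M\<^esub> g x) = (\<Oplus>\<^bsub>M\<^esub>x\<in>C. \<alpha> x \<odot>\<^bsub>M\<^esub> g x)"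
      using x0C ac gc CA by (intro M.finsum_cong') auto
    have clos: "(\<Oplus>\<^bsub>M\<^esub>x\<in>C. \<alpha> x \<odot>\<^bsub>M\<^esub> g x) \<in> carrier M" using ac gc CA by (intro M.finsum_closed) auto
    have "(\<Oplus>\<^bsub>M\<^esub>x\<in>insert x0 C. ?\<beta> x \<odot>\<^bsub>M\<^esub> g x) = ?\<beta> x0 \<odot>\<^bsub>M\<^esub> g x0 \<oplus>\<^bsub>M\<^esub> (\<Oplus>\<^bsub>M\<^esub>x\<in>C. ?\<beta> x \<odot>\<^bsub>M\<^esub> g x)"
      using C x0C ac gc CA sc x0 by (intro M.finsum_insert) auto
    also have "\<dots> = \<zero>\<^bsub>M\<^esub>" unfolding same using z clos sc gc[OF x0(1)] by (simp add: M.a_comm)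
    finally have "(\<Oplus>\<^bsub>M\<^esub>x\<in>insert x0 C. ?\<beta> x \<odot>\<^bsub>M\<^esub> g x) = \<zero>\<^bsub>M\<^esub>" .
    moreover have "\<exists>x\<in>insert x0 C. ?\<beta> x \<noteq> \<zero>" using nz x0C by auto
    moreover have "?\<beta> \<in> insert x0 C \<rightarrow> carrier R" using ac sc by auto
    moreover have "finite (insert x0 C)" "insert x0 C \<subseteq> A" using C x0 by auto
    ultimately show ?thesis by (intro exI[of _ "insert x0 C"] exI[of _ ?\<beta>] conjI)
  qed
qed

end

section \<open>Partial fractions over a subfield\<close>

context field
begin

text \<open>\<open>p\<close> is a common denominator and \<open>q\<close> the numerator of the sum
  of the \<open>a c / (X - u c)\<close>. One pair serves all \<open>y\<close> off the poles, because
  it is later evaluated both at the element under study and at a further pole.\<close>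

lemma rational_function_polynomials:
  assumes k: "subfield k R" and C: "finite C" and u: "u \<in> C \<rightarrow> k" and a: "a \<in> C \<rightarrow> k"
  shows "\<exists>p\<in>carrier (k[X]). \<exists>q\<in>carrier (k[X]). \<forall>y\<in>carrier R. y \<notin> u ` C \<longrightarrow>
    eval p y \<noteq> \<zero> \<and> eval q y = (\<Oplus>c\<in>C. a c \<otimes> inv (y \<ominus> u c)) \<otimes> eval p y"
  using C u a
proof (induction C)
  case empty
  interpret P: domain "k[X]" by (rule univ_poly_is_domain[OF subfieldE(1)[OF k]])
  have "eval \<one>\<^bsub>k[X]\<^esub> y \<noteq> \<zero> \<and> eval \<zero>\<^bsub>k[X]\<^esub> y = \<zero> \<otimes> eval \<one>\<^bsub>k[X]\<^esub> y" if "y \<in> carrier R" for y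
  proof -
    interpret h: ring_hom_ring "k[X]" R "\<lambda>p. eval p y" by (rule eval_ring_hom[OF subfieldE(1)[OF k] that])
    show ?thesis using h.hom_one h.hom_zero by simp
  qed
  thus ?case by (intro bexI[of _ "\<one>\<^bsub>k[X]\<^esub>"] bexI[of _ "\<zero>\<^bsub>k[X]\<^esub>"]) auto
next
  case (insert c C)
  interpret P: domain "k[X]" by (rule univ_poly_is_domain[OF subfieldE(1)[OF k]])
  have uc: "u c \<in> k" "a c \<in> k" and carr: "u x \<in> carrier R" "a x \<in> carrier R" if "x \<in> insert c C" for x
    using insert.prems subfieldE(3)[OF k] that by auto
  have "u \<in> C \<rightarrow> k" "a \<in> C \<rightarrow> k" using insert.prems by auto
  then obtain p q where p: "p \<in> carrier (k[X])" and q: "q \<in> carrier (k[X])"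
    and "\<forall>y\<in>carrier R. y \<notin> u ` C \<longrightarrow> eval p y \<noteq> \<zero> \<and> eval q y = (\<Oplus>c\<in>C. a c \<otimes> inv (y \<ominus> u c)) \<otimes> eval p y"
    using insert.IH by blast
  hence pq: "eval p y \<noteq> \<zero> \<and> eval q y = (\<Oplus>c\<in>C. a c \<otimes> inv (y \<ominus> u c)) \<otimes> eval p y"
    if "y \<in> carrier R" "y \<notin> u ` C" for y
    using that by simp
  define l where "l = [\<one>, \<ominus> u c]"
  have l: "l \<in> carrier (k[X])"
    using uc(1) insert.prems subringE[OF subfieldE(1)[OF k]] by (auto simp: l_def univ_poly_def polynomial_def)
  \<comment> \<open>Polynomials are coefficient lists without leading zeros, so the constant
    \<open>a c\<close> is normalized in case it is zero.\<close>
  define m where "m = normalize [a c]"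
  have m: "m \<in> carrier (k[X])"
    using uc(2) normalize_gives_polynomial[of "[a c]" k] by (auto simp: m_def univ_poly_def)
  let ?p = "p \<otimes>\<^bsub>k[X]\<^esub> l" and ?q = "q \<otimes>\<^bsub>k[X]\<^esub> l \<oplus>\<^bsub>k[X]\<^esub> m \<otimes>\<^bsub>k[X]\<^esub> p"
  have "eval ?p y \<noteq> \<zero> \<and> eval ?q y = (\<Oplus>c\<in>insert c C. a c \<otimes> inv (y \<ominus> u c)) \<otimes> eval ?p y"
    if y: "y \<in> carrier R" "y \<notin> u ` insert c C" for y
  proof -
    interpret h: ring_hom_ring "k[X]" R "\<lambda>p. eval p y" by (rule eval_ring_hom[OF subfieldE(1)[OF k] y(1)])
    have el: "eval l y = y \<ominus> u c" using y carr by (simp add: l_def minus_eq)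
    have em: "eval m y = a c" using y carr[of c] eval_normalize[of "[a c]" y] by (simp add: m_def)
    have nz: "y \<ominus> u x \<noteq> \<zero>" if "x \<in> insert c C" for x
      using y that carr[OF that] by auto
    have iv: "inv (y \<ominus> u x) \<in> carrier R" "inv (y \<ominus> u x) \<otimes> (y \<ominus> u x) = \<one>" if "x \<in> insert c C" for x
      using nz[OF that] carr[OF that] y field_Units by auto
    let ?S = "\<Oplus>c\<in>C. a c \<otimes> inv (y \<ominus> u c)"
    have S: "?S \<in> carrier R" using iv carr by (intro finsum_closed) auto
    have Si: "(\<Oplus>c\<in>insert c C. a c \<otimes> inv (y \<ominus> u c)) = a c \<otimes> inv (y \<ominus> u c) \<oplus> ?S"
      using insert.hyps iv carr by (intro finsum_insert) auto
    have ep: "eval p y \<in> carrier R" "eval q y \<in> carrier R" using p q by auto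
    have pq': "eval p y \<noteq> \<zero>" "eval q y = ?S \<otimes> eval p y" using pq y by auto
    have ex: "eval ?p y = eval p y \<otimes> (y \<ominus> u c)" using p l el by simp
    have "eval ?q y = eval q y \<otimes> (y \<ominus> u c) \<oplus> a c \<otimes> eval p y" using p q l m el em by simp
    also have "\<dots> = ?S \<otimes> eval p y \<otimes> (y \<ominus> u c) \<oplus> a c \<otimes> (inv (y \<ominus> u c) \<otimes> (y \<ominus> u c)) \<otimes> eval p y"
      unfolding pq'(2) using iv(2)[of c] carr[of c] by simp
    also have "\<dots> = (a c \<otimes> inv (y \<ominus> u c) \<oplus> ?S) \<otimes> (eval p y \<otimes> (y \<ominus> u c))"
    proof -
      define w where "w = y \<ominus> u c"
      have w: "w \<in> carrier R" "inv w \<in> carrier R" using carr[of c] y iv(1)[of c] by (auto simp: w_def)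
      show ?thesis unfolding w_def[symmetric] using S ep(1) carr[of c] w by (simp add: l_distr r_distr m_ac a_ac)
    qed
    finally have "eval ?q y = \<dots>" .
    moreover have "eval p y \<otimes> (y \<ominus> u c) \<noteq> \<zero>" using pq'(1) nz[of c] ep carr[of c] y integral by (metis insertI1 minus_closed)
    ultimately show ?thesis unfolding ex Si by blast
  qed
  moreover have "?p \<in> carrier (k[X])" "?q \<in> carrier (k[X])" using p q l m by auto
  ultimately show ?case by (intro bexI[of _ ?p] bexI[of _ ?q] ballI impI)
qed

text \<open>Clearing denominators turns the relation into a polynomial \<open>?r\<close> vanishing
  at \<open>x\<close>. It is not the zero polynomial, since its value at the pole
  \<open>u c0\<close> is \<open>a c0\<close> times a nonzero denominator.\<close>

lemma algebraic_if_partial_fractions_dependent: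
  assumes k: "subfield k R" and C: "finite C" and u: "u \<in> C \<rightarrow> k" "inj_on u C" and a: "a \<in> C \<rightarrow> k"
    and c0: "c0 \<in> C" "a c0 \<noteq> \<zero>" and x: "x \<in> carrier R" "x \<notin> u ` C"
    and eq: "(\<Oplus>c\<in>C. a c \<otimes> inv (x \<ominus> u c)) = \<zero>"
  shows "algebraic k x"
proof -
  interpret P: domain "k[X]" by (rule univ_poly_is_domain[OF subfieldE(1)[OF k]])
  \<comment> \<open>Leaving out \<open>c0\<close> keeps the denominator \<open>p\<close> nonzero at
    \<open>u c0\<close>; injectivity of \<open>u\<close> puts that point off the remaining
    poles.\<close>
  let ?C = "C - {c0}"
  have carr: "u x \<in> carrier R" "a x \<in> carrier R" if "x \<in> C" for x
    using u a subfieldE(3)[OF k] that by auto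
  have "u \<in> ?C \<rightarrow> k" "a \<in> ?C \<rightarrow> k" "finite ?C" using u a C by auto
  then obtain p q where p: "p \<in> carrier (k[X])" and q: "q \<in> carrier (k[X])"
    and "\<forall>y\<in>carrier R. y \<notin> u ` ?C \<longrightarrow> eval p y \<noteq> \<zero> \<and> eval q y = (\<Oplus>c\<in>?C. a c \<otimes> inv (y \<ominus> u c)) \<otimes> eval p y"
    using rational_function_polynomials[OF k, of ?C u a] by blast
  hence pq: "eval p y \<noteq> \<zero> \<and> eval q y = (\<Oplus>c\<in>?C. a c \<otimes> inv (y \<ominus> u c)) \<otimes> eval p y"
    if "y \<in> carrier R" "y \<notin> u ` ?C" for y
    using that by simp
  define l where "l = [\<one>, \<ominus> u c0]"
  have l: "l \<in> carrier (k[X])"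
    using u c0 subringE[OF subfieldE(1)[OF k]] by (auto simp: l_def univ_poly_def polynomial_def)
  define m where "m = normalize [a c0]"
  have m: "m \<in> carrier (k[X])"
    using a c0 normalize_gives_polynomial[of "[a c0]" k] by (auto simp: m_def univ_poly_def)
  let ?r = "q \<otimes>\<^bsub>k[X]\<^esub> l \<oplus>\<^bsub>k[X]\<^esub> m \<otimes>\<^bsub>k[X]\<^esub> p"
  have r: "?r \<in> carrier (k[X])" using p q l m by auto
  have er: "eval ?r y = eval q y \<otimes> (y \<ominus> u c0) \<oplus> a c0 \<otimes> eval p y" if y: "y \<in> carrier R" for y
  proof -
    interpret h: ring_hom_ring "k[X]" R "\<lambda>p. eval p y" by (rule eval_ring_hom[OF subfieldE(1)[OF k] y(1)])
    have el: "eval l y = y \<ominus> u c0" using y carr c0 by (simp add: l_def minus_eq)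
    have em: "eval m y = a c0" using y carr[OF c0(1)] eval_normalize[of "[a c0]" y] by (simp add: m_def)
    show ?thesis using p q l m el em by simp
  qed
  have ev: "eval z y \<in> carrier R" if "z \<in> carrier (k[X])" "y \<in> carrier R" for z y
    using ring_hom_memE(1)[OF ring_hom_ring.homh[OF eval_ring_hom[OF subfieldE(1)[OF k] that(2)]] that(1)] .
  have c0n: "u c0 \<notin> u ` ?C" using u(2) c0 by (auto dest: inj_onD)
  have "eval ?r (u c0) = a c0 \<otimes> eval p (u c0)"
    using er[OF carr(1)[OF c0(1)]] ev[OF q carr(1)[OF c0(1)]] ev[OF p carr(1)[OF c0(1)]] carr[OF c0(1)]
    by (simp add: r_neg minus_eq)
  moreover have "\<dots> \<noteq> \<zero>"
    using pq[OF carr(1)[OF c0(1)] c0n] c0 carr[OF c0(1)] ev[OF p carr(1)[OF c0(1)]] integral by blast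
  ultimately have rn: "?r \<noteq> []" by auto
  have iv: "inv (x \<ominus> u c) \<in> carrier R" "inv (x \<ominus> u c) \<otimes> (x \<ominus> u c) = \<one>" if "c \<in> C" for c
  proof -
    have "x \<ominus> u c \<noteq> \<zero>" using x that carr[OF that] by auto
    thus "inv (x \<ominus> u c) \<in> carrier R" "inv (x \<ominus> u c) \<otimes> (x \<ominus> u c) = \<one>" using carr[OF that] x field_Units by auto
  qed
  let ?S = "\<Oplus>c\<in>?C. a c \<otimes> inv (x \<ominus> u c)"
  have S: "?S \<in> carrier R" using iv carr by (intro finsum_closed) auto
  have "(\<Oplus>c\<in>insert c0 ?C. a c \<otimes> inv (x \<ominus> u c)) = a c0 \<otimes> inv (x \<ominus> u c0) \<oplus> ?S"
    using C c0 iv carr by (intro finsum_insert) auto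
  hence Si: "a c0 \<otimes> inv (x \<ominus> u c0) \<oplus> ?S = \<zero>" using eq c0 by (simp add: insert_absorb)
  have xn: "x \<notin> u ` ?C" using x by auto
  define w where "w = x \<ominus> u c0"
  have w: "w \<in> carrier R" "inv w \<in> carrier R" "inv w \<otimes> w = \<one>"
    using carr[OF c0(1)] x iv[OF c0(1)] by (auto simp: w_def)
  have "eval ?r x = ?S \<otimes> eval p x \<otimes> w \<oplus> a c0 \<otimes> (inv w \<otimes> w) \<otimes> eval p x"
    using er[OF x(1)] pq[OF x(1) xn] w carr[OF c0(1)] by (simp add: w_def)
  also have "\<dots> = (a c0 \<otimes> inv w \<oplus> ?S) \<otimes> (eval p x \<otimes> w)"
    using S ev[OF p x(1)] carr[OF c0(1)] w(1,2) by (simp add: l_distr r_distr m_ac a_ac)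
  also have "\<dots> = \<zero>" using Si ev[OF p x(1)] w(1) by (simp add: w_def)
  finally show ?thesis using algebraicI[OF r rn] by (simp add: over_def)
qed

end

section \<open>Fraction fields of prime quotients\<close>

definition frac_map :: "('a, 'n) ring_scheme \<Rightarrow> 'a set \<Rightarrow> 'a \<Rightarrow> ('a set \<times> 'a set) set" where
  "frac_map R P r = fraction (R Quot P) (P +>\<^bsub>R\<^esub> r) \<one>\<^bsub>R Quot P\<^esub>"

lemma (in primeideal) quot_carrier: "carrier (R Quot I) = (\<lambda>r. I +> r) ` carrier R"
  by (auto simp: FactRing_def A_RCOSETS_def')

lemma (in primeideal) quot_zero: "\<zero>\<^bsub>R Quot I\<^esub> = I"
  by (simp add: FactRing_def)

lemma (in primeideal) rcos_eq_zero_iff: "r \<in> carrier R \<Longrightarrow> I +> r = I \<longleftrightarrow> r \<in> I"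
  using a_rcos_const rcos_const_imp_mem by blast

lemma (in primeideal) frac_map_hom: "frac_map R I \<in> ring_hom R (Frac (R Quot I))"
proof (rule ring_hom_memI)
  interpret Q: "domain" "R Quot I" by (rule quotient_is_domain)
  note h = rcos_ring_hom
  have c: "I +> r \<in> carrier (R Quot I)" if "r \<in> carrier R" for r using that by (simp add: quot_carrier)
  fix x assume x: "x \<in> carrier R"
  show "frac_map R I x \<in> carrier (Frac (R Quot I))" using c[OF x] by (simp add: frac_map_def)
  fix y assume y: "y \<in> carrier R"
  show "frac_map R I (x \<otimes> y) = frac_map R I x \<otimes>\<^bsub>Frac (R Quot I)\<^esub> frac_map R I y"
    using c[OF x] c[OF y] x y by (simp add: frac_map_def Q.fraction_mult ring_hom_mult[OF h])
  show "frac_map R I (x \<oplus> y) = frac_map R I x \<oplus>\<^bsub>Frac (R Quot I)\<^esub> frac_map R I y"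
    using c[OF x] c[OF y] x y by (simp add: frac_map_def Q.fraction_add ring_hom_add[OF h])
next
  interpret Q: "domain" "R Quot I" by (rule quotient_is_domain)
  show "frac_map R I \<one> = \<one>\<^bsub>Frac (R Quot I)\<^esub>"
    by (simp add: frac_map_def Q.fraction_one ring_hom_one[OF rcos_ring_hom])
qed

lemma (in primeideal) frac_map_zero_iff:
  assumes r: "r \<in> carrier R"
  shows "frac_map R I r = \<zero>\<^bsub>Frac (R Quot I)\<^esub> \<longleftrightarrow> r \<in> I"
proof -
  interpret Q: "domain" "R Quot I" by (rule quotient_is_domain)
  have c: "I +> r \<in> carrier (R Quot I)" using r by (simp add: quot_carrier)
  have "frac_map R I r = \<zero>\<^bsub>Frac (R Quot I)\<^esub> \<longleftrightarrow> I +> r = \<zero>\<^bsub>R Quot I\<^esub>"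
    using c by (simp add: frac_map_def Q.fraction_zero Q.fraction_eq_iff)
  thus ?thesis by (simp add: quot_zero rcos_eq_zero_iff[OF r])
qed

lemma (in primeideal) frac_map_quotient:
  assumes "x \<in> carrier (Frac (R Quot I))"
  shows "\<exists>a\<in>carrier R. \<exists>b\<in>carrier R - I. frac_map R I b \<otimes>\<^bsub>Frac (R Quot I)\<^esub> x = frac_map R I a"
proof -
  interpret Q: "domain" "R Quot I" by (rule quotient_is_domain)
  obtain A B where AB: "A \<in> carrier (R Quot I)" "B \<in> carrier (R Quot I)" "B \<noteq> \<zero>\<^bsub>R Quot I\<^esub>"
    and x: "x = fraction (R Quot I) A B" using assms by (rule Q.fraction_cases)
  obtain a b where ab: "a \<in> carrier R" "A = I +> a" "b \<in> carrier R" "B = I +> b"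
    using AB by (auto simp: quot_carrier)
  have "b \<notin> I" using AB(3) ab rcos_eq_zero_iff[of b] quot_zero by auto
  moreover have "frac_map R I b \<otimes>\<^bsub>Frac (R Quot I)\<^esub> x = frac_map R I a"
    using AB Q.nonzero_prod
    by (simp add: frac_map_def x ab(2,4)[symmetric] Q.fraction_mult Q.fraction_eq_iff Q.m_ac)
  ultimately show ?thesis using ab by blast
qed

lemma (in cring) maximalideal_by_units:
  assumes N: "primeideal N R" and inv: "\<And>t. t \<in> carrier R - N \<Longrightarrow> \<exists>w\<in>carrier R. t \<otimes> w \<ominus> \<one> \<in> N"
  shows "maximalideal N R"
proof (rule maximalidealI)
  show Nid: "ideal N R" using N by (rule primeideal.axioms)
  show "carrier R \<noteq> N" using N by (rule primeideal.I_notcarr)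
  fix J assume J: "ideal J R" "N \<subseteq> J" "J \<subseteq> carrier R"
  show "J = N \<or> J = carrier R"
  proof (rule disjCI)
    assume "J \<noteq> carrier R"
    show "J = N"
    proof (rule ccontr)
      assume "J \<noteq> N"
      then obtain t where t: "t \<in> J" "t \<in> carrier R - N" using J by blast
      obtain w where w: "w \<in> carrier R" "t \<otimes> w \<ominus> \<one> \<in> N" using inv[OF t(2)] by blast
      have tc: "t \<in> carrier R" using t by simp
      have "t \<otimes> w \<ominus> (t \<otimes> w \<ominus> \<one>) = \<one>" using tc w by algebra
      hence "\<one> \<in> J" using ideal_facts(4,6)[OF J(1)] w t J(2) by (metis subsetD)
      thus False using ideal.one_imp_carrier[OF J(1)] \<open>J \<noteq> carrier R\<close> by blast
    qed
  qed
qed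

lemma (in cring) maximalideal_inverse:
  assumes M: "maximalideal M R" and d: "d \<in> carrier R - M"
  shows "\<exists>w\<in>carrier R. \<one> \<ominus> d \<otimes> w \<in> M"
proof -
  have Mid: "ideal M R" using M by (rule maximalideal.axioms)
  have dc: "d \<in> carrier R" using d by simp
  note A = adjoin_facts[OF Mid dc]
  have "adjoin R M d \<noteq> M" using A(3) d by blast
  hence "adjoin R M d = carrier R"
    using maximalideal.I_maximal[OF M A(1,2)] ideal_facts(1)[OF A(1)] by blast
  hence "\<one> \<in> adjoin R M d" by simp
  then obtain m w where m: "m \<in> M" "w \<in> carrier R" "\<one> = m \<oplus> w \<otimes> d" by (auto simp: adjoin_def)
  have mc: "m \<in> carrier R" using m ideal_facts(1)[OF Mid] by blast
  have "\<one> \<ominus> d \<otimes> w = m" unfolding m(3) using m(2) mc dc by algebra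
  thus ?thesis using m by blast
qed

lemma (in ideal) finsum_in_ideal:
  assumes "finite A" "f \<in> A \<rightarrow> I"
  shows "(\<Oplus>x\<in>A. f x) \<in> I"
  using assms
proof (induction A)
  case (insert x A)
  have "f \<in> A \<rightarrow> carrier R" "f x \<in> carrier R" using insert.prems by (auto intro!: Icarr)
  thus ?case using insert by simp
qed simp

section \<open>Algebras of dimension less than the size of an infinite field\<close>

locale small_diff_algebra = noetherian_diff_ring R \<Delta> + alg: algebra K R + K: field K
  for R :: "('k, 'a, 'n) module_scheme" (structure) and \<Delta> and K :: "('k, 'm) ring_scheme" +
  fixes B
  assumes scalars_infinite: "infinite (carrier K)"
    and spanning: "B \<subseteq> carrier R" "lin_span K R B = carrier R" "|B| <o |carrier K|"
    and derivations_small: "|\<Delta>| <o |carrier K|"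
    and der_smult: "\<delta> \<in> \<Delta> \<Longrightarrow> c \<in> carrier K \<Longrightarrow> a \<in> carrier R \<Longrightarrow> \<delta> (c \<odot> a) = c \<odot> \<delta> a"
begin

lemma smult_eq_mult: "c \<in> carrier K \<Longrightarrow> a \<in> carrier R \<Longrightarrow> c \<odot> a = (c \<odot> \<one>) \<otimes> a"
  using alg.smult_assoc2[of c \<one> a] by simp

lemma scalar_hom: "(\<lambda>c. c \<odot> \<one>) \<in> ring_hom K R"
proof (rule ring_hom_memI)
  fix x y assume xy: "x \<in> carrier K" "y \<in> carrier K"
  show "(x \<otimes>\<^bsub>K\<^esub> y) \<odot> \<one> = (x \<odot> \<one>) \<otimes> (y \<odot> \<one>)"
    using xy smult_eq_mult[of x "y \<odot> \<one>"] by (simp add: alg.smult_assoc1)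
qed (auto simp: alg.smult_l_distr)

lemma scalar_inverse:
  assumes "c \<in> carrier K" "c \<noteq> \<zero>\<^bsub>K\<^esub>"
  shows "(c \<odot> \<one>) \<otimes> (inv\<^bsub>K\<^esub> c \<odot> \<one>) = \<one>"
proof -
  have i: "inv\<^bsub>K\<^esub> c \<in> carrier K" "c \<otimes>\<^bsub>K\<^esub> inv\<^bsub>K\<^esub> c = \<one>\<^bsub>K\<^esub>" using assms K.field_Units by auto
  have "(c \<odot> \<one>) \<otimes> (inv\<^bsub>K\<^esub> c \<odot> \<one>) = (c \<otimes>\<^bsub>K\<^esub> inv\<^bsub>K\<^esub> c) \<odot> \<one>"
    using ring_hom_mult[OF scalar_hom assms(1) i(1)] by simp
  thus ?thesis using i by simp
qed

lemma smult_ideal: "ideal I R \<Longrightarrow> c \<in> carrier K \<Longrightarrow> x \<in> I \<Longrightarrow> c \<odot> x \<in> I"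
  using smult_eq_mult[of c x] ideal_facts(1,5)[of I] by auto

text \<open>Each \<open>g c\<close> lies in the span of a finite part of \<open>B\<close>. The pairs
  of such a part and a label \<open>s c\<close> number fewer than \<open>|carrier K|\<close>, so
  infinitely many scalars share a pair and elimination applies to them. In applications the label is
  a denominator, or trivial.\<close>

lemma scalar_family_dependent:
  assumes S: "infinite B \<or> finite S" "|S| <o |carrier K|" and s: "s \<in> carrier K \<rightarrow> S"
    and g: "g \<in> carrier K \<rightarrow> carrier R"
  shows "\<exists>C \<alpha> s0. finite C \<and> C \<subseteq> carrier K \<and> (\<forall>c\<in>C. s c = s0) \<and> \<alpha> \<in> C \<rightarrow> carrier K \<and>
    (\<exists>c\<in>C. \<alpha> c \<noteq> \<zero>\<^bsub>K\<^esub>) \<and> (\<Oplus>c\<in>C. \<alpha> c \<odot> g c) = \<zero>"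
proof -
  have "\<forall>c\<in>carrier K. \<exists>T. finite T \<and> T \<subseteq> B \<and> g c \<in> alg.ind_span T"
    using alg.ex_finite_ind_span[OF spanning(2,1)] g by blast
  then obtain T where T: "\<And>c. c \<in> carrier K \<Longrightarrow> finite (T c) \<and> T c \<subseteq> B \<and> g c \<in> alg.ind_span (T c)" by metis
  let ?N = "{T. finite T \<and> T \<subseteq> B} \<times> S"
  have "|?N| <o |carrier K|"
  proof (cases "finite B")
    case True
    hence "finite ?N" using S by simp
    thus ?thesis using scalars_infinite by (rule finite_ordLess_infinite2)
  next
    case False
    let ?Y = "B <+> S"
    have Y: "infinite ?Y" "|?Y| <o |carrier K|"
      using False card_of_Plus_ordLess_infinite[OF scalars_infinite spanning(3) S(2)] by auto
    have "|{T. finite T \<and> T \<subseteq> B}| \<le>o |?Y|" by (rule card_of_finite_subsets[OF Y(1) card_of_Plus1])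
    hence "|?N| \<le>o |?Y|" by (rule card_of_Sigma_ordLeq_infinite[OF Y(1)]) (simp add: card_of_Plus2)
    thus ?thesis using Y(2) ordLeq_ordLess_trans by blast
  qed
  moreover have "(\<lambda>c. (T c, s c)) ` carrier K \<subseteq> ?N" using T s by auto
  ultimately have "\<exists>b\<in>?N. infinite {c \<in> carrier K. (T c, s c) = b}"
    by (rule infinite_fiber[OF scalars_infinite])
  then obtain T0 s0 where "(T0, s0) \<in> ?N" and inf: "infinite {c \<in> carrier K. (T c, s c) = (T0, s0)}" by blast
  hence T0: "finite T0" "T0 \<subseteq> carrier R" using spanning(1) by auto
  let ?A = "{c \<in> carrier K. (T c, s c) = (T0, s0)}"
  have "\<exists>C \<alpha>. finite C \<and> C \<subseteq> ?A \<and> \<alpha> \<in> C \<rightarrow> carrier K \<and> (\<exists>x\<in>C. \<alpha> x \<noteq> \<zero>\<^bsub>K\<^esub>) \<and> (\<Oplus>x\<in>C. \<alpha> x \<odot> g x) = \<zero>"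
    by (rule alg.infinite_family_dependent[OF K.field_axioms T0 inf]) (use T in auto)
  then obtain C \<alpha> where C: "finite C" "C \<subseteq> ?A" "\<alpha> \<in> C \<rightarrow> carrier K" "\<exists>x\<in>C. \<alpha> x \<noteq> \<zero>\<^bsub>K\<^esub>"
    "(\<Oplus>x\<in>C. \<alpha> x \<odot> g x) = \<zero>" by (elim exE conjE)
  show ?thesis
  proof (intro exI[of _ C] exI[of _ \<alpha>] exI[of _ s0] conjI C)
    show "C \<subseteq> carrier K" "\<forall>c\<in>C. s c = s0" using C(2) by auto
  qed
qed

text \<open>A domain algebraic over a field is a field. The powers of \<open>t\<close> satisfy a
  linear relation; dividing by the lowest power of \<open>t\<close> that occurs, allowed modulo
  \<open>N\<close>, exhibits an inverse of \<open>t\<close>.\<close>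

lemma finite_dimensional_prime_maximal:
  assumes B: "finite B" and N: "primeideal N R"
  shows "maximalideal N R"
proof (rule maximalideal_by_units[OF N])
  fix t assume t: "t \<in> carrier R - N"
  have tc: "t \<in> carrier R" using t by simp
  have Nid: "ideal N R" using N by (rule primeideal.axioms)
  have "\<exists>C \<alpha>. finite C \<and> C \<subseteq> UNIV \<and> \<alpha> \<in> C \<rightarrow> carrier K \<and> (\<exists>n\<in>C. \<alpha> n \<noteq> \<zero>\<^bsub>K\<^esub>) \<and>
      (\<Oplus>n\<in>C. \<alpha> n \<odot> t [^] (n::nat)) = \<zero>"
  proof (rule alg.infinite_family_dependent[OF K.field_axioms B spanning(1) infinite_UNIV_nat])
    fix n :: nat
    obtain T where T: "finite T" "T \<subseteq> B" "t [^] n \<in> alg.ind_span T"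
      using alg.ex_finite_ind_span[OF spanning(2,1), of "t [^] n"] tc by auto
    from T(3) show "t [^] n \<in> alg.ind_span B"
      by induction (use T(2) in \<open>auto intro: alg.ind_span.intros\<close>)
  qed
  then obtain C \<alpha> where C: "finite C" and \<alpha>: "\<alpha> \<in> C \<rightarrow> carrier K" "\<exists>n\<in>C. \<alpha> n \<noteq> \<zero>\<^bsub>K\<^esub>"
    and eq: "(\<Oplus>n\<in>C. \<alpha> n \<odot> t [^] (n::nat)) = \<zero>" by (elim exE conjE)
  define n0 where "n0 = (LEAST n. n \<in> C \<and> \<alpha> n \<noteq> \<zero>\<^bsub>K\<^esub>)"
  have n0: "n0 \<in> C" "\<alpha> n0 \<noteq> \<zero>\<^bsub>K\<^esub>" using LeastI_ex[of "\<lambda>n. n \<in> C \<and> \<alpha> n \<noteq> \<zero>\<^bsub>K\<^esub>"] \<alpha>(2) by (auto simp: n0_def)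
  have small: "\<alpha> n = \<zero>\<^bsub>K\<^esub>" if "n \<in> C" "n < n0" for n
    using not_less_Least[of n "\<lambda>n. n \<in> C \<and> \<alpha> n \<noteq> \<zero>\<^bsub>K\<^esub>"] that by (auto simp: n0_def)
  \<comment> \<open>Every term other than the lowest lies in the ideal of \<open>t^(n0+1)\<close>,
    so the relation becomes \<open>s t^n0 + w t^(n0+1) = 0\<close> with \<open>s\<close> an
    invertible scalar.\<close>
  let ?I = "PIdl (t [^] Suc n0)"
  have Iid: "ideal ?I R" using tc by (simp add: cgenideal_ideal)
  have summand: "\<alpha> n \<odot> t [^] n \<in> ?I" if n: "n \<in> C - {n0}" for n
  proof (cases "n < n0")
    case True
    thus ?thesis using small[of n] n tc ideal_facts(2)[OF Iid] by simp
  next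
    case False
    hence "n = Suc n0 + (n - Suc n0)" using n by simp
    hence "t [^] n = t [^] Suc n0 \<otimes> t [^] (n - Suc n0)" using tc by (metis nat_pow_mult)
    hence "t [^] n \<in> ?I" using ideal_facts(6)[OF Iid _ cgenideal_self] tc by simp
    thus ?thesis using smult_ideal[OF Iid] \<alpha>(1) n by auto
  qed
  let ?S = "\<Oplus>n\<in>C - {n0}. \<alpha> n \<odot> t [^] n"
  have "?S \<in> ?I" using C summand by (intro ideal.finsum_in_ideal[OF Iid]) auto
  then obtain w where w: "w \<in> carrier R" "?S = w \<otimes> t [^] Suc n0" by (auto simp: cgenideal_def)
  define s where "s = \<alpha> n0 \<odot> \<one>"
  have a0: "\<alpha> n0 \<in> carrier K" using \<alpha>(1) n0 by auto
  have sc: "s \<in> carrier R" using a0 by (simp add: s_def)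
  have "(\<Oplus>n\<in>insert n0 (C - {n0}). \<alpha> n \<odot> t [^] n) = \<alpha> n0 \<odot> t [^] n0 \<oplus> ?S"
    using C \<alpha>(1) tc n0 by (intro finsum_insert) auto
  hence "\<zero> = s \<otimes> t [^] n0 \<oplus> w \<otimes> t [^] Suc n0"
    using eq n0 w(2) smult_eq_mult[OF a0, of "t [^] n0"] tc by (simp add: insert_absorb s_def)
  also have "\<dots> = t [^] n0 \<otimes> (s \<oplus> t \<otimes> w)" using tc w(1) sc by (simp add: r_distr m_ac)
  finally have "t [^] n0 \<otimes> (s \<oplus> t \<otimes> w) \<in> N" using ideal_facts(2)[OF Nid] by simp
  hence mem: "s \<oplus> t \<otimes> w \<in> N"
    using primeideal.I_prime[OF N, of "t [^] n0" "s \<oplus> t \<otimes> w"] prime_pow_notin[OF N t, of n0] tc w sc by auto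
  define i where "i = inv\<^bsub>K\<^esub> (\<alpha> n0) \<odot> \<one>"
  have i: "i \<in> carrier R" "s \<otimes> i = \<one>"
    using scalar_inverse[OF a0 n0(2)] a0 n0(2) K.field_Units by (auto simp: i_def s_def)
  have "t \<otimes> (\<ominus> (w \<otimes> i)) \<ominus> s \<otimes> i = \<ominus> (i \<otimes> (s \<oplus> t \<otimes> w))" using tc w(1) sc i(1) by algebra
  also have "\<dots> = (\<ominus> i) \<otimes> (s \<oplus> t \<otimes> w)" using tc w(1) sc i(1) by (simp add: l_minus)
  also have "\<dots> \<in> N" using ideal_facts(5)[OF Nid _ mem] i by simp
  finally have "t \<otimes> (\<ominus> (w \<otimes> i)) \<ominus> \<one> \<in> N" using i(2) by simp
  thus "\<exists>w\<in>carrier R. t \<otimes> w \<ominus> \<one> \<in> N" using w i by blast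
qed

end

section \<open>The fraction field at a prime\<close>

locale prime_point = small_diff_algebra +
  fixes P assumes prime_P: "primeideal P R"
begin

abbreviation "F \<equiv> Frac (R Quot P)"
abbreviation F_mult (infixl \<open>\<otimes>\<^sub>F\<close> 70) where "x \<otimes>\<^sub>F y \<equiv> x \<otimes>\<^bsub>F\<^esub> y"
abbreviation F_inv (\<open>inv\<^sub>F _\<close> [81] 80) where "inv\<^sub>F x \<equiv> inv\<^bsub>F\<^esub> x"
abbreviation F_zero (\<open>\<zero>\<^sub>F\<close>) where "\<zero>\<^sub>F \<equiv> \<zero>\<^bsub>F\<^esub>"
abbreviation F_one (\<open>\<one>\<^sub>F\<close>) where "\<one>\<^sub>F \<equiv> \<one>\<^bsub>F\<^esub>"
abbreviation "\<phi> \<equiv> frac_map R P"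
abbreviation "u c \<equiv> \<phi> (c \<odot> \<one>)"

sublocale F: field F
  by (rule domain.Frac_field[OF primeideal.quotient_is_domain[OF prime_P]])

sublocale phi: ring_hom_cring R F \<phi>
  by unfold_locales (rule primeideal.frac_map_hom[OF prime_P])

lemma phi_ring_hom: "ring_hom_ring R F \<phi>"
  by (rule ring_hom_ringI2[OF ring_axioms F.ring_axioms phi.homh])

lemma ideal_P: "ideal P R"
  using prime_P by (rule primeideal.axioms)

lemma phi_zero_iff: "r \<in> carrier R \<Longrightarrow> \<phi> r = \<zero>\<^sub>F \<longleftrightarrow> r \<in> P"
  by (rule primeideal.frac_map_zero_iff[OF prime_P])

lemma phi_minus: "a \<in> carrier R \<Longrightarrow> b \<in> carrier R \<Longrightarrow> \<phi> (a \<ominus> b) = \<phi> a \<ominus>\<^bsub>F\<^esub> \<phi> b"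
  by (simp add: minus_eq F.minus_eq)

lemma phi_eq_iff:
  assumes "a \<in> carrier R" "b \<in> carrier R"
  shows "\<phi> a = \<phi> b \<longleftrightarrow> a \<ominus> b \<in> P"
proof -
  have "\<phi> a = \<phi> b \<longleftrightarrow> \<phi> a \<ominus>\<^bsub>F\<^esub> \<phi> b = \<zero>\<^sub>F" using assms by simp
  thus ?thesis using assms phi_zero_iff[of "a \<ominus> b"] by (simp add: phi_minus)
qed

lemma phi_quotient: "x \<in> carrier F \<Longrightarrow> \<exists>a\<in>carrier R. \<exists>b\<in>carrier R - P. \<phi> b \<otimes>\<^sub>F x = \<phi> a"
  by (rule primeideal.frac_map_quotient[OF prime_P])

lemma u_hom: "u \<in> ring_hom K F"
  using ring_hom_trans[OF scalar_hom phi.homh] by (simp add: comp_def)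

lemma u_ring_hom: "ring_hom_ring K F u"
  by (rule ring_hom_ringI2[OF cring.axioms(1)[OF alg.R_cring] F.ring_axioms u_hom])

abbreviation "kP \<equiv> base_image K R P"

lemma base_image_eq: "kP = u ` carrier K"
  by (simp add: base_image_def frac_map_def)

lemma u_inj: "inj_on u (carrier K)" and base_subfield: "subfield (kP) F"
  using ring_hom_ring.img_is_subfield[OF u_ring_hom K.carrier_is_subfield F.one_not_zero] by (simp_all add: base_image_eq)

lemma phi_lincomb:
  assumes "finite C" "\<alpha> \<in> C \<rightarrow> carrier K" "g \<in> C \<rightarrow> carrier R"
  shows "\<phi> (\<Oplus>c\<in>C. \<alpha> c \<odot> g c) = (\<Oplus>\<^bsub>F\<^esub>c\<in>C. u (\<alpha> c) \<otimes>\<^sub>F \<phi> (g c))"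
  using assms
proof (induction C)
  case empty
  show ?case by simp
next
  case (insert c C)
  have c: "\<alpha> c \<in> carrier K" "g c \<in> carrier R" using insert.prems by auto
  have 1: "(\<lambda>c. \<alpha> c \<odot> g c) \<in> C \<rightarrow> carrier R" using insert.prems by auto
  have 2: "(\<lambda>c. u (\<alpha> c) \<otimes>\<^sub>F \<phi> (g c)) \<in> C \<rightarrow> carrier F" using insert.prems by auto
  have IH: "\<phi> (\<Oplus>c\<in>C. \<alpha> c \<odot> g c) = (\<Oplus>\<^bsub>F\<^esub>c\<in>C. u (\<alpha> c) \<otimes>\<^sub>F \<phi> (g c))"
    using insert by auto
  have "\<phi> (\<Oplus>c\<in>insert c C. \<alpha> c \<odot> g c) = \<phi> (\<alpha> c \<odot> g c \<oplus> (\<Oplus>c\<in>C. \<alpha> c \<odot> g c))"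
    using insert.hyps 1 c by (subst finsum_insert) auto
  also have "\<dots> = \<phi> (\<alpha> c \<odot> g c) \<oplus>\<^bsub>F\<^esub> (\<Oplus>\<^bsub>F\<^esub>c\<in>C. u (\<alpha> c) \<otimes>\<^sub>F \<phi> (g c))"
    using c 1 IH by (simp add: finsum_closed)
  also have "\<phi> (\<alpha> c \<odot> g c) = u (\<alpha> c) \<otimes>\<^sub>F \<phi> (g c)"
    using c smult_eq_mult[OF c] by simp
  also have "u (\<alpha> c) \<otimes>\<^sub>F \<phi> (g c) \<oplus>\<^bsub>F\<^esub> (\<Oplus>\<^bsub>F\<^esub>c\<in>C. u (\<alpha> c) \<otimes>\<^sub>F \<phi> (g c)) =
      (\<Oplus>\<^bsub>F\<^esub>c\<in>insert c C. u (\<alpha> c) \<otimes>\<^sub>F \<phi> (g c))"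
    using insert.hyps 2 c by (subst F.finsum_insert) auto
  finally show ?case .
qed

lemma algebraic_by_dependence:
  assumes x: "x \<in> carrier F" "\<And>c. c \<in> carrier K \<Longrightarrow> x \<noteq> u c"
    and C: "finite C" "C \<subseteq> carrier K" "\<alpha> \<in> C \<rightarrow> carrier K" "\<exists>c\<in>C. \<alpha> c \<noteq> \<zero>\<^bsub>K\<^esub>"
    and eq: "(\<Oplus>\<^bsub>F\<^esub>c\<in>C. u (\<alpha> c) \<otimes>\<^sub>F inv\<^sub>F (x \<ominus>\<^bsub>F\<^esub> u c)) = \<zero>\<^sub>F"
  shows "F.algebraic (kP) x"
proof -
  obtain c0 where c0: "c0 \<in> C" "\<alpha> c0 \<noteq> \<zero>\<^bsub>K\<^esub>" using C(4) by blast
  have nz: "u (\<alpha> c0) \<noteq> \<zero>\<^sub>F"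
  proof
    assume "u (\<alpha> c0) = \<zero>\<^sub>F"
    hence eq0: "u (\<alpha> c0) = u \<zero>\<^bsub>K\<^esub>" by simp
    have "\<alpha> c0 \<in> carrier K" using c0(1) C(3) by auto
    from inj_onD[OF u_inj eq0 this] show False using c0(2) by simp
  qed
  have uC: "u \<in> C \<rightarrow> kP" "(\<lambda>c. u (\<alpha> c)) \<in> C \<rightarrow> kP"
    using C by (auto simp: base_image_eq)
  have "x \<notin> u ` C" using x(2) C(2) by auto
  thus ?thesis
    using F.algebraic_if_partial_fractions_dependent[OF base_subfield C(1) uC(1) inj_on_subset[OF u_inj C(2)] uC(2) c0(1) nz x(1) _ eq]
    by blast
qed

text \<open>For algebraic \<open>x\<close> the ring generated by \<open>x\<close> over the base
  field is a field, so the inverse is a polynomial in \<open>x\<close>. The subrings in question are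
  the image of \<open>R\<close> and a localization of it.\<close>

lemma inverse_in_subring:
  assumes A: "subring A F" "kP \<subseteq> A" and x: "x \<in> A" "x \<noteq> \<zero>\<^sub>F"
    and alg: "F.algebraic (kP) x"
  shows "inv\<^sub>F x \<in> A"
proof -
  have xc: "x \<in> carrier F" using subringE(1)[OF A(1)] x by blast
  have "subfield (F.simple_extension (kP) x) F"
    using F.simple_extension_is_subfield[OF base_subfield xc] alg by (simp add: over_def)
  moreover have "x \<in> F.simple_extension (kP) x"
    by (rule F.simple_extension_mem[OF subfieldE(1)[OF base_subfield] xc])
  ultimately have "inv\<^sub>F x \<in> F.simple_extension (kP) x"
    using F.subfield_m_inv(1) x(2) by blast
  thus ?thesis using F.simple_extension_subring_incl[OF A x(1)] by blast
qed

lemma algebraic_unit: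
  assumes t: "t \<in> carrier R - P" and alg: "F.algebraic (kP) (\<phi> t)"
  shows "\<exists>w\<in>carrier R. t \<otimes> w \<ominus> \<one> \<in> P"
proof -
  have tc: "t \<in> carrier R" using t by simp
  have nz: "\<phi> t \<noteq> \<zero>\<^sub>F" using phi_zero_iff t by simp
  have "inv\<^sub>F (\<phi> t) \<in> \<phi> ` carrier R"
  proof (rule inverse_in_subring)
    show "subring (\<phi> ` carrier R) F" by (rule ring_hom_ring.img_is_subring[OF phi_ring_hom carrier_is_subring])
    show "kP \<subseteq> \<phi> ` carrier R" by (auto simp: base_image_eq)
  qed (use tc nz alg in auto)
  then obtain w where w: "w \<in> carrier R" "inv\<^sub>F (\<phi> t) = \<phi> w" by blast
  have "\<phi> t \<otimes>\<^sub>F \<phi> w = \<one>\<^sub>F" using w(2) nz tc F.field_Units by (metis F.Units_r_inv phi.hom_closed DiffI singletonD)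
  hence "\<phi> (t \<otimes> w) = \<phi> \<one>" using w tc by simp
  thus ?thesis using phi_eq_iff[of "t \<otimes> w" \<one>] w tc by auto
qed

text \<open>Each \<open>t - c\<close> outside \<open>P\<close> has a multiple in \<open>S\<close>
  modulo \<open>P\<close>, so 1/(t - c) is a fraction \<open>g c / s c\<close> with denominator in
  \<open>S\<close>. Fixing the denominator by pigeonhole makes infinitely many of these fractions
  dependent, so \<open>t\<close> is algebraic modulo \<open>P\<close>, hence invertible
  there.\<close>

lemma maximal_if_small_multiplicative_set:
  assumes B: "infinite B" and S: "S \<subseteq> carrier R - P" "|S| <o |carrier K|"
    and meets: "\<And>L. ideal L R \<Longrightarrow> P \<subset> L \<Longrightarrow> L \<inter> S \<noteq> {}"
  shows "maximalideal P R"
proof (rule maximalideal_by_units[OF prime_P])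
  fix t assume t: "t \<in> carrier R - P"
  have tc: "t \<in> carrier R" using t by simp
  have "F.algebraic (kP) (\<phi> t)"
  \<comment> \<open>If the image of \<open>t\<close> is a scalar it is algebraic at once; otherwise
    no \<open>t - c\<close> vanishes modulo \<open>P\<close> and all the fractions exist.\<close>
  proof (cases "\<exists>c\<in>carrier K. \<phi> t = u c")
    case True
    thus ?thesis using F.algebraic_self[OF subfieldE(1)[OF base_subfield]] by (auto simp: over_def base_image_eq)
  next
    case False
    have ex: "\<exists>s\<in>S. \<exists>g\<in>carrier R. \<phi> s = \<phi> g \<otimes>\<^sub>F (\<phi> t \<ominus>\<^bsub>F\<^esub> u c)" if c: "c \<in> carrier K" for c
    proof -
      let ?t = "t \<ominus> c \<odot> \<one>"
      have tc': "?t \<in> carrier R" using tc c by simp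
      have "?t \<notin> P" using False c tc phi_eq_iff[of t "c \<odot> \<one>"] by auto
      hence "P \<subset> adjoin R P ?t" using adjoin_facts(2,3)[OF ideal_P tc'] by blast
      hence "adjoin R P ?t \<inter> S \<noteq> {}" using meets adjoin_facts(1)[OF ideal_P tc'] by blast
      then obtain n g where n: "n \<in> P" "g \<in> carrier R" "n \<oplus> g \<otimes> ?t \<in> S" by (auto simp: adjoin_def)
      have nc: "n \<in> carrier R" using n ideal_facts(1)[OF ideal_P] by blast
      have "\<phi> (n \<oplus> g \<otimes> ?t) = \<phi> g \<otimes>\<^sub>F (\<phi> t \<ominus>\<^bsub>F\<^esub> u c)"
        using nc n(2) tc' tc c phi_zero_iff[OF nc] n(1) by (simp add: phi_minus)
      thus ?thesis using n by blast
    qed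
    obtain s g where sg: "\<And>c. c \<in> carrier K \<Longrightarrow> s c \<in> S" "\<And>c. c \<in> carrier K \<Longrightarrow> g c \<in> carrier R"
      "\<And>c. c \<in> carrier K \<Longrightarrow> \<phi> (s c) = \<phi> (g c) \<otimes>\<^sub>F (\<phi> t \<ominus>\<^bsub>F\<^esub> u c)"
      using ex by metis
    have "\<exists>C \<alpha> s0. finite C \<and> C \<subseteq> carrier K \<and> (\<forall>c\<in>C. s c = s0) \<and> \<alpha> \<in> C \<rightarrow> carrier K \<and>
      (\<exists>c\<in>C. \<alpha> c \<noteq> \<zero>\<^bsub>K\<^esub>) \<and> (\<Oplus>c\<in>C. \<alpha> c \<odot> g c) = \<zero>"
      by (rule scalar_family_dependent[OF _ S(2)]) (use B sg in auto)
    then obtain C \<alpha> s0 where C: "finite C" "C \<subseteq> carrier K" and s0: "\<forall>c\<in>C. s c = s0"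
      and \<alpha>: "\<alpha> \<in> C \<rightarrow> carrier K" "\<exists>c\<in>C. \<alpha> c \<noteq> \<zero>\<^bsub>K\<^esub>" and eq: "(\<Oplus>c\<in>C. \<alpha> c \<odot> g c) = \<zero>"
      by (elim exE conjE)
    obtain c1 where c1: "c1 \<in> C" using \<alpha>(2) by blast
    have s0S: "s0 \<in> S" using sg(1)[OF subsetD[OF C(2) c1]] bspec[OF s0 c1] by simp
    have s0c: "\<phi> s0 \<in> carrier F" using s0S S(1) by auto
    have s0n: "\<phi> s0 \<noteq> \<zero>\<^sub>F" using s0S S(1) phi_zero_iff by auto
    have is0: "inv\<^sub>F (\<phi> s0) \<in> carrier F" "\<phi> s0 \<otimes>\<^sub>F inv\<^sub>F (\<phi> s0) = \<one>\<^sub>F" using s0c s0n F.field_Units by auto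
    have iv: "inv\<^sub>F (\<phi> t \<ominus>\<^bsub>F\<^esub> u c) = \<phi> (g c) \<otimes>\<^sub>F inv\<^sub>F (\<phi> s0)" if c: "c \<in> C" for c
    proof (rule F.comm_inv_char)
      have cK: "c \<in> carrier K" using c C by blast
      show "\<phi> t \<ominus>\<^bsub>F\<^esub> u c \<in> carrier F" using tc cK by simp
      show "\<phi> (g c) \<otimes>\<^sub>F inv\<^sub>F (\<phi> s0) \<in> carrier F" using sg(2)[OF cK] is0 by simp
      have "(\<phi> t \<ominus>\<^bsub>F\<^esub> u c) \<otimes>\<^sub>F (\<phi> (g c) \<otimes>\<^sub>F inv\<^sub>F (\<phi> s0)) = (\<phi> (g c) \<otimes>\<^sub>F (\<phi> t \<ominus>\<^bsub>F\<^esub> u c)) \<otimes>\<^sub>F inv\<^sub>F (\<phi> s0)"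
        using sg(2)[OF cK] is0(1) tc cK by (simp add: F.m_ac)
      also have "\<dots> = \<one>\<^sub>F" using sg(3)[OF cK] s0 c is0(2) by simp
      finally show "(\<phi> t \<ominus>\<^bsub>F\<^esub> u c) \<otimes>\<^sub>F (\<phi> (g c) \<otimes>\<^sub>F inv\<^sub>F (\<phi> s0)) = \<one>\<^sub>F" .
    qed
    have gC: "g \<in> C \<rightarrow> carrier R" using sg(2) C(2) by auto
    have ug: "(\<lambda>c. u (\<alpha> c) \<otimes>\<^sub>F \<phi> (g c)) \<in> C \<rightarrow> carrier F" using \<alpha>(1) gC by auto
    \<comment> \<open>All denominators being \<open>s0\<close>, the relation among the numerators
      \<open>g c\<close> is divided by it.\<close>
    have "(\<Oplus>\<^bsub>F\<^esub>c\<in>C. u (\<alpha> c) \<otimes>\<^sub>F inv\<^sub>F (\<phi> t \<ominus>\<^bsub>F\<^esub> u c)) = (\<Oplus>\<^bsub>F\<^esub>c\<in>C. (u (\<alpha> c) \<otimes>\<^sub>F \<phi> (g c)) \<otimes>\<^sub>F inv\<^sub>F (\<phi> s0))"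
      using iv \<alpha>(1) gC is0(1) by (intro F.finsum_cong') (auto simp: F.m_assoc Pi_iff)
    also have "\<dots> = (\<Oplus>\<^bsub>F\<^esub>c\<in>C. u (\<alpha> c) \<otimes>\<^sub>F \<phi> (g c)) \<otimes>\<^sub>F inv\<^sub>F (\<phi> s0)"
      using F.finsum_ldistr[OF C(1) is0(1) ug] by simp
    also have "(\<Oplus>\<^bsub>F\<^esub>c\<in>C. u (\<alpha> c) \<otimes>\<^sub>F \<phi> (g c)) = \<zero>\<^sub>F"
      unfolding phi_lincomb[OF C(1) \<alpha>(1) gC, symmetric] eq by simp
    also have "\<zero>\<^sub>F \<otimes>\<^sub>F inv\<^sub>F (\<phi> s0) = \<zero>\<^sub>F" using is0(1) by simp
    finally show ?thesis using algebraic_by_dependence[OF _ _ C \<alpha>] False tc by auto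
  qed
  thus "\<exists>w\<in>carrier R. t \<otimes> w \<ominus> \<one> \<in> P" by (rule algebraic_unit[OF t])
qed

end

section \<open>Constants of the fraction field at a \<Delta>-prime\<close>

locale delta_prime_point = prime_point +
  assumes delta_P: "delta_ideal R \<Delta> P"
begin

abbreviation "D \<delta> \<equiv> frac_der (R Quot P) (quot_der R P \<delta>)"
abbreviation "Z \<equiv> frac_const R \<Delta> P"

lemma D_ring_der:
  assumes "\<delta> \<in> \<Delta>" shows "D \<delta> \<in> ring_der F"
proof -
  have "\<Delta> \<subseteq> ring_der R" using derivation by blast
  thus ?thesis
    by (rule domain.frac_der_unique_extension(1)[OF primeideal.quotient_is_domain[OF prime_P]
      quot_der_induced(2)[OF delta_P _ assms]])
qed

lemma D_phi:
  assumes d: "\<delta> \<in> \<Delta>" and r: "r \<in> carrier R"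
  shows "D \<delta> (\<phi> r) = \<phi> (\<delta> r)"
proof -
  have sub: "\<Delta> \<subseteq> ring_der R" using derivation by blast
  have c: "P +> r \<in> carrier (R Quot P)" using r by (simp add: primeideal.quot_carrier[OF prime_P])
  have "D \<delta> (\<phi> r) = fraction (R Quot P) (quot_der R P \<delta> (P +> r)) \<one>\<^bsub>R Quot P\<^esub>"
    unfolding frac_map_def
    by (rule domain.frac_der_unique_extension(2)[OF primeideal.quotient_is_domain[OF prime_P]
      quot_der_induced(2)[OF delta_P sub d] c])
  thus ?thesis using quot_der_induced(1)[OF delta_P sub d r] by (simp add: frac_map_def)
qed

lemma D_closed: "\<delta> \<in> \<Delta> \<Longrightarrow> x \<in> carrier F \<Longrightarrow> D \<delta> x \<in> carrier F"
  and D_add: "\<delta> \<in> \<Delta> \<Longrightarrow> x \<in> carrier F \<Longrightarrow> y \<in> carrier F \<Longrightarrow> D \<delta> (x \<oplus>\<^bsub>F\<^esub> y) = D \<delta> x \<oplus>\<^bsub>F\<^esub> D \<delta> y"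
  and D_mult: "\<delta> \<in> \<Delta> \<Longrightarrow> x \<in> carrier F \<Longrightarrow> y \<in> carrier F \<Longrightarrow>
    D \<delta> (x \<otimes>\<^sub>F y) = D \<delta> x \<otimes>\<^sub>F y \<oplus>\<^bsub>F\<^esub> x \<otimes>\<^sub>F D \<delta> y"
  using D_ring_der[of \<delta>] unfolding ring_der_def by blast+

lemma constI: "x \<in> carrier F \<Longrightarrow> (\<And>\<delta>. \<delta> \<in> \<Delta> \<Longrightarrow> D \<delta> x = \<zero>\<^sub>F) \<Longrightarrow> x \<in> Z"
  by (simp add: frac_const_def)

lemma constD: "x \<in> Z \<Longrightarrow> x \<in> carrier F" "x \<in> Z \<Longrightarrow> \<delta> \<in> \<Delta> \<Longrightarrow> D \<delta> x = \<zero>\<^sub>F"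
  by (auto simp: frac_const_def)

lemma const_mult_right:
  assumes "\<delta> \<in> \<Delta>" "y \<in> carrier F" "x \<in> Z"
  shows "D \<delta> (y \<otimes>\<^sub>F x) = D \<delta> y \<otimes>\<^sub>F x"
  using D_mult[OF assms(1,2) constD(1)[OF assms(3)]] constD[OF assms(3)] D_closed[OF assms(1,2)] assms by simp

lemma const_subfield: "subfield Z F"
proof (rule F.subfieldI')
  have one: "D \<delta> \<one>\<^sub>F = \<zero>\<^sub>F" if "\<delta> \<in> \<Delta>" for \<delta>
    using D_phi[OF that one_closed] der_one[OF that] by simp
  have oneZ: "\<one>\<^sub>F \<in> Z" using one by (intro constI) auto
  have mult: "x \<otimes>\<^sub>F y \<in> Z" if "x \<in> Z" "y \<in> Z" for x y
  proof (rule constI)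
    fix \<delta> assume d: "\<delta> \<in> \<Delta>"
    show "D \<delta> (x \<otimes>\<^sub>F y) = \<zero>\<^sub>F"
      using const_mult_right[OF d constD(1)[OF that(1)] that(2)] constD(2)[OF that(1) d] constD(1)[OF that(2)] by simp
  qed (use constD(1) that in simp)
  have "\<ominus>\<^bsub>F\<^esub> \<one>\<^sub>F \<in> Z"
  proof (rule constI)
    fix \<delta> assume d: "\<delta> \<in> \<Delta>"
    have "D \<delta> \<zero>\<^sub>F = \<zero>\<^sub>F" using D_phi[OF d zero_closed] der_zero[OF d] by simp
    moreover have "D \<delta> (\<one>\<^sub>F \<oplus>\<^bsub>F\<^esub> \<ominus>\<^bsub>F\<^esub> \<one>\<^sub>F) = D \<delta> (\<ominus>\<^bsub>F\<^esub> \<one>\<^sub>F)"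
      using D_add[OF d, of "\<one>\<^sub>F" "\<ominus>\<^bsub>F\<^esub> \<one>\<^sub>F"] one[OF d] D_closed[OF d, of "\<ominus>\<^bsub>F\<^esub> \<one>\<^sub>F"] by simp
    ultimately show "D \<delta> (\<ominus>\<^bsub>F\<^esub> \<one>\<^sub>F) = \<zero>\<^sub>F" by (simp add: F.r_neg)
  qed simp
  note neg1 = this
  show "subring Z F"
  proof (rule F.subringI)
    show "Z \<subseteq> carrier F" using constD(1) by blast
    show "\<one>\<^sub>F \<in> Z" by (rule oneZ)
    show "x \<otimes>\<^sub>F y \<in> Z" if "x \<in> Z" "y \<in> Z" for x y using mult that .
    show "\<ominus>\<^bsub>F\<^esub> x \<in> Z" if "x \<in> Z" for x
      using mult[OF neg1 that] constD(1)[OF that] by (simp add: F.l_minus)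
    show "x \<oplus>\<^bsub>F\<^esub> y \<in> Z" if "x \<in> Z" "y \<in> Z" for x y
      using that constD D_add by (intro constI) auto
  qed
  fix x assume x: "x \<in> Z - {\<zero>\<^sub>F}"
  have xc: "x \<in> carrier F" using x constD by blast
  have i: "inv\<^sub>F x \<in> carrier F" "inv\<^sub>F x \<otimes>\<^sub>F x = \<one>\<^sub>F" using x xc F.field_Units by auto
  show "inv\<^sub>F x \<in> Z"
  proof (rule constI[OF i(1)])
    fix \<delta> assume d: "\<delta> \<in> \<Delta>"
    \<comment> \<open>Multiplying by the constant \<open>x\<close> commutes with the derivation, and
      the product is one.\<close>
    have "D \<delta> (inv\<^sub>F x) \<otimes>\<^sub>F x = \<zero>\<^sub>F"
      using const_mult_right[OF d i(1), of x] x one[OF d] i(2) by simp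
    thus "D \<delta> (inv\<^sub>F x) = \<zero>\<^sub>F" using F.integral D_closed[OF d i(1)] xc x by blast
  qed
qed

lemma base_const: "kP \<subseteq> Z"
proof
  fix x assume "x \<in> kP"
  then obtain c where c: "c \<in> carrier K" "x = u c" by (auto simp: base_image_eq)
  have "D \<delta> (u c) = \<zero>\<^sub>F" if "\<delta> \<in> \<Delta>" for \<delta>
    using D_phi[OF that, of "c \<odot> \<one>"] der_smult[OF that c(1) one_closed] der_one[OF that] c by simp
  thus "x \<in> Z" using c by (intro constI) auto
qed

text \<open>The ideal of denominators of a constant is a \<open>\<Delta>\<close>-ideal.\<close>

lemma ex_denominator:
  assumes x: "x \<in> Z" and M: "ideal M R" "P = core M"
  shows "\<exists>d\<in>carrier R - M. \<exists>e\<in>carrier R. \<phi> d \<otimes>\<^sub>F x = \<phi> e"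
proof (rule ccontr)
  assume no: "\<not> ?thesis"
  let ?I = "{d \<in> carrier R. \<exists>e\<in>carrier R. \<phi> d \<otimes>\<^sub>F x = \<phi> e}"
  have xc: "x \<in> carrier F" by (rule constD(1)[OF x])
  have Iid: "ideal ?I R"
  proof (rule ideal_cringI)
    show "?I \<subseteq> carrier R" by blast
    have "\<phi> \<zero> \<otimes>\<^sub>F x = \<phi> \<zero>" using xc by simp
    thus "\<zero> \<in> ?I" by blast
  next
    fix d d' assume "d \<in> ?I" "d' \<in> ?I"
    then obtain e e' where e: "d \<in> carrier R" "d' \<in> carrier R" "e \<in> carrier R" "e' \<in> carrier R"
      "\<phi> d \<otimes>\<^sub>F x = \<phi> e" "\<phi> d' \<otimes>\<^sub>F x = \<phi> e'" by blast
    have "\<phi> (d \<oplus> d') \<otimes>\<^sub>F x = \<phi> (e \<oplus> e')" using e xc by (simp add: F.l_distr)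
    moreover have "d \<oplus> d' \<in> carrier R" "e \<oplus> e' \<in> carrier R" using e by auto
    ultimately show "d \<oplus> d' \<in> ?I" by blast
  next
    fix r d assume r: "r \<in> carrier R" and "d \<in> ?I"
    then obtain e where e: "d \<in> carrier R" "e \<in> carrier R" "\<phi> d \<otimes>\<^sub>F x = \<phi> e" by blast
    have "\<phi> (r \<otimes> d) \<otimes>\<^sub>F x = \<phi> (r \<otimes> e)" using e xc r by (simp add: F.m_assoc)
    moreover have "r \<otimes> d \<in> carrier R" "r \<otimes> e \<in> carrier R" using e r by auto
    ultimately show "r \<otimes> d \<in> ?I" by blast
  qed
  have "Dideal ?I"
  proof (rule delta_idealI[OF Iid])
    fix \<delta> d assume dl: "\<delta> \<in> \<Delta>" and "d \<in> ?I"
    then obtain e where e: "d \<in> carrier R" "e \<in> carrier R" "\<phi> d \<otimes>\<^sub>F x = \<phi> e" by blast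
    \<comment> \<open>Since \<open>x\<close> is constant, differentiating \<open>d x = e\<close>
      moves the derivation onto \<open>d\<close> and \<open>e\<close>, so the derivative of
      \<open>d\<close> is again a denominator.\<close>
    have "\<phi> (\<delta> d) \<otimes>\<^sub>F x = D \<delta> (\<phi> d \<otimes>\<^sub>F x)"
      using const_mult_right[OF dl _ x, of "\<phi> d"] D_phi[OF dl e(1)] e(1) by simp
    also have "\<dots> = \<phi> (\<delta> e)" using D_phi[OF dl e(2)] e(3) by simp
    finally have "\<phi> (\<delta> d) \<otimes>\<^sub>F x = \<phi> (\<delta> e)" .
    thus "\<delta> d \<in> ?I" using der_closed[OF dl e(1)] der_closed[OF dl e(2)] by blast
  qed
  moreover have "?I \<subseteq> M" using no by blast
  \<comment> \<open>A \<Delta>-ideal inside \<open>M\<close> lies in its core \<open>P\<close>, yet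
    every element of the fraction field has some denominator outside \<open>P\<close>.\<close>
  ultimately have "?I \<subseteq> P" using delta_core_facts(3)[OF M(1)] M(2) by blast
  moreover obtain a b where "a \<in> carrier R" "b \<in> carrier R - P" "\<phi> b \<otimes>\<^sub>F x = \<phi> a"
    using phi_quotient[OF xc] by blast
  ultimately show False by blast
qed

end

lemma (in ring) subring_finsum_closed:
  assumes A: "subring A R" and "finite C" "f \<in> C \<rightarrow> A"
  shows "(\<Oplus>c\<in>C. f c) \<in> A"
  using assms(2,3)
proof (induction C)
  case empty
  show ?case using subringE(2)[OF A] by simp
next
  case (insert c C)
  have "f \<in> insert c C \<rightarrow> carrier R" using insert.prems subringE(1)[OF A] by blast
  hence "(\<Oplus>c\<in>insert c C. f c) = f c \<oplus> (\<Oplus>c\<in>C. f c)" using insert.hyps by (intro finsum_insert) auto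
  thus ?case using insert subringE(7)[OF A] by auto
qed

section \<open>The residue map on constants: primitive implies rational\<close>

context delta_prime_point
begin

text \<open>For a prime \<open>M\<close> containing \<open>P\<close>, this says that
  \<open>y\<close> lies in the local ring of \<open>R/P\<close> at \<open>M\<close> and has the same
  residue there as \<open>g\<close>. Taking the residue map as a relation with values in
  \<open>R\<close> lets linear dependence be tested in \<open>R\<close> itself.\<close>

definition near :: "'a set \<Rightarrow> ('a set \<times> 'a set) set \<Rightarrow> 'a \<Rightarrow> bool" where
  "near M y g \<longleftrightarrow> y \<in> carrier F \<and> g \<in> carrier R \<and>
    (\<exists>d\<in>carrier R - M. \<exists>e\<in>M. \<phi> d \<otimes>\<^sub>F (y \<ominus>\<^bsub>F\<^esub> \<phi> g) = \<phi> e)"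

lemma near_zero: "primeideal M R \<Longrightarrow> near M \<zero>\<^sub>F \<zero>"
  using prime_one_notin[of M] ideal_facts(2)[OF primeideal.axioms(1)]
  unfolding near_def by (intro conjI bexI[of _ \<one>] bexI[of _ \<zero>]) (auto simp: F.minus_eq)

lemma near_add:
  assumes M: "primeideal M R" and 1: "near M y g" and 2: "near M z h"
  shows "near M (y \<oplus>\<^bsub>F\<^esub> z) (g \<oplus> h)"
proof -
  note F = ideal_facts[OF primeideal.axioms(1)[OF M]]
  obtain d e where d: "d \<in> carrier R - M" "e \<in> M" "\<phi> d \<otimes>\<^sub>F (y \<ominus>\<^bsub>F\<^esub> \<phi> g) = \<phi> e"
    using 1 by (auto simp: near_def)
  obtain d' e' where d': "d' \<in> carrier R - M" "e' \<in> M" "\<phi> d' \<otimes>\<^sub>F (z \<ominus>\<^bsub>F\<^esub> \<phi> h) = \<phi> e'"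
    using 2 by (auto simp: near_def)
  have c: "y \<in> carrier F" "z \<in> carrier F" "g \<in> carrier R" "h \<in> carrier R" "e \<in> carrier R" "e' \<in> carrier R"
    "d \<in> carrier R" "d' \<in> carrier R"
    using 1 2 d d' F(1) by (auto simp: near_def)
  define p q where "p = \<phi> d" and "q = \<phi> d'"
  have pq: "p \<in> carrier F" "q \<in> carrier F" "\<phi> g \<in> carrier F" "\<phi> h \<in> carrier F" using c by (auto simp: p_def q_def)
  have "p \<otimes>\<^sub>F q \<otimes>\<^sub>F (y \<oplus>\<^bsub>F\<^esub> z \<ominus>\<^bsub>F\<^esub> (\<phi> g \<oplus>\<^bsub>F\<^esub> \<phi> h)) =
      q \<otimes>\<^sub>F (p \<otimes>\<^sub>F (y \<ominus>\<^bsub>F\<^esub> \<phi> g)) \<oplus>\<^bsub>F\<^esub> p \<otimes>\<^sub>F (q \<otimes>\<^sub>F (z \<ominus>\<^bsub>F\<^esub> \<phi> h))"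
    using c(1,2) pq by algebra
  also have "\<dots> = \<phi> (d' \<otimes> e \<oplus> d \<otimes> e')" using d(3) d'(3) c by (simp add: p_def q_def)
  finally have "\<phi> (d \<otimes> d') \<otimes>\<^sub>F (y \<oplus>\<^bsub>F\<^esub> z \<ominus>\<^bsub>F\<^esub> \<phi> (g \<oplus> h)) = \<phi> (d' \<otimes> e \<oplus> d \<otimes> e')"
    using c by (simp add: p_def q_def)
  moreover have "d' \<otimes> e \<oplus> d \<otimes> e' \<in> M" using F(3,5) d(2) d'(2) c by simp
  ultimately show ?thesis
    unfolding near_def using prime_mult_notin[OF M d(1) d'(1)] c by blast
qed

lemma near_smult:
  assumes M: "primeideal M R" and 1: "near M y g" and a: "a \<in> carrier K"
  shows "near M (u a \<otimes>\<^sub>F y) (a \<odot> g)"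
proof -
  note I = primeideal.axioms(1)[OF M]
  obtain d e where d: "d \<in> carrier R - M" "e \<in> M" "\<phi> d \<otimes>\<^sub>F (y \<ominus>\<^bsub>F\<^esub> \<phi> g) = \<phi> e"
    using 1 by (auto simp: near_def)
  have c: "y \<in> carrier F" "g \<in> carrier R" "e \<in> carrier R" "d \<in> carrier R"
    using 1 d ideal_facts(1)[OF I] by (auto simp: near_def)
  define p b where "p = \<phi> d" and "b = u a"
  have pq: "p \<in> carrier F" "b \<in> carrier F" "\<phi> g \<in> carrier F" using c a by (auto simp: p_def b_def)
  have "p \<otimes>\<^sub>F (b \<otimes>\<^sub>F y \<ominus>\<^bsub>F\<^esub> b \<otimes>\<^sub>F \<phi> g) = b \<otimes>\<^sub>F (p \<otimes>\<^sub>F (y \<ominus>\<^bsub>F\<^esub> \<phi> g))"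
    using c(1) pq by algebra
  hence "\<phi> d \<otimes>\<^sub>F (u a \<otimes>\<^sub>F y \<ominus>\<^bsub>F\<^esub> \<phi> (a \<odot> g)) = \<phi> (a \<odot> e)"
    using d(3) c a smult_eq_mult[OF a c(2)] smult_eq_mult[OF a c(3)] by (simp add: p_def b_def)
  thus ?thesis unfolding near_def using d(1) smult_ideal[OF I a d(2)] c a by auto
qed

lemma near_lincomb:
  assumes M: "primeideal M R" and "finite C" "\<alpha> \<in> C \<rightarrow> carrier K" "\<And>c. c \<in> C \<Longrightarrow> near M (y c) (g c)"
  shows "near M (\<Oplus>\<^bsub>F\<^esub>c\<in>C. u (\<alpha> c) \<otimes>\<^sub>F y c) (\<Oplus>c\<in>C. \<alpha> c \<odot> g c)"
  using assms(2-4)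
proof (induction C)
  case empty
  show ?case using near_zero[OF M] by simp
next
  case (insert c C)
  have yg: "y b \<in> carrier F" "g b \<in> carrier R" if "b \<in> insert c C" for b
    using insert.prems(2)[OF that] by (auto simp: near_def)
  have \<alpha>: "\<alpha> b \<in> carrier K" if "b \<in> insert c C" for b using insert.prems(1) that by blast
  have "(\<Oplus>\<^bsub>F\<^esub>c\<in>insert c C. u (\<alpha> c) \<otimes>\<^sub>F y c) = u (\<alpha> c) \<otimes>\<^sub>F y c \<oplus>\<^bsub>F\<^esub> (\<Oplus>\<^bsub>F\<^esub>c\<in>C. u (\<alpha> c) \<otimes>\<^sub>F y c)"
    using insert.hyps \<alpha> yg by (intro F.finsum_insert) auto
  moreover have "(\<Oplus>c\<in>insert c C. \<alpha> c \<odot> g c) = \<alpha> c \<odot> g c \<oplus> (\<Oplus>c\<in>C. \<alpha> c \<odot> g c)"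
    using insert.hyps \<alpha> yg by (intro finsum_insert) auto
  moreover have "near M (\<Oplus>\<^bsub>F\<^esub>c\<in>C. u (\<alpha> c) \<otimes>\<^sub>F y c) (\<Oplus>c\<in>C. \<alpha> c \<odot> g c)"
    using insert by auto
  moreover have "near M (u (\<alpha> c) \<otimes>\<^sub>F y c) (\<alpha> c \<odot> g c)"
    using near_smult[OF M] insert.prems by auto
  ultimately show ?case using near_add[OF M] by simp
qed

text \<open>Write \<open>y = e/d\<close> with \<open>d\<close> outside \<open>M\<close>. An inverse
  \<open>w\<close> of \<open>d\<close> modulo \<open>M\<close> gives the representative
  \<open>e w\<close>.\<close>

lemma const_near:
  assumes M: "maximalideal M R" "P = core M" and y: "y \<in> Z"
  shows "\<exists>g. near M y g"
proof -
  have Mid: "ideal M R" using M(1) by (rule maximalideal.axioms)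
  obtain d e where d: "d \<in> carrier R - M" and e: "e \<in> carrier R" "\<phi> d \<otimes>\<^sub>F y = \<phi> e"
    using ex_denominator[OF y Mid M(2)] by blast
  obtain w where w: "w \<in> carrier R" "\<one> \<ominus> d \<otimes> w \<in> M" using maximalideal_inverse[OF M(1) d] by blast
  have dc: "d \<in> carrier R" and yc: "y \<in> carrier F" using d constD(1)[OF y] by auto
  have "\<phi> d \<otimes>\<^sub>F (y \<ominus>\<^bsub>F\<^esub> \<phi> (e \<otimes> w)) = \<phi> d \<otimes>\<^sub>F y \<ominus>\<^bsub>F\<^esub> \<phi> d \<otimes>\<^sub>F \<phi> (e \<otimes> w)"
    using yc dc e(1) w(1) by (simp add: F.minus_eq F.r_distr F.r_minus)
  also have "\<dots> = \<phi> (e \<ominus> d \<otimes> (e \<otimes> w))" unfolding e(2) using dc e(1) w(1) by (simp add: phi_minus)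
  also have "e \<ominus> d \<otimes> (e \<otimes> w) = e \<otimes> (\<one> \<ominus> d \<otimes> w)" using dc e(1) w(1) by algebra
  finally have "\<phi> d \<otimes>\<^sub>F (y \<ominus>\<^bsub>F\<^esub> \<phi> (e \<otimes> w)) = \<phi> (e \<otimes> (\<one> \<ominus> d \<otimes> w))" .
  moreover have "e \<otimes> (\<one> \<ominus> d \<otimes> w) \<in> M" using ideal_facts(5)[OF Mid e(1) w(2)] .
  ultimately show ?thesis
    unfolding near_def using d e(1) w(1) yc by (intro exI[of _ "e \<otimes> w"]) blast
qed

text \<open>The residue map is injective on the field of constants: for nonzero \<open>y\<close> the
  inverse is also a constant and has a denominator \<open>z\<close> outside \<open>M\<close>. If
  \<open>y\<close> had residue zero, this would put \<open>d z\<close> into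
  \<open>M\<close>.\<close>

lemma const_near_zero:
  assumes M: "maximalideal M R" "P = core M" and y: "y \<in> Z" "near M y \<zero>"
  shows "y = \<zero>\<^sub>F"
proof (rule ccontr)
  assume ne: "y \<noteq> \<zero>\<^sub>F"
  have Mid: "ideal M R" using M(1) by (rule maximalideal.axioms)
  have yc: "y \<in> carrier F" using constD(1)[OF y(1)] .
  obtain d e where d: "d \<in> carrier R - M" and e: "e \<in> M" "\<phi> d \<otimes>\<^sub>F (y \<ominus>\<^bsub>F\<^esub> \<phi> \<zero>) = \<phi> e"
    using y(2) by (auto simp: near_def)
  have de: "\<phi> d \<otimes>\<^sub>F y = \<phi> e" using e(2) yc by (simp add: F.minus_eq)
  have "inv\<^sub>F y \<in> Z" using F.subfield_m_inv(1)[OF const_subfield] ne y(1) by blast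
  then obtain z w where z: "z \<in> carrier R - M" and w: "w \<in> carrier R" "\<phi> z \<otimes>\<^sub>F inv\<^sub>F y = \<phi> w"
    using ex_denominator[OF _ Mid M(2)] by blast
  have c: "d \<in> carrier R" "z \<in> carrier R" "e \<in> carrier R" using d z e ideal_facts(1)[OF Mid] by auto
  have i: "inv\<^sub>F y \<in> carrier F" "inv\<^sub>F y \<otimes>\<^sub>F y = \<one>\<^sub>F" using yc ne F.field_Units by auto
  have "\<phi> (d \<otimes> z) = \<phi> d \<otimes>\<^sub>F (\<phi> z \<otimes>\<^sub>F (inv\<^sub>F y \<otimes>\<^sub>F y))" using c i(2) by simp
  also have "\<dots> = (\<phi> z \<otimes>\<^sub>F inv\<^sub>F y) \<otimes>\<^sub>F (\<phi> d \<otimes>\<^sub>F y)" using c i(1) yc by (simp add: F.m_ac)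
  also have "\<dots> = \<phi> (w \<otimes> e)" using w c by (simp add: de)
  finally have eq: "\<phi> (d \<otimes> z) = \<phi> (w \<otimes> e)" .
  have dwe: "d \<otimes> z \<ominus> w \<otimes> e \<in> P"
    using iffD1[OF phi_eq_iff eq] c w(1) by simp
  have "P \<subseteq> M" using delta_core_facts(2)[OF Mid] M(2) by simp
  hence "d \<otimes> z \<ominus> w \<otimes> e \<in> M" using dwe by blast
  hence "(d \<otimes> z \<ominus> w \<otimes> e) \<oplus> w \<otimes> e \<in> M" using ideal_facts(3,5)[OF Mid] e(1) w(1) by simp
  moreover have "(d \<otimes> z \<ominus> w \<otimes> e) \<oplus> w \<otimes> e = d \<otimes> z" using c w(1) by algebra
  ultimately show False using prime_mult_notin[OF maximalideal_prime[OF M(1)] d z] by simp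
qed

text \<open>The fractions 1/(x - c) are constants and have representatives \<open>g c\<close> in
  \<open>R\<close>. A relation among the \<open>g c\<close> says that the corresponding combination
  of fractions has residue zero, and a constant with residue zero vanishes.\<close>

theorem primitive_const_algebraic:
  assumes M: "maximalideal M R" "P = core M" and x: "x \<in> Z"
  shows "F.algebraic (kP) x"
proof (cases "\<exists>c\<in>carrier K. x = u c")
  case True
  thus ?thesis using F.algebraic_self[OF subfieldE(1)[OF base_subfield]] by (auto simp: over_def base_image_eq)
next
  case False
  have Mp: "primeideal M R" by (rule maximalideal_prime[OF M(1)])
  have Zs: "subring Z F" by (rule subfieldE(1)[OF const_subfield])
  have uZ: "u c \<in> Z" if "c \<in> carrier K" for c using base_const that by (auto simp: base_image_eq)
  define y where "y c = inv\<^sub>F (x \<ominus>\<^bsub>F\<^esub> u c)" for c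
  have xc: "x \<in> carrier F" using constD(1)[OF x] .
  have yZ: "y c \<in> Z" if c: "c \<in> carrier K" for c
  proof -
    have "x \<ominus>\<^bsub>F\<^esub> u c \<in> Z" using subringE(5,7)[OF Zs] x uZ[OF c] by (simp add: F.minus_eq)
    moreover have "x \<ominus>\<^bsub>F\<^esub> u c \<noteq> \<zero>\<^sub>F" using False xc c by auto
    ultimately show ?thesis using F.subfield_m_inv(1)[OF const_subfield] by (simp add: y_def)
  qed
  have "\<forall>c\<in>carrier K. \<exists>g. near M (y c) g" using const_near[OF M yZ] by blast
  then obtain g where g: "\<And>c. c \<in> carrier K \<Longrightarrow> near M (y c) (g c)" by metis
  \<comment> \<open>No denominators need to be matched here, so the pigeonhole argument runs with a
    single label.\<close>
  have "|{()}| <o |carrier K|" by (rule finite_ordLess_infinite2[OF _ scalars_infinite]) simp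
  hence "\<exists>C \<alpha> s0. finite C \<and> C \<subseteq> carrier K \<and> (\<forall>c\<in>C. (\<lambda>_. ()) c = s0) \<and> \<alpha> \<in> C \<rightarrow> carrier K \<and>
      (\<exists>c\<in>C. \<alpha> c \<noteq> \<zero>\<^bsub>K\<^esub>) \<and> (\<Oplus>c\<in>C. \<alpha> c \<odot> g c) = \<zero>"
    by (intro scalar_family_dependent[of "{()}"]) (use g in \<open>auto simp: near_def\<close>)
  then obtain C \<alpha> where C: "finite C" "C \<subseteq> carrier K"
      and \<alpha>: "\<alpha> \<in> C \<rightarrow> carrier K" "\<exists>c\<in>C. \<alpha> c \<noteq> \<zero>\<^bsub>K\<^esub>" and eq: "(\<Oplus>c\<in>C. \<alpha> c \<odot> g c) = \<zero>"
    by (elim exE conjE)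
  have "near M (\<Oplus>\<^bsub>F\<^esub>c\<in>C. u (\<alpha> c) \<otimes>\<^sub>F y c) \<zero>"
    using near_lincomb[OF Mp C(1) \<alpha>(1), of y g] g C(2) eq by auto
  moreover have "u (\<alpha> c) \<otimes>\<^sub>F y c \<in> Z" if "c \<in> C" for c
  proof -
    have "\<alpha> c \<in> carrier K" "c \<in> carrier K" using \<alpha>(1) C(2) that by auto
    thus ?thesis using subringE(6)[OF Zs uZ yZ] by blast
  qed
  hence "(\<Oplus>\<^bsub>F\<^esub>c\<in>C. u (\<alpha> c) \<otimes>\<^sub>F y c) \<in> Z"
    by (intro F.subring_finsum_closed[OF Zs C(1)]) blast
  ultimately have "(\<Oplus>\<^bsub>F\<^esub>c\<in>C. u (\<alpha> c) \<otimes>\<^sub>F y c) = \<zero>\<^sub>F" using const_near_zero[OF M] by blast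
  thus ?thesis using algebraic_by_dependence[OF xc _ C \<alpha>] False by (auto simp: y_def)
qed

end

text \<open>The numerator of the derivative of \<open>w/v\<close>, that is, \<open>v^2\<close> times
  that derivative.\<close>

definition wronskian :: "('a, 'n) ring_scheme \<Rightarrow> ('a \<Rightarrow> 'a) \<Rightarrow> 'a \<Rightarrow> 'a \<Rightarrow> 'a" where
  "wronskian R \<delta> v w = v \<otimes>\<^bsub>R\<^esub> \<delta> w \<ominus>\<^bsub>R\<^esub> w \<otimes>\<^bsub>R\<^esub> \<delta> v"

section \<open>Wronskians and separating elements: rational implies separable\<close>

context small_diff_algebra
begin

text \<open>Every element of \<open>R\<close> is in the span of finitely many members of
  \<open>G\<close>, and Wronskians of members stay in \<open>G\<close>; this is what the descent on
  the number of spanning elements consumes.\<close>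

abbreviation "G \<equiv> op_closure \<Delta> (wronskian R) B"

lemma wronskian_closed:
  "\<delta> \<in> \<Delta> \<Longrightarrow> v \<in> carrier R \<Longrightarrow> w \<in> carrier R \<Longrightarrow> wronskian R \<delta> v w \<in> carrier R"
  by (simp add: wronskian_def der_closed)

lemma wronskian_add:
  assumes d: "\<delta> \<in> \<Delta>" and c: "v \<in> carrier R" "w \<in> carrier R" "x \<in> carrier R"
  shows "wronskian R \<delta> v (w \<oplus> x) = wronskian R \<delta> v w \<oplus> wronskian R \<delta> v x"
proof -
  have "\<delta> v \<in> carrier R" "\<delta> w \<in> carrier R" "\<delta> x \<in> carrier R" using der_closed d c by auto
  hence "v \<otimes> (\<delta> w \<oplus> \<delta> x) \<ominus> (w \<oplus> x) \<otimes> \<delta> v = v \<otimes> \<delta> w \<ominus> w \<otimes> \<delta> v \<oplus> (v \<otimes> \<delta> x \<ominus> x \<otimes> \<delta> v)"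
    using c by algebra
  thus ?thesis by (simp add: wronskian_def der_add[OF d c(2,3)])
qed

lemma wronskian_smult:
  assumes d: "\<delta> \<in> \<Delta>" and c: "v \<in> carrier R" "w \<in> carrier R" "a \<in> carrier K"
  shows "wronskian R \<delta> v (a \<odot> w) = a \<odot> wronskian R \<delta> v w"
proof -
  define s where "s = a \<odot> \<one>"
  have s: "s \<in> carrier R" using c by (simp add: s_def)
  have dc: "\<delta> v \<in> carrier R" "\<delta> w \<in> carrier R" using der_closed d c by auto
  have "v \<otimes> (s \<otimes> \<delta> w) \<ominus> (s \<otimes> w) \<otimes> \<delta> v = s \<otimes> (v \<otimes> \<delta> w \<ominus> w \<otimes> \<delta> v)"
    using c(1,2) s dc by algebra
  hence "v \<otimes> (a \<odot> \<delta> w) \<ominus> (a \<odot> w) \<otimes> \<delta> v = a \<odot> (v \<otimes> \<delta> w \<ominus> w \<otimes> \<delta> v)"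
    using smult_eq_mult[OF c(3) dc(2)] smult_eq_mult[OF c(3,2)] smult_eq_mult[OF c(3), of "v \<otimes> \<delta> w \<ominus> w \<otimes> \<delta> v"] c dc
    by (simp add: s_def)
  thus ?thesis unfolding wronskian_def der_smult[OF d c(3,2)] .
qed

lemma wronskian_self:
  assumes "\<delta> \<in> \<Delta>" "v \<in> carrier R"
  shows "wronskian R \<delta> v v = \<zero>"
  using assms der_closed[OF assms] by (simp add: wronskian_def minus_eq r_neg)

text \<open>The Wronskian is linear over the scalars in its second argument, so it carries a span to
  the span of the images.\<close>

lemma wronskian_ind_span:
  assumes d: "\<delta> \<in> \<Delta>" and v: "v \<in> carrier R" and T: "T \<subseteq> carrier R" and x: "x \<in> alg.ind_span T"
  shows "wronskian R \<delta> v x \<in> alg.ind_span (wronskian R \<delta> v ` T)"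
  using x
proof induction
  case zero
  have "wronskian R \<delta> v \<zero> = \<zero>"
    using wronskian_smult[OF d v zero_closed, of "\<zero>\<^bsub>K\<^esub>"] wronskian_closed[OF d v zero_closed] by simp
  thus ?case using alg.ind_span.zero by simp
next
  case (step c t x)
  have c: "t \<in> carrier R" "x \<in> carrier R" using step T alg.ind_span_closed[OF T] by auto
  have "wronskian R \<delta> v (c \<odot> t \<oplus> x) = c \<odot> wronskian R \<delta> v t \<oplus> wronskian R \<delta> v x"
    using wronskian_add[OF d v _ c(2), of "c \<odot> t"] wronskian_smult[OF d v c(1) step.hyps(1)] c step.hyps(1) by simp
  thus ?case using alg.ind_span.step[OF step.hyps(1) imageI[OF step.hyps(2)] step.IH] by simp
qed

lemma G_closed: "G \<subseteq> carrier R"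
proof
  fix x assume "x \<in> G"
  thus "x \<in> carrier R" by induction (use spanning(1) wronskian_closed in auto)
qed

end

context delta_prime_point
begin

text \<open>For \<open>x = f/v\<close>, differentiating \<open>v x = f\<close> shows that
  \<open>v^2\<close> times the derivative of \<open>x\<close> is the Wronskian, which vanishes
  modulo \<open>P\<close>.\<close>

lemma const_ratio:
  assumes v: "v \<in> carrier R - P" and f: "f \<in> carrier R"
    and W: "\<And>\<delta>. \<delta> \<in> \<Delta> \<Longrightarrow> wronskian R \<delta> v f \<in> P"
  shows "inv\<^sub>F (\<phi> v) \<otimes>\<^sub>F \<phi> f \<in> Z"
proof (rule constI)
  have vc: "v \<in> carrier R" using v by simp
  have nz: "\<phi> v \<noteq> \<zero>\<^sub>F" using v phi_zero_iff by simp
  define i where "i = inv\<^sub>F (\<phi> v)"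
  define a b where "a = \<phi> v" and "b = \<phi> f"
  have i: "i \<in> carrier F" "a \<otimes>\<^sub>F i = \<one>\<^sub>F" "i \<otimes>\<^sub>F a = \<one>\<^sub>F" and ab: "a \<in> carrier F" "b \<in> carrier F"
    using vc f nz F.field_Units by (auto simp: i_def a_def b_def)
  show "inv\<^sub>F (\<phi> v) \<otimes>\<^sub>F \<phi> f \<in> carrier F" using i(1) ab(2) by (simp add: i_def b_def)
  fix \<delta> assume d: "\<delta> \<in> \<Delta>"
  define x where "x = i \<otimes>\<^sub>F b"
  have x: "x \<in> carrier F" using i ab by (simp add: x_def)
  have ax: "a \<otimes>\<^sub>F x = b" using i ab by (simp add: x_def F.m_assoc[symmetric])
  have Dx: "D \<delta> x \<in> carrier F" by (rule D_closed[OF d x])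
  have Da: "D \<delta> a = \<phi> (\<delta> v)" "D \<delta> b = \<phi> (\<delta> f)" using D_phi[OF d vc] D_phi[OF d f] by (auto simp: a_def b_def)
  have dc: "\<delta> v \<in> carrier R" "\<delta> f \<in> carrier R" using der_closed d vc f by auto
  have cc: "\<phi> (\<delta> v) \<in> carrier F" "\<phi> (\<delta> f) \<in> carrier F" using dc by auto
  have e1: "\<phi> (\<delta> f) = \<phi> (\<delta> v) \<otimes>\<^sub>F x \<oplus>\<^bsub>F\<^esub> a \<otimes>\<^sub>F D \<delta> x"
    using D_mult[OF d ab(1) x] Da ax by simp
  have "\<phi> (wronskian R \<delta> v f) = \<zero>\<^sub>F"
    using phi_zero_iff[OF wronskian_closed[OF d vc f]] W[OF d] by simp
  hence "a \<otimes>\<^sub>F \<phi> (\<delta> f) \<ominus>\<^bsub>F\<^esub> b \<otimes>\<^sub>F \<phi> (\<delta> v) = \<zero>\<^sub>F"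
    using vc f dc by (simp add: wronskian_def phi_minus a_def b_def)
  hence "a \<otimes>\<^sub>F (\<phi> (\<delta> v) \<otimes>\<^sub>F x \<oplus>\<^bsub>F\<^esub> a \<otimes>\<^sub>F D \<delta> x) \<ominus>\<^bsub>F\<^esub> (a \<otimes>\<^sub>F x) \<otimes>\<^sub>F \<phi> (\<delta> v) = \<zero>\<^sub>F"
    using e1 ax by simp
  moreover have "a \<otimes>\<^sub>F (\<phi> (\<delta> v) \<otimes>\<^sub>F x \<oplus>\<^bsub>F\<^esub> a \<otimes>\<^sub>F D \<delta> x) \<ominus>\<^bsub>F\<^esub> (a \<otimes>\<^sub>F x) \<otimes>\<^sub>F \<phi> (\<delta> v) = a \<otimes>\<^sub>F a \<otimes>\<^sub>F D \<delta> x"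
    using ab(1) x Dx cc(1) by algebra
  ultimately have "a \<otimes>\<^sub>F a \<otimes>\<^sub>F D \<delta> x = \<zero>\<^sub>F" by simp
  hence "D \<delta> x = \<zero>\<^sub>F"
    using F.integral[of "a \<otimes>\<^sub>F a" "D \<delta> x"] F.integral[of a a] ab(1) Dx nz by (auto simp: a_def)
  thus "D \<delta> (inv\<^sub>F (\<phi> v) \<otimes>\<^sub>F \<phi> f) = \<zero>\<^sub>F" by (simp add: x_def i_def b_def)
qed

text \<open>If \<open>\<gamma> = f/v\<close> is algebraic then \<open>1/\<gamma>\<close> is a polynomial in \<open>\<gamma>\<close>, so \<open>f\<close> divides a power of \<open>v\<close>.\<close>

lemma algebraic_ratio_mem:
  assumes v: "v \<in> carrier R - P" and f: "f \<in> carrier R - P"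
    and alg: "F.algebraic (kP) (inv\<^sub>F (\<phi> v) \<otimes>\<^sub>F \<phi> f)"
    and Q: "primeideal Q R" "P \<subseteq> Q" "f \<in> Q"
  shows "v \<in> Q"
proof -
  have vc: "v \<in> carrier R" "f \<in> carrier R" using v f by auto
  have Qid: "ideal Q R" using Q(1) by (rule primeideal.axioms)
  define a b i where "a = \<phi> v" and "b = \<phi> f" and "i = inv\<^sub>F (\<phi> v)"
  have nz: "a \<noteq> \<zero>\<^sub>F" "b \<noteq> \<zero>\<^sub>F" using v f phi_zero_iff by (auto simp: a_def b_def)
  have i: "i \<in> carrier F" "a \<otimes>\<^sub>F i = \<one>\<^sub>F" and ab: "a \<in> carrier F" "b \<in> carrier F"
    using vc nz F.field_Units by (auto simp: i_def a_def b_def)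
  let ?x = "i \<otimes>\<^sub>F b"
  have x: "?x \<in> carrier F" using i ab by simp
  have ax: "a \<otimes>\<^sub>F ?x = b" using i ab by (simp add: F.m_assoc[symmetric])
  have xn: "?x \<noteq> \<zero>\<^sub>F" using ax nz ab by auto
  \<comment> \<open>The localization of \<open>R/P\<close> at the powers of \<open>v\<close>, as a
    subring of the fraction field. It contains \<open>f/v\<close>, hence also the inverse
    \<open>v/f\<close>.\<close>
  let ?A = "{y \<in> carrier F. \<exists>m::nat. \<exists>r\<in>carrier R. a [^]\<^bsub>F\<^esub> m \<otimes>\<^sub>F y = \<phi> r}"
  have memI: "y \<in> ?A" if "y \<in> carrier F" "r \<in> carrier R" "a [^]\<^bsub>F\<^esub> (m::nat) \<otimes>\<^sub>F y = \<phi> r" for y r m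
    using that by blast
  have pw: "\<phi> (v [^] (m::nat)) = a [^]\<^bsub>F\<^esub> m" for m
    using vc by (induction m) (auto simp: a_def)
  have img: "\<phi> r \<in> ?A" if "r \<in> carrier R" for r
    using that by (intro memI[of _ r 0]) auto
  have "inv\<^sub>F ?x \<in> ?A"
  proof (rule inverse_in_subring)
    show "subring ?A F"
    proof (rule F.subringI)
      show "?A \<subseteq> carrier F" by blast
      show "\<one>\<^sub>F \<in> ?A" using img[OF one_closed] by simp
    next
      fix y assume "y \<in> ?A"
      then obtain m :: nat and r where y: "y \<in> carrier F" "r \<in> carrier R" "a [^]\<^bsub>F\<^esub> m \<otimes>\<^sub>F y = \<phi> r" by blast
      show "\<ominus>\<^bsub>F\<^esub> y \<in> ?A"
        using y ab by (intro memI[of _ "\<ominus> r" m]) (auto simp: F.r_minus)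
    next
      fix y z assume "y \<in> ?A" "z \<in> ?A"
      then obtain m n :: nat and r s where y: "y \<in> carrier F" "r \<in> carrier R" "a [^]\<^bsub>F\<^esub> m \<otimes>\<^sub>F y = \<phi> r"
        and z: "z \<in> carrier F" "s \<in> carrier R" "a [^]\<^bsub>F\<^esub> n \<otimes>\<^sub>F z = \<phi> s" by blast
      define p q where "p = a [^]\<^bsub>F\<^esub> m" and "q = a [^]\<^bsub>F\<^esub> n"
      have pq: "p \<in> carrier F" "q \<in> carrier F" using ab by (auto simp: p_def q_def)
      have e: "a [^]\<^bsub>F\<^esub> (m + n) = p \<otimes>\<^sub>F q" using ab by (simp add: F.nat_pow_mult p_def q_def)
      have "(p \<otimes>\<^sub>F q) \<otimes>\<^sub>F (y \<otimes>\<^sub>F z) = (p \<otimes>\<^sub>F y) \<otimes>\<^sub>F (q \<otimes>\<^sub>F z)" using pq y(1) z(1) by algebra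
      also have "\<dots> = \<phi> (r \<otimes> s)" using y z by (simp add: p_def q_def)
      finally show "y \<otimes>\<^sub>F z \<in> ?A" using y z e by (intro memI[of _ "r \<otimes> s" "m + n"]) auto
      have "(p \<otimes>\<^sub>F q) \<otimes>\<^sub>F (y \<oplus>\<^bsub>F\<^esub> z) = q \<otimes>\<^sub>F (p \<otimes>\<^sub>F y) \<oplus>\<^bsub>F\<^esub> p \<otimes>\<^sub>F (q \<otimes>\<^sub>F z)" using pq y(1) z(1) by algebra
      also have "\<dots> = \<phi> (v [^] n \<otimes> r \<oplus> v [^] m \<otimes> s)" using y z vc by (simp add: p_def q_def pw)
      finally show "y \<oplus>\<^bsub>F\<^esub> z \<in> ?A"
        using y z e vc by (intro memI[of _ "v [^] n \<otimes> r \<oplus> v [^] m \<otimes> s" "m + n"]) auto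
    qed
    show "kP \<subseteq> ?A" using img by (auto simp: base_image_eq)
    show "?x \<in> ?A"
      using x ax vc(2) ab by (intro memI[of _ f 1]) (auto simp: b_def)
    show "?x \<noteq> \<zero>\<^sub>F" by (rule xn)
    show "F.algebraic (kP) ?x" using alg by (simp add: i_def b_def)
  qed
  then obtain m :: nat and r where r: "r \<in> carrier R" "a [^]\<^bsub>F\<^esub> m \<otimes>\<^sub>F inv\<^sub>F ?x = \<phi> r" by blast
  have ix: "inv\<^sub>F ?x \<in> carrier F" "inv\<^sub>F ?x \<otimes>\<^sub>F ?x = \<one>\<^sub>F" using x xn F.field_Units by auto
  have am: "a [^]\<^bsub>F\<^esub> m \<in> carrier F" using ab by simp
  \<comment> \<open>From \<open>v^m (v/f) = r\<close> it follows that \<open>v^(m+1) = r f\<close>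
    modulo \<open>P\<close>, and \<open>f\<close> lies in \<open>Q\<close>.\<close>
  have "\<phi> (v [^] Suc m) = a [^]\<^bsub>F\<^esub> m \<otimes>\<^sub>F a \<otimes>\<^sub>F (inv\<^sub>F ?x \<otimes>\<^sub>F ?x)"
    unfolding ix(2) pw using ab am by simp
  also have "\<dots> = (a [^]\<^bsub>F\<^esub> m \<otimes>\<^sub>F inv\<^sub>F ?x) \<otimes>\<^sub>F (a \<otimes>\<^sub>F ?x)"
  proof -
    define j y where "j = inv\<^sub>F ?x" and "y = ?x"
    have "j \<in> carrier F" "y \<in> carrier F" using ix(1) x by (auto simp: j_def y_def)
    thus ?thesis unfolding j_def[symmetric] unfolding y_def[symmetric] using am ab(1) by (simp add: F.m_ac)
  qed
  also have "\<dots> = \<phi> (r \<otimes> f)" unfolding r(2) ax using r(1) vc by (simp add: b_def)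
  finally have "v [^] Suc m \<ominus> r \<otimes> f \<in> P"
    using phi_eq_iff[of "v [^] Suc m" "r \<otimes> f"] vc r(1) by auto
  hence "v [^] Suc m \<ominus> r \<otimes> f \<in> Q" using Q(2) by blast
  moreover have "r \<otimes> f \<in> Q" using ideal_facts(5)[OF Qid r(1) Q(3)] .
  ultimately have "(v [^] Suc m \<ominus> r \<otimes> f) \<oplus> r \<otimes> f \<in> Q" by (rule ideal_facts(3)[OF Qid])
  moreover have "(v [^] Suc m \<ominus> r \<otimes> f) \<oplus> r \<otimes> f = v [^] Suc m"
    using vc r(1) by (simp add: minus_eq a_assoc l_neg)
  ultimately have "v [^] Suc m \<in> Q" by simp
  thus ?thesis using prime_pow_notin[OF Q(1), of v "Suc m"] vc by blast
qed

text \<open>Start from any \<open>f\<close> in \<open>Q - P\<close>, written in the span of finitely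
  many members of \<open>G\<close>. Descent on their number ends with one of the spanning elements
  itself lying in \<open>Q - P\<close>.\<close>

theorem rational_separating:
  assumes rat: "\<And>x. x \<in> Z \<Longrightarrow> F.algebraic (kP) x"
    and Q: "Q \<in> DSpec" "P \<subset> Q"
  shows "\<exists>d\<in>G. d \<in> Q \<and> d \<notin> P"
proof -
  have Qid: "ideal Q R" and Qp: "primeideal Q R" and Qd: "Dideal Q" using delta_specD[OF Q(1)] by auto
  have main: "\<exists>d\<in>G. d \<in> Q \<and> d \<notin> P"
    if "finite T" "card T \<le> n" "T \<subseteq> G" "f \<in> alg.ind_span T" "f \<in> Q" "f \<notin> P" for n T f
    using that
  proof (induction n arbitrary: T f)
    case 0
    hence "T = {}" by simp
    hence "f = \<zero>" using 0(4) by (auto elim: alg.ind_span.cases)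
    thus ?case using 0 ideal_facts(2)[OF ideal_P] by simp
  next
    case (Suc n)
    show ?case
    proof (cases "T = {}")
      case True
      hence "f = \<zero>" using Suc.prems(4) by (auto elim: alg.ind_span.cases)
      thus ?thesis using Suc.prems ideal_facts(2)[OF ideal_P] by simp
    next
      case False
      then obtain v where v: "v \<in> T" by blast
      let ?T = "T - {v}"
      have T: "insert v ?T = T" using v by blast
      have Tc: "T \<subseteq> carrier R" using Suc.prems(3) G_closed by blast
      have T': "finite ?T" "card ?T \<le> n" "?T \<subseteq> G" using Suc.prems v by auto
      have vc: "v \<in> carrier R" using v Tc by blast
      have fc: "f \<in> carrier R" using Suc.prems(5) ideal_facts(1)[OF Qid] by blast
      obtain a h where a: "a \<in> carrier K" and h: "h \<in> alg.ind_span ?T" and f: "f = a \<odot> v \<oplus> h"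
        using alg.ind_span_insert[of v ?T f] Suc.prems(4) Tc T by auto
      have hc: "h \<in> carrier R" using h alg.ind_span_closed[of ?T] Tc by blast
      have avc: "a \<odot> v \<in> carrier R" using a vc by simp
      show ?thesis
      proof (cases "v \<in> P")
        case True
        \<comment> \<open>When \<open>v\<close> lies in \<open>P\<close>, its term is dropped; the
          remainder \<open>h\<close> is still in \<open>Q\<close> and outside
          \<open>P\<close>.\<close>
        have av: "a \<odot> v \<in> P" using smult_ideal[OF ideal_P a True] .
        have "h \<oplus> a \<odot> v \<in> Q" using Suc.prems(5) f hc avc by (simp add: a_comm)
        hence "h \<in> Q" using ideal_add_cancel[OF Qid _ hc] av Q(2) by blast
        moreover have "h \<notin> P" using Suc.prems(6) f ideal_facts(3)[OF ideal_P av] by blast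
        ultimately show ?thesis using Suc.IH[OF T' h] by blast
      next
        case False
        hence vP: "v \<in> carrier R - P" using vc by simp
        show ?thesis
        proof (cases "\<forall>\<delta>\<in>\<Delta>. wronskian R \<delta> v f \<in> P")
          case True
          \<comment> \<open>All Wronskians lie in \<open>P\<close>, so \<open>f/v\<close> is
            constant and by rationality algebraic; then \<open>v\<close> itself is the element
            sought.\<close>
          have "v \<in> Q"
            by (rule algebraic_ratio_mem[OF vP _ rat[OF const_ratio[OF vP fc]] Qp])
              (use True fc Suc.prems Q in auto)
          thus ?thesis using v Suc.prems(3) False by blast
        next
          case False
          then obtain \<delta> where d: "\<delta> \<in> \<Delta>" "wronskian R \<delta> v f \<notin> P" by blast
          let ?W = "wronskian R \<delta> v"
          have "?W f = ?W (a \<odot> v) \<oplus> ?W h" unfolding f by (rule wronskian_add[OF d(1) vc avc hc])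
          \<comment> \<open>Taking the Wronskian with \<open>v\<close> annihilates the
            \<open>v\<close> component, so one spanning element fewer is left, and the images of the
            others are again in \<open>G\<close>. The new element stays in \<open>Q\<close> because
            \<open>Q\<close> is a \<Delta>-ideal.\<close>
          also have "?W (a \<odot> v) = \<zero>"
            using wronskian_smult[OF d(1) vc vc a] wronskian_self[OF d(1) vc] a by simp
          finally have eq: "?W f = ?W h" using wronskian_closed[OF d(1) vc hc] by simp
          have sp: "?W f \<in> alg.ind_span (?W ` ?T)"
            unfolding eq by (rule wronskian_ind_span[OF d(1) vc _ h]) (use Tc in blast)
          have "?W f \<in> Q"
            unfolding wronskian_def
            using ideal_facts(4)[OF Qid ideal_facts(5)[OF Qid vc delta_idealD(2)[OF Qd d(1) Suc.prems(5)]]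
              ideal_facts(6)[OF Qid der_closed[OF d(1) vc] Suc.prems(5)]] .
          moreover have "?W ` ?T \<subseteq> G" using T'(3) v Suc.prems(3) d(1) by (auto intro!: op_closure.step)
          moreover have "card (?W ` ?T) \<le> n" using card_image_le[OF T'(1)] T'(2) order_trans by blast
          ultimately show ?thesis using Suc.IH[of "?W ` ?T" "?W f"] T'(1) sp d(2) by blast
        qed
      qed
    qed
  qed
  obtain f where f: "f \<in> Q" "f \<notin> P" using Q(2) by blast
  obtain T where T: "finite T" "T \<subseteq> B" "f \<in> alg.ind_span T"
    using alg.ex_finite_ind_span[OF spanning(2,1), of f] f(1) ideal_facts(1)[OF Qid] by blast
  have "T \<subseteq> G" using T(2) by (auto intro: op_closure.base)
  thus ?thesis using main[OF T(1) order_refl _ T(3) f] by blast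
qed

end

section \<open>The equivalence\<close>

context small_diff_algebra
begin

lemma prime_pointI: "primeideal P R \<Longrightarrow> prime_point R \<Delta> K B P"
  using small_diff_algebra_axioms by (intro prime_point.intro prime_point_axioms.intro)

lemma delta_prime_pointI: "P \<in> DSpec \<Longrightarrow> delta_prime_point R \<Delta> K B P"
  using delta_specD[of P]
  by (intro delta_prime_point.intro prime_pointI delta_prime_point_axioms.intro)

lemma card_of_G:
  assumes "infinite B"
  shows "|G| \<le>o |B <+> \<Delta>|"
  using assms by (intro card_of_op_closure card_of_Plus1 card_of_Plus2) simp

theorem primitive_imp_rational:
  assumes "delta_primitive R \<Delta> P"
  shows "P \<in> DSpec" "delta_rational K R \<Delta> P"
proof -
  obtain M where M: "maximalideal M R" "P = core M"
    using assms by (auto simp: delta_primitive_def)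
  have Mp: "primeideal M R" by (rule maximalideal_prime[OF M(1)])
  show P: "P \<in> DSpec"
    unfolding M(2) using delta_core_facts(1)[OF primeideal.axioms(1)[OF Mp]] delta_core_prime[OF Mp]
    by (rule delta_specI)
  interpret delta_prime_point R \<Delta> K B P by (rule delta_prime_pointI[OF P])
  show "delta_rational K R \<Delta> P"
    using P primitive_const_algebraic[OF M] by (auto simp: delta_rational_def delta_spec_def)
qed

text \<open>Fewer than \<open>|carrier K|\<close> elements \<open>d\<close> outside \<open>P\<close>
  meet all \<Delta>-primes strictly above \<open>P\<close>. Each \<open>d\<close> contributes the
  finitely many \<Delta>-primes minorizing those that contain \<open>P\<close> and
  \<open>d\<close>.\<close>

theorem rational_imp_separable:
  assumes rat: "delta_rational K R \<Delta> P"
  shows "P \<in> DSpec" "top_separable |carrier K| DTop P"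
proof -
  show P: "P \<in> DSpec" using rat by (simp add: delta_rational_def delta_spec_def)
  interpret delta_prime_point R \<Delta> K B P by (rule delta_prime_pointI[OF P])
  show "top_separable |carrier K| DTop P"
  \<comment> \<open>For finite \<open>B\<close> the set \<open>G\<close> may be as large as a
    countable field, but \<open>P\<close> is then maximal and nothing lies strictly above
    it.\<close>
  proof (cases "finite B")
    case True
    have "maximalideal P R" by (rule finite_dimensional_prime_maximal[OF True prime_P])
    hence no: "\<not> P \<subset> Q" if "Q \<in> DSpec" for Q
      using maximalideal.I_maximal[of P R Q] delta_specD[OF that] ideal_facts(1)[of Q] primeideal.I_notcarr[of Q R]
      by blast
    have "|{} :: 'a set set| <o |carrier K|" by (rule finite_ordLess_infinite2[OF _ scalars_infinite]) simp
    thus ?thesis using no by (intro top_separable_delta_specI[OF P, of "{}"]) auto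
  next
    case False
    let ?Y = "B <+> \<Delta>"
    have Y: "infinite ?Y" "|?Y| <o |carrier K|"
      using False card_of_Plus_ordLess_infinite[OF scalars_infinite spanning(3) derivations_small] by auto
    \<comment> \<open>The \<Delta>-ideal generated by \<open>P\<close> and \<open>d\<close>.\<close>
    define I where "I d = \<Inter>{J. Dideal J \<and> P \<subseteq> J \<and> d \<in> J}" for d
    have I: "Dideal (I d)" "P \<subseteq> I d" "d \<in> I d" if "d \<in> carrier R" for d
    proof -
      have "carrier R \<in> {J. Dideal J \<and> P \<subseteq> J \<and> d \<in> J}"
        using that delta_ideal_carrier ideal_facts(1)[OF ideal_P] by blast
      thus "Dideal (I d)" unfolding I_def by (intro delta_ideal_Inter) auto
      show "P \<subseteq> I d" "d \<in> I d" by (auto simp: I_def)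
    qed
    have "\<exists>\<Lambda>. minorants (I d) \<Lambda>" if "d \<in> G" for d
    proof -
      have "d \<in> carrier R" using that G_closed by blast
      note d = I(1)[OF this]
      show ?thesis by (rule finite_minimal_delta_primes[OF delta_idealD(1)[OF d], THEN mp, OF d])
    qed
    hence "\<exists>L. \<forall>d\<in>G. minorants (I d) (L d)"
      by (intro bchoice ballI)
    then obtain L where L0: "\<forall>d\<in>G. minorants (I d) (L d)" by (rule exE)
    have L: "finite (L d)" "L d \<subseteq> DSpec" "\<forall>q\<in>L d. I d \<subseteq> q"
        "\<forall>Q\<in>DSpec. I d \<subseteq> Q \<longrightarrow> (\<exists>q\<in>L d. q \<subseteq> Q)" if "d \<in> G" for d
      using bspec[OF L0 that] by - (elim conjE, assumption)+
    let ?\<Lambda> = "\<Union>d\<in>G - P. L d"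
    show ?thesis
    proof (rule top_separable_delta_specI[OF P])
      show "?\<Lambda> \<subseteq> {Q \<in> DSpec. P \<subset> Q}"
      proof
        fix q assume "q \<in> ?\<Lambda>"
        then obtain d where d: "d \<in> G" "d \<notin> P" "q \<in> L d" by blast
        have dc: "d \<in> carrier R" using d(1) G_closed by blast
        have "P \<subset> q" using I(2,3)[OF dc] bspec[OF L(3)[OF d(1)] d(3)] d(2) by blast
        thus "q \<in> {Q \<in> DSpec. P \<subset> Q}" using L(2)[OF d(1)] d(3) by blast
      qed
      have "|G - P| \<le>o |?Y|"
        using card_of_mono1[OF Diff_subset, of G P] card_of_G[OF False] by (rule ordLeq_transitive)
      moreover have "|L d| \<le>o |?Y|" if "d \<in> G - P" for d
        using that finite_ordLess_infinite2[OF _ Y(1)] L(1) by (blast intro: ordLess_imp_ordLeq)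
      ultimately have "|?\<Lambda>| \<le>o |?Y|" using Y(1) by (intro card_of_UNION_ordLeq_infinite) auto
      thus "|?\<Lambda>| <o |carrier K|" using Y(2) by (rule ordLeq_ordLess_trans)
      fix Q assume Q: "Q \<in> DSpec" "P \<subset> Q"
      have "\<exists>d\<in>G. d \<in> Q \<and> d \<notin> P"
        using rat by (intro rational_separating[OF _ Q]) (auto simp: delta_rational_def)
      then obtain d where d: "d \<in> G" "d \<in> Q" "d \<notin> P" by blast
      have "I d \<subseteq> Q" using Q d(2) delta_specD(1)[OF Q(1)] by (auto simp: I_def)
      hence "\<exists>q\<in>L d. q \<subseteq> Q" by (rule bspec[OF L(4)[OF d(1)] Q(1), THEN mp])
      then obtain q where "q \<in> L d" "q \<subseteq> Q" by blast
      thus "\<exists>q\<in>?\<Lambda>. q \<subseteq> Q" using d by blast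
    qed
  qed
qed

text \<open>A maximal ideal \<open>N\<close> over \<open>P\<close> that misses an element
  \<open>f q\<close> of each \<open>q\<close> in a coinitial set has core \<open>P\<close>: a larger
  core would be a \<Delta>-prime containing some \<open>q\<close>.\<close>

theorem separable_imp_primitive:
  assumes P: "P \<in> DSpec" and sep: "top_separable |carrier K| DTop P"
  shows "delta_primitive R \<Delta> P"
proof -
  note Pp = delta_specD(2)[OF P] and Pid = delta_specD(3)[OF P] and Pd = delta_specD(1)[OF P]
  obtain \<Lambda> where L: "\<Lambda> \<subseteq> {Q \<in> DSpec. P \<subset> Q}" "|\<Lambda>| <o |carrier K|"
    "\<forall>Q\<in>DSpec. P \<subset> Q \<longrightarrow> (\<exists>q\<in>\<Lambda>. q \<subseteq> Q)"
    using sep by (rule top_separable_delta_specE[OF P])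
  have "\<forall>q\<in>\<Lambda>. \<exists>f. f \<in> q \<and> f \<notin> P" using L(1) by blast
  then obtain f where f: "\<And>q. q \<in> \<Lambda> \<Longrightarrow> f q \<in> q" "\<And>q. q \<in> \<Lambda> \<Longrightarrow> f q \<notin> P" by metis
  have "\<exists>N. maximalideal N R \<and> P \<subseteq> N \<and> (\<forall>q\<in>\<Lambda>. f q \<notin> N)"
  proof (cases "finite B")
    case True
    \<comment> \<open>In finite dimension \<open>P\<close> is already maximal and serves as
      \<open>N\<close>.\<close>
    thus ?thesis using finite_dimensional_prime_maximal[OF True Pp] f(2) by blast
  next
    case False
    let ?Y = "B <+> \<Lambda>"
    have Y: "infinite ?Y" "|?Y| <o |carrier K|"
      using False card_of_Plus_ordLess_infinite[OF scalars_infinite spanning(3) L(2)] by auto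
    \<comment> \<open>The element one keeps the multiplicative set nonempty when no \<Delta>-prime
      lies strictly above \<open>P\<close>.\<close>
    let ?F = "insert \<one> (f ` \<Lambda>)"
    let ?S = "op_closure {()} (\<lambda>_. (\<otimes>)) ?F"
    have "|f ` \<Lambda>| \<le>o |?Y|" using card_of_image card_of_Plus2 by (rule ordLeq_transitive)
    hence F: "|?F| \<le>o |?Y|" by (rule card_of_insert_ordLeq_infinite[OF Y(1)])
    have "|{()}| \<le>o |?Y|" by (intro ordLess_imp_ordLeq finite_ordLess_infinite2[OF _ Y(1)]) simp
    hence S: "|?S| <o |carrier K|" using card_of_op_closure[OF Y(1) _ F] Y(2) ordLeq_ordLess_trans by blast
    have SP: "?S \<subseteq> carrier R - P"
    proof
      fix x assume "x \<in> ?S"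
      thus "x \<in> carrier R - P"
      proof induction
        case (base a)
        have "f q \<in> carrier R" if "q \<in> \<Lambda>" for q
          using f(1)[OF that] L(1) that delta_specD(3) ideal_facts(1) by blast
        thus ?case using base f(2) prime_one_notin[OF Pp] by auto
      next
        case (step i a b)
        thus ?case using prime_mult_notin[OF Pp] by blast
      qed
    qed
    have one: "\<one> \<in> ?S" by (intro op_closure.base) simp
    have mult: "x \<otimes> y \<in> ?S" if "x \<in> ?S" "y \<in> ?S" for x y using op_closure.step[OF _ that] by simp
    have Sc: "?S \<noteq> {}" "?S \<subseteq> carrier R" "P \<inter> ?S = {}" using one SP by blast+
    have "\<exists>N. primeideal N R \<and> P \<subseteq> N \<and> N \<inter> ?S = {} \<and> (\<forall>L. ideal L R \<longrightarrow> N \<subset> L \<longrightarrow> L \<inter> ?S \<noteq> {})"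
      by (rule ex_prime_disjoint[OF Sc(1,2) mult Pid Sc(3)])
    then obtain N where N: "primeideal N R" "P \<subseteq> N" "N \<inter> ?S = {}"
      "\<forall>L. ideal L R \<longrightarrow> N \<subset> L \<longrightarrow> L \<inter> ?S \<noteq> {}" by (elim exE conjE)
    have SN: "?S \<subseteq> carrier R - N" using SP N(3) by blast
    have "maximalideal N R"
      by (rule prime_point.maximal_if_small_multiplicative_set[OF prime_pointI[OF N(1)] False SN S]) (simp add: N(4))
    moreover have "f q \<notin> N" if "q \<in> \<Lambda>" for q
    proof -
      have "f q \<in> ?S" using that by (intro op_closure.base) simp
      thus ?thesis using N(3) by blast
    qed
    ultimately show ?thesis using N(2) by blast
  qed
  then obtain N where N: "maximalideal N R" "P \<subseteq> N" "\<And>q. q \<in> \<Lambda> \<Longrightarrow> f q \<notin> N" by blast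
  note C = delta_core_facts[OF maximalideal.axioms(1)[OF N(1)]]
  have Cs: "core N \<in> DSpec"
    using C(1) delta_core_prime[OF maximalideal_prime[OF N(1)]] by (rule delta_specI)
  have "P = core N"
  proof (rule ccontr)
    assume "P \<noteq> core N"
    hence "P \<subset> core N" using C(3)[OF Pd N(2)] by blast
    then obtain q where q: "q \<in> \<Lambda>" "q \<subseteq> core N" using L(3) Cs by blast
    have "f q \<in> N" using f(1)[OF q(1)] q(2) C(2) by blast
    thus False using N(3)[OF q(1)] by simp
  qed
  thus ?thesis using N(1) by (auto simp: delta_primitive_def)
qed

lemma aleph0_separable_imp_separable:
  assumes "P \<in> DSpec" "top_separable natLeq DTop P"
  shows "top_separable |carrier K| DTop P"
proof -
  obtain \<Lambda> where L: "\<Lambda> \<subseteq> {Q \<in> DSpec. P \<subset> Q}" "|\<Lambda>| <o natLeq"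
    "\<forall>Q\<in>DSpec. P \<subset> Q \<longrightarrow> (\<exists>q\<in>\<Lambda>. q \<subseteq> Q)"
    using assms(2) by (rule top_separable_delta_specE[OF assms(1)])
  have "natLeq \<le>o |carrier K|" using scalars_infinite infinite_iff_natLeq_ordLeq by blast
  hence "|\<Lambda>| <o |carrier K|" using L(2) ordLess_ordLeq_trans by blast
  thus ?thesis using L(3) by (intro top_separable_delta_specI[OF assms(1) L(1)]) auto
qed

abbreviation "locally_closed P \<equiv> locally_closed_pt DTop P"

lemma primitive_iff_rational: "delta_primitive R \<Delta> P \<longleftrightarrow> delta_rational K R \<Delta> P"
  and primitive_iff_separable: "delta_primitive R \<Delta> P \<longleftrightarrow>
    P \<in> DSpec \<and> top_separable |carrier K| DTop P"
  using primitive_imp_rational rational_imp_separable separable_imp_primitive by metis+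

lemma locally_closed_imp_primitive:
  "P \<in> DSpec \<Longrightarrow> locally_closed P \<Longrightarrow> delta_primitive R \<Delta> P"
  using locally_closed_iff_top_separable aleph0_separable_imp_separable separable_imp_primitive by blast

text \<open>Locally closed points are always primitive, and primitive always agrees with rational,
  so primitive implies locally closed is the one implication that can fail.\<close>

lemma DME_iff_primitive:
  "DME K R \<Delta> \<longleftrightarrow> (\<forall>P. delta_primitive R \<Delta> P \<longrightarrow> locally_closed P)"
  unfolding DME_def
  using primitive_iff_rational primitive_imp_rational(1) locally_closed_imp_primitive by metis

lemma DME_iff_rational:
  "DME K R \<Delta> \<longleftrightarrow> (\<forall>P. delta_rational K R \<Delta> P \<longrightarrow> locally_closed P)"
  by (simp add: DME_iff_primitive primitive_iff_rational)

lemma DME_iff_top_separable: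
  "DME K R \<Delta> \<longleftrightarrow> (\<forall>P\<in>DSpec. top_separable |carrier K| DTop P \<longrightarrow>
    top_separable natLeq DTop P)"
proof -
  have "(delta_primitive R \<Delta> P \<longrightarrow> locally_closed P) \<longleftrightarrow>
    (P \<in> DSpec \<longrightarrow> top_separable |carrier K| DTop P \<longrightarrow>
    top_separable natLeq DTop P)" for P
    using primitive_iff_separable[of P] locally_closed_iff_top_separable[of P] by argo
  thus ?thesis unfolding DME_iff_primitive Ball_def by (rule iff_allI)
qed

lemma DME_iff_poset_separable:
  "DME K R \<Delta> \<longleftrightarrow> (\<forall>P\<in>DSpec. poset_separable |carrier K| DSpec P \<longrightarrow>
    poset_separable natLeq DSpec P)"
  unfolding DME_iff_top_separable by (intro ball_cong refl) (simp add: top_separable_iff_poset_separable)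

end

section \<open>From the hypotheses of the theorem to the working locale\<close>

lemma (in ring) char_zero_infinite:
  assumes "char_zero R"
  shows "infinite (carrier R)"
proof -
  have "inj (\<lambda>n::nat. [n] \<cdot> \<one>)"
  proof (rule linorder_injI)
    fix m n :: nat assume "m < n"
    then obtain k where k: "n = m + k" "k > 0" using less_imp_add_positive by blast
    show "[m] \<cdot> \<one> \<noteq> [n] \<cdot> \<one>"
    proof
      assume e: "[m] \<cdot> \<one> = [n] \<cdot> \<one>"
      have "[m] \<cdot> \<one> \<oplus> [k] \<cdot> \<one> = [m] \<cdot> \<one>" using e k add.nat_pow_mult[of \<one> m k] by simp
      hence "[k] \<cdot> \<one> = \<zero>" by (simp add: add.l_cancel_one)
      thus False using assms k(2) by (auto simp: char_zero_def)
    qed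
  qed
  moreover have "range (\<lambda>n::nat. [n] \<cdot> \<one>) \<subseteq> carrier R" by auto
  ultimately show ?thesis using infinite_UNIV_nat finite_subset finite_imageD by blast
qed

text \<open>Positive integers of \<open>R\<close> are images of nonzero scalars, whose inverses in
  \<open>K\<close> map to inverses in \<open>R\<close>.\<close>

lemma small_diff_algebraI:
  fixes K :: "('k, 'm) ring_scheme" and R :: "('k, 'a, 'n) module_scheme"
    and \<Delta> :: "('a \<Rightarrow> 'a) set"
  assumes K: "field K" "char_zero K" and R: "comm_diff_algebra K R \<Delta>" "noetherian_ring R"
    and B: "lin_basis K R B" "|B| <o |carrier K|" and small: "|\<Delta>| <o |carrier K|"
  shows "small_diff_algebra R \<Delta> K B"
proof -
  interpret K: field K by fact
  interpret A: comm_diff_algebra K R \<Delta> by fact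
  interpret N: noetherian_ring R by fact
  have cr: "cring R" by (rule A.M_cring)
  have pow: "add_pow R n \<one>\<^bsub>R\<^esub> = add_pow K n \<one>\<^bsub>K\<^esub> \<odot>\<^bsub>R\<^esub> \<one>\<^bsub>R\<^esub>" for n :: nat
    by (induction n) (simp_all add: A.smult_l_distr)
  have unit: "add_pow R n \<one>\<^bsub>R\<^esub> \<in> Units R" if n: "n > 0" for n :: nat
  proof -
    define c where "c = add_pow K n \<one>\<^bsub>K\<^esub>"
    have c: "c \<in> carrier K" "c \<noteq> \<zero>\<^bsub>K\<^esub>" using K(2) n by (auto simp: c_def char_zero_def)
    have i: "inv\<^bsub>K\<^esub> c \<in> carrier K" "c \<otimes>\<^bsub>K\<^esub> inv\<^bsub>K\<^esub> c = \<one>\<^bsub>K\<^esub>" using c K.field_Units by auto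
    have m: "(a \<odot>\<^bsub>R\<^esub> \<one>\<^bsub>R\<^esub>) \<otimes>\<^bsub>R\<^esub> (b \<odot>\<^bsub>R\<^esub> \<one>\<^bsub>R\<^esub>) = (a \<otimes>\<^bsub>K\<^esub> b) \<odot>\<^bsub>R\<^esub> \<one>\<^bsub>R\<^esub>"
      if "a \<in> carrier K" "b \<in> carrier K" for a b
      using that A.smult_assoc2[of a "\<one>\<^bsub>R\<^esub>" "b \<odot>\<^bsub>R\<^esub> \<one>\<^bsub>R\<^esub>"] by (simp add: A.smult_assoc1)
    have "(c \<odot>\<^bsub>R\<^esub> \<one>\<^bsub>R\<^esub>) \<otimes>\<^bsub>R\<^esub> (inv\<^bsub>K\<^esub> c \<odot>\<^bsub>R\<^esub> \<one>\<^bsub>R\<^esub>) = \<one>\<^bsub>R\<^esub>" using m[OF c(1) i(1)] i by simp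
    moreover have "(inv\<^bsub>K\<^esub> c \<odot>\<^bsub>R\<^esub> \<one>\<^bsub>R\<^esub>) \<otimes>\<^bsub>R\<^esub> (c \<odot>\<^bsub>R\<^esub> \<one>\<^bsub>R\<^esub>) = \<one>\<^bsub>R\<^esub>"
      using m[OF i(1) c(1)] i c by (simp add: K.m_comm)
    ultimately show ?thesis
      unfolding pow c_def[symmetric] Units_def using c i by auto
  qed
  have nd: "noetherian_diff_ring R \<Delta>"
  proof (intro noetherian_diff_ring.intro noetherian_cring.intro noetherian_diff_ring_axioms.intro)
    show "\<delta> \<in> \<Delta> \<Longrightarrow> \<delta> \<in> ring_der R" for \<delta> using A.derivations by (auto simp: Der_def)
  qed (use R(2) cr unit in auto)
  show ?thesis
  proof (intro small_diff_algebra.intro small_diff_algebra_axioms.intro)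
    show "infinite (carrier K)" using ring.char_zero_infinite[OF _ K(2)] cring.axioms(1)[OF A.R_cring] by blast
    show "B \<subseteq> carrier R" "lin_span K R B = carrier R" using B(1) by (auto simp: lin_basis_def)
    show "\<delta> (c \<odot>\<^bsub>R\<^esub> a) = c \<odot>\<^bsub>R\<^esub> \<delta> a" if "\<delta> \<in> \<Delta>" "c \<in> carrier K" "a \<in> carrier R" for \<delta> c a
      using A.derivations that by (auto simp: Der_def)
  qed (use nd K B(2) small A.algebra_axioms in auto)
qed

theorem theorem4p6:
  fixes K :: "('k, 'm) ring_scheme" and R :: "('k, 'a, 'n) module_scheme"
    and \<Delta> :: "('a \<Rightarrow> 'a) set"
  assumes "field K" and "char_zero K"
    and "comm_diff_algebra K R \<Delta>"
    and "noetherian_ring R"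
    and "\<exists>B. lin_basis K R B \<and> |B| <o |carrier K|"
    and "|\<Delta>| <o |carrier K|"
  shows "(DME K R \<Delta> \<longleftrightarrow>
           (\<forall>P. delta_rational K R \<Delta> P \<longrightarrow> locally_closed_pt (delta_spec_topology R \<Delta>) P)) \<and>
         (DME K R \<Delta> \<longleftrightarrow>
           (\<forall>P. delta_primitive R \<Delta> P \<longrightarrow> locally_closed_pt (delta_spec_topology R \<Delta>) P)) \<and>
         (DME K R \<Delta> \<longleftrightarrow>
           (\<forall>P\<in>delta_spec R \<Delta>.
              top_separable |carrier K| (delta_spec_topology R \<Delta>) P \<longrightarrow>
              top_separable natLeq (delta_spec_topology R \<Delta>) P)) \<and>
         (DME K R \<Delta> \<longleftrightarrow>
           (\<forall>P\<in>delta_spec R \<Delta>.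
              poset_separable |carrier K| (delta_spec R \<Delta>) P \<longrightarrow>
              poset_separable natLeq (delta_spec R \<Delta>) P))"
proof -
  obtain B where "lin_basis K R B" "|B| <o |carrier K|" using assms(5) by blast
  then interpret small_diff_algebra R \<Delta> K B
    using assms by (intro small_diff_algebraI)
  show ?thesis
    using DME_iff_rational DME_iff_primitive DME_iff_top_separable DME_iff_poset_separable
    by (intro conjI)
qed

end
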